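(* Let $n\ge0$ and let $\lambda$ be a partition with $l(\lambda)\le 2n+1$, regarded as a vector $(\lambda_1,\dots,\lambda_{2n+1})$ with $2n+1$ parts (zeros allowed). Let $\alpha\in\mathbb{C}$. Then $$\frac{1-\alpha}{\int_T\tilde\Delta_K^{(n)}(x;t,-1,\sqrt t,-\sqrt t;t)\,dT}\int_T P_\lambda(x_1^{\pm1},\dots,x_n^{\pm1},1;t)\,\tilde\Delta_K^{(n)}(x;t,-1,\sqrt t,-\sqrt t;t)\prod_{i=1}^n(1-\alpha x_i^{\pm1})\,dT$$ $$=\frac{\phi_{2n+1}(t)}{v_\lambda(t)(1-t)^{2n+1}}\Big[(-\alpha)^{\#\text{ of odd parts of }\lambda}+(-\alpha)^{\#\text{ of even parts of }\lambda}\Big].$$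
   Context: Let $t\in\mathbb{C}$ with $|t|<1$ and fix a square root $\sqrt t$. $T=\{(x_1,\dots,x_k):|x_1|=\dots=|x_k|=1\}$ is the torus in the variables of integration, $dT=\prod_j \frac{dx_j}{2\pi\sqrt{-1}\,x_j}$ (when there are no variables, the integral is evaluation). $[i]=(1-t^i)/(1-t)$, $[m]!=[m][m-1]\cdots[1]$, $[0]!=1$; $\phi_r(t)=(1-t)(1-t^2)\cdots(1-t^r)$. For a partition $\lambda$ with $N$ parts (zeros included), $m_i(\lambda)$ is the number of $j\in\{1,\dots,N\}$ with $\lambda_j=i$, and $v_\lambda(t)=\prod_{i\ge0}[m_i(\lambda)]!$ (zero parts are counted). The Hall--Littlewood polynomial in $N$ variables is $P_\lambda(z_1,\dots,z_N;t)=\frac{1}{v_\lambda(t)}\sum_{w\in S_N}w\Big(z^\lambda\prod_{1\le i<j\le N}\frac{z_i-tz_j}{z_i-z_j}\Big)$, with $w$ permuting the subscripts of the variables. $P_\lambda(x_1^{\pm1},\dots,x_n^{\pm1},1;t)$ is its value at the $2n+1$ arguments $x_1,x_1^{-1},\dots,x_n,x_n^{-1},1$. The symmetric Koornwinder density is $$\tilde\Delta_K^{(k)}(x;a,b,c,d;t)=\frac{1}{2^kk!}\prod_{1\le i\le k}\frac{1-x_i^{\pm2}}{(1-ax_i^{\pm1})(1-bx_i^{\pm1})(1-cx_i^{\pm1})(1-dx_i^{\pm1})}\prod_{1\le i<j\le k}\frac{1-x_i^{\pm1}x_j^{\pm1}}{1-tx_i^{\pm1}x_j^{\pm1}},$$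 where an expression with $\pm$ signs denotes the product over all choices of signs, e.g. $1-x_i^{\pm2}$ means $(1-x_i^2)(1-x_i^{-2})$, $1-\alpha x_i^{\pm1}$ means $(1-\alpha x_i)(1-\alpha x_i^{-1})$, and $1-x_i^{\pm1}x_j^{\pm1}$ is a product of four factors. Common factors (when a parameter equals $\pm1$) are cancelled. The numbers of odd and even parts of $\lambda$ are counted among all $2n+1$ entries, a zero entry being an even part. *)

theory Defs
  imports "HOL-Analysis.Analysis" "HOL-Complex_Analysis.Complex_Analysis"
begin

text \<open>
  Families of variables are functions \<open>nat \<Rightarrow> complex\<close>, indexed from \<open>0\<close>, of which only the first
  \<open>N\<close> (or \<open>k\<close>) values are used. A partition with \<open>N\<close> parts (zeros included) is a weakly decreasing
  list of length \<open>N\<close>.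
\<close>

definition is_partition :: "nat \<Rightarrow> nat list \<Rightarrow> bool" where
  "is_partition N lam \<longleftrightarrow> length lam = N \<and> sorted_wrt (\<ge>) lam"

definition t_number :: "complex \<Rightarrow> nat \<Rightarrow> complex" where
  "t_number t i = (1 - t ^ i) / (1 - t)"

definition t_fact :: "complex \<Rightarrow> nat \<Rightarrow> complex" where
  "t_fact t m = (\<Prod>i=1..m. t_number t i)"

definition phi :: "complex \<Rightarrow> nat \<Rightarrow> complex" where
  "phi t r = (\<Prod>i=1..r. 1 - t ^ i)"

text \<open>Values \<open>i\<close> that do not occur in the partition contribute the factor \<open>[0]! = 1\<close>.\<close>

definition v_part :: "complex \<Rightarrow> nat list \<Rightarrow> complex" where
  "v_part t lam = (\<Prod>i\<in>set lam. t_fact t (count_list lam i))"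

definition HL_formula :: "complex \<Rightarrow> nat list \<Rightarrow> (nat \<Rightarrow> complex) \<Rightarrow> complex" where
  "HL_formula t lam z =
     (let N = length lam in
      1 / v_part t lam *
      (\<Sum>w | w permutes {..<N}.
         (\<Prod>i<N. z (w i) ^ (lam ! i)) *
         (\<Prod>j<N. \<Prod>i<j. (z (w i) - t * z (w j)) / (z (w i) - z (w j)))))"

text \<open>
  The symmetrisation formula is literally meaningful only at points with pairwise distinct
  coordinates, where it agrees with a polynomial. The value of this polynomial at an arbitrary
  point (such as \<open>x, 1/x, 1\<close> with \<open>x = 1\<close>) is the limit of the formula through points with
  pairwise distinct coordinates.
\<close>

definition hall_littlewood :: "complex \<Rightarrow> nat list \<Rightarrow> (nat \<Rightarrow> complex) \<Rightarrow> complex" where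
  "hall_littlewood t lam z =
     Lim (at z within {y. inj_on y {..<length lam}}) (HL_formula t lam)"

text \<open>The arguments \<open>x\<^sub>1, x\<^sub>1\<^sup>-\<^sup>1, \<dots>, x\<^sub>n, x\<^sub>n\<^sup>-\<^sup>1, 1\<close>.\<close>

definition pm_args_one :: "nat \<Rightarrow> (nat \<Rightarrow> complex) \<Rightarrow> nat \<Rightarrow> complex" where
  "pm_args_one n x k =
     (if k < 2 * n then (if even k then x (k div 2) else inverse (x (k div 2))) else 1)"

text \<open>\<open>pm1 a x\<close> is \<open>1 - a x\<^sup>\<plusminus>\<^sup>1\<close> and \<open>pm2 a x y\<close> is \<open>1 - a x\<^sup>\<plusminus>\<^sup>1 y\<^sup>\<plusminus>\<^sup>1\<close>, as products over all signs.\<close>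

definition pm1 :: "complex \<Rightarrow> complex \<Rightarrow> complex" where
  "pm1 a x = (1 - a * x) * (1 - a * inverse x)"

definition pm2 :: "complex \<Rightarrow> complex \<Rightarrow> complex \<Rightarrow> complex" where
  "pm2 a x y = (1 - a * x * y) * (1 - a * x * inverse y) *
               (1 - a * inverse x * y) * (1 - a * inverse x * inverse y)"

text \<open>
  \<open>remove_sings\<close> carries out the cancellation of common factors of numerator and denominator
  in each one-variable factor, e.g. of \<open>1 + x\<^sup>\<plusminus>\<^sup>1\<close> when a parameter is \<open>-1\<close>.
\<close>

definition koornwinder_density ::
  "nat \<Rightarrow> (nat \<Rightarrow> complex) \<Rightarrow> complex \<Rightarrow> complex \<Rightarrow> complex \<Rightarrow> complex \<Rightarrow> complex \<Rightarrow> complex" where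
  "koornwinder_density k x a b c d t =
     1 / (2 ^ k * fact k) *
     (\<Prod>i<k. remove_sings (\<lambda>u. pm1 1 (u\<^sup>2) / (pm1 a u * pm1 b u * pm1 c u * pm1 d u)) (x i)) *
     (\<Prod>j<k. \<Prod>i<j. pm2 1 (x i) (x j) / pm2 t (x i) (x j))"

text \<open>
  Integration over the torus, parametrised by \<open>x\<^sub>j = exp (2\<pi>\<i>\<theta>\<^sub>j)\<close> with \<open>\<theta>\<^sub>j \<in> [0,1]\<close>, so that
  \<open>dx\<^sub>j / (2\<pi>\<i>x\<^sub>j) = d\<theta>\<^sub>j\<close>. For \<open>k = 0\<close> the product measure is a unit point mass.
\<close>

definition torus_integral :: "nat \<Rightarrow> ((nat \<Rightarrow> complex) \<Rightarrow> complex) \<Rightarrow> complex" where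
  "torus_integral k f =
     (LINT \<theta>|PiM {..<k} (\<lambda>_. restrict_space lborel {0..1::real}). f (\<lambda>j. cis (2 * pi * \<theta> j)))"

end

theory Submission
  imports Defs "HOL-Combinatorics.Multiset_Permutations"
begin

text \<open>
  Multiplying \<open>P\<^sub>\<lambda>\<close> by \<open>v\<^sub>\<lambda>(t)\<close> and sorting the symmetrisation by the argument \<open>p\<close> that carries the
  largest part gives a recursion: the sum over \<open>p\<close> of
  \<open>p ^ \<lambda>\<^sub>1 * (\<Prod>q\<noteq>p. (p - t q) / (p - q))\<close> times the same sum for the other parts and the other
  arguments (\<open>hl_sum\<close>). To integrate it, four families of integrals are treated together. For
  \<open>A \<subseteq> {1,-1}\<close> the arguments are the elements of \<open>A\<close> and the pairs \<open>x\<^sub>i, x\<^sub>i\<^sup>-\<^sup>1\<close>, and the density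
  \<open>weight A\<close> has a factor \<open>(1 - e x\<^sub>i\<^sup>\<plusminus>\<^sup>1) / (1 - t e x\<^sub>i\<^sup>\<plusminus>\<^sup>1)\<close> for each \<open>e \<in> A\<close>; the theorem is about
  \<open>A = {1}\<close>, where \<open>weight\<close> is the Koornwinder density up to \<open>2 ^ n n!\<close>.

  The product \<open>\<Prod>q\<noteq>p. (p - t q) / (p - q)\<close> cancels against the density. If \<open>p = e \<in> A\<close>, all
  factors of the density that belong to \<open>e\<close> disappear, and a multiple of the integral for \<open>A - {e}\<close>
  is left. If \<open>p = x\<^sub>i\<^sup>\<plusminus>\<^sup>1\<close>, the factors in \<open>p\<^sup>-\<^sup>1\<close> disappear, and with \<open>u = x\<^sub>i\<close> the two terms together are
  \<open>kern u * g u + kern (1/u) * g (1/u)\<close>, where \<open>kern u = u / (u - 1/u)\<close> and \<open>u * g u\<close> is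
  holomorphic on a disc of radius greater than \<open>1\<close>: all the denominators left have the form \<open>1 - t c u\<close>
  or \<open>1 - t u\<^sup>2\<close>, and \<open>u ^ \<lambda>\<^sub>1\<close> kills the pole at \<open>0\<close> because no later part exceeds \<open>\<lambda>\<^sub>1\<close>. By the mean
  value property the integral over \<open>u\<close> is \<open>(g 1 + g (-1)) / 2\<close> (\<open>circ_integral_kern\<close>). Here
  \<open>g e = 0\<close> for \<open>e \<in> A\<close>, and for \<open>e \<notin> A\<close> the value \<open>g e\<close> is a multiple of the integrand for
  \<open>insert e A\<close> with one variable less. So every step uses up one part and moves one point in
  or out of \<open>A\<close> (\<open>hl_integral_Cons\<close>), and induction on the list of parts solves this
  recursion (\<open>hl_integral_closed_form\<close>). The norm of the density comes from the same formula at
  \<open>\<alpha> = 0\<close> and \<open>\<lambda> = 0\<close>, where the sum has the constant value \<open>[2n+1]!\<close> by Lagrange interpolation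
  (\<open>hl_sum_zero_partition\<close>); in particular it does not vanish.

  Two analytic points need care. Single terms have poles on the torus, so the integral can only be
  split into the sums of a term and its image under \<open>x\<^sub>i \<mapsto> x\<^sub>i\<^sup>-\<^sup>1\<close>. These are bounded
  (\<open>bracket_bounded\<close>), since \<open>u * g u\<close> is Lipschitz under inversion, uniformly in the other variables.
  And the symmetrisation formula makes sense only at pairwise distinct arguments; it extends to a
  polynomial function (\<open>hl_sum_mpoly_fun\<close>), which gives continuity, measurability and bounds.
\<close>

section \<open>Lagrange interpolation\<close>

lemma lagrange_interpolation:
  fixes P :: "'a::field poly"
  assumes "finite Z" "degree P < card Z"
  shows "(\<Sum>p\<in>Z. poly P p * (\<Prod>q\<in>Z-{p}. (u - q) / (p - q))) = poly P u"
proof -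
  define L where "L = (\<Sum>p\<in>Z. smult (poly P p / (\<Prod>q\<in>Z-{p}. p - q)) (\<Prod>q\<in>Z-{p}. [:-q,1:]))"
  have L: "poly L v = (\<Sum>p\<in>Z. poly P p * (\<Prod>q\<in>Z-{p}. (v - q) / (p - q)))" for v
    by (simp add: L_def poly_sum poly_prod prod_dividef algebra_simps)
  have deg: "degree L < card Z"
  proof -
    have "degree L \<le> card Z - 1"
      unfolding L_def
    proof (rule degree_sum_le[OF \<open>finite Z\<close>])
      fix p assume p: "p \<in> Z"
      have "degree (\<Prod>q\<in>Z-{p}. [:-q,1:]) \<le> sum (degree \<circ> (\<lambda>q. [:-q,1:])) (Z-{p})"
        by (rule degree_prod_sum_le) (use assms in auto)
      also have "\<dots> = card Z - 1" using p assms by (simp add: card_Diff_singleton)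
      finally show "degree (smult (poly P p / (\<Prod>q\<in>Z-{p}. p - q)) (\<Prod>q\<in>Z-{p}. [:-q,1:])) \<le> card Z - 1"
        by (meson degree_smult_le order_trans)
    qed
    then show ?thesis using assms by linarith
  qed
  have "poly L v = poly P v" if v: "v \<in> Z" for v
  proof -
    have "poly P p * (\<Prod>q\<in>Z-{p}. (v - q) / (p - q)) = (if p = v then poly P v else 0)" if "p \<in> Z" for p
    proof (cases "p = v")
      case True
      have "(\<Prod>q\<in>Z-{v}. (v - q) / (v - q)) = 1"
        by (intro prod.neutral) auto
      then show ?thesis using True by simp
    next
      case False
      then have "(\<Prod>q\<in>Z-{p}. (v - q) / (p - q)) = 0"
        using v assms by (intro prod_zero) auto
      then show ?thesis using False by simp
    qed
    then have "poly L v = (\<Sum>p\<in>Z. if p = v then poly P v else 0)"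
      unfolding L by (intro sum.cong) auto
    then show ?thesis using v assms by simp
  qed
  then have "L = P"
    by (intro poly_eqI_degree[of Z]) (use deg assms in auto)
  then show ?thesis using L[of u] by simp
qed

text \<open>
  Interpolating the constant \<open>1\<close> at \<open>a\<close> and dividing by \<open>\<Prod>q\<in>Z. a - q\<close>.
\<close>

lemma lagrange_partial_fractions:
  fixes a :: "'a::field"
  assumes "finite Z" "Z \<noteq> {}" "a \<notin> Z"
  shows "1 / (\<Prod>q\<in>Z. a - q) = (\<Sum>p\<in>Z. 1 / ((a - p) * (\<Prod>q\<in>Z-{p}. p - q)))"
proof -
  have nz: "(\<Prod>q\<in>Z. a - q) \<noteq> 0" using assms by auto
  have "1 = (\<Sum>p\<in>Z. (\<Prod>q\<in>Z-{p}. (a - q) / (p - q)))"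
    using lagrange_interpolation[of Z 1 a] assms by (simp add: card_gt_0_iff)
  also have "\<dots> = (\<Sum>p\<in>Z. (\<Prod>q\<in>Z. a - q) * (1 / ((a - p) * (\<Prod>q\<in>Z-{p}. p - q))))"
  proof (rule sum.cong[OF refl])
    fix p assume p: "p \<in> Z"
    then have "a - p \<noteq> 0" using assms by auto
    moreover have "(\<Prod>q\<in>Z. a - q) = (a - p) * (\<Prod>q\<in>Z-{p}. a - q)"
      using p assms by (simp add: prod.remove)
    ultimately show "(\<Prod>q\<in>Z-{p}. (a - q) / (p - q)) =
        (\<Prod>q\<in>Z. a - q) * (1 / ((a - p) * (\<Prod>q\<in>Z-{p}. p - q)))"
      by (simp add: prod_dividef)
  qed
  finally have "1 = (\<Prod>q\<in>Z. a - q) * (\<Sum>p\<in>Z. 1 / ((a - p) * (\<Prod>q\<in>Z-{p}. p - q)))"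
    by (simp add: sum_distrib_left)
  then show ?thesis using nz by (simp add: field_simps)
qed

section \<open>Polynomial functions of a family of variables\<close>

text \<open>
  Closure properties of multivariate polynomials are all that is used of them, so they are taken as
  functions of a family of variables.
\<close>

inductive_set mpoly_fun :: "(('i \<Rightarrow> complex) \<Rightarrow> complex) set" where
  const: "(\<lambda>z. c) \<in> mpoly_fun"
| coord: "(\<lambda>z. z i) \<in> mpoly_fun"
| add: "f \<in> mpoly_fun \<Longrightarrow> g \<in> mpoly_fun \<Longrightarrow> (\<lambda>z. f z + g z) \<in> mpoly_fun"
| mult: "f \<in> mpoly_fun \<Longrightarrow> g \<in> mpoly_fun \<Longrightarrow> (\<lambda>z. f z * g z) \<in> mpoly_fun"

lemma mpoly_fun_diff: "f \<in> mpoly_fun \<Longrightarrow> g \<in> mpoly_fun \<Longrightarrow> (\<lambda>z. f z - g z) \<in> mpoly_fun"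
  using mpoly_fun.add[OF _ mpoly_fun.mult[OF mpoly_fun.const[of "-1"]], of f g] by simp

lemma mpoly_fun_prod: "(\<And>j. j \<in> S \<Longrightarrow> f j \<in> mpoly_fun) \<Longrightarrow> (\<lambda>z. \<Prod>j\<in>S. f j z) \<in> mpoly_fun"
  by (induction S rule: infinite_finite_induct) (auto intro: mpoly_fun.intros)

lemma mpoly_fun_power: "f \<in> mpoly_fun \<Longrightarrow> (\<lambda>z. f z ^ n) \<in> mpoly_fun"
  by (induction n) (auto intro: mpoly_fun.intros)

lemma mpoly_fun_subst: "f \<in> mpoly_fun \<Longrightarrow> (\<lambda>z. f (z(i := z j))) \<in> mpoly_fun"
proof (induction rule: mpoly_fun.induct)
  case (coord k)
  then show ?case by (cases "k = i") (auto intro: mpoly_fun.intros)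
qed (auto intro: mpoly_fun.intros)

lemma mpoly_fun_restrict: "f \<in> mpoly_fun \<Longrightarrow> (\<lambda>z. f (\<lambda>i. if i \<in> J then z i else 0)) \<in> mpoly_fun"
proof (induction rule: mpoly_fun.induct)
  case (coord k)
  then show ?case by (cases "k \<in> J") (auto intro: mpoly_fun.intros)
qed (auto intro: mpoly_fun.intros)

lemma mpoly_fun_one_variable:
  assumes "f \<in> mpoly_fun"
  obtains P where "\<And>u. f (z(i := u)) = poly P u"
proof -
  have "\<exists>P. \<forall>u. f (z(i := u)) = poly P u"
    using assms
  proof (induction rule: mpoly_fun.induct)
    case (const c)
    then show ?case by (intro exI[of _ "[:c:]"]) simp
  next
    case (coord k)
    then show ?case by (intro exI[of _ "if k = i then [:0,1:] else [:z k:]"]) simp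
  next
    case (add f g)
    then obtain P Q where "\<And>u. f (z(i := u)) = poly P u" "\<And>u. g (z(i := u)) = poly Q u" by blast
    then show ?case by (intro exI[of _ "P + Q"]) (simp del: fun_upd_apply)
  next
    case (mult f g)
    then obtain P Q where "\<And>u. f (z(i := u)) = poly P u" "\<And>u. g (z(i := u)) = poly Q u" by blast
    then show ?case by (intro exI[of _ "P * Q"]) (simp del: fun_upd_apply)
  qed
  then show thesis using that by blast
qed

lemma mpoly_fun_continuous: "f \<in> mpoly_fun \<Longrightarrow> continuous_on UNIV f"
  by (induction rule: mpoly_fun.induct) (auto intro!: continuous_intros)

lemma mpoly_fun_measurable:
  assumes "f \<in> mpoly_fun" "\<And>i. (\<lambda>w. z w i) \<in> borel_measurable M"
  shows "(\<lambda>w. f (z w)) \<in> borel_measurable M"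
  using assms by (induction rule: mpoly_fun.induct) auto

text \<open>
  The quotient of \<open>f(z) - f(z')\<close> by \<open>z\<^sub>i - z\<^sub>j\<close>, where \<open>z'\<close> has \<open>z\<^sub>j\<close> also in place \<open>i\<close>, is again
  polynomial; for products this is the Leibniz rule.
\<close>

lemma mpoly_fun_divided_difference:
  assumes "f \<in> mpoly_fun" "i \<noteq> j"
  obtains h where "h \<in> mpoly_fun" "\<And>z. f z - f (z(i := z j)) = (z i - z j) * h z"
proof -
  have "\<exists>h\<in>mpoly_fun. \<forall>z. f z - f (z(i := z j)) = (z i - z j) * h z"
    using assms
  proof (induction rule: mpoly_fun.induct)
    case (const c)
    show ?case by (rule bexI[of _ "\<lambda>z. 0"]) (auto intro: mpoly_fun.intros)
  next
    case (coord k)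
    show ?case
    proof (cases "k = i")
      case True
      then show ?thesis by (intro bexI[of _ "\<lambda>z. 1"]) (auto intro: mpoly_fun.intros)
    next
      case False
      then show ?thesis by (intro bexI[of _ "\<lambda>z. 0"]) (auto intro: mpoly_fun.intros)
    qed
  next
    case (add f g)
    then obtain h1 h2 where h: "h1 \<in> mpoly_fun" "h2 \<in> mpoly_fun"
      "\<And>z. f z - f (z(i := z j)) = (z i - z j) * h1 z" "\<And>z. g z - g (z(i := z j)) = (z i - z j) * h2 z"
      by blast
    have "f z + g z - (f (z(i := z j)) + g (z(i := z j))) = (z i - z j) * (h1 z + h2 z)" for z
    proof -
      have "f z + g z - (f (z(i := z j)) + g (z(i := z j))) = (f z - f (z(i := z j))) + (g z - g (z(i := z j)))"
        by simp
      then show ?thesis unfolding h(3,4) by (simp add: algebra_simps)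
    qed
    then show ?case using h(1,2) by (intro bexI[of _ "\<lambda>z. h1 z + h2 z"]) (auto intro: mpoly_fun.intros simp del: fun_upd_apply)
  next
    case (mult f g)
    then obtain h1 h2 where h: "h1 \<in> mpoly_fun" "h2 \<in> mpoly_fun"
      "\<And>z. f z - f (z(i := z j)) = (z i - z j) * h1 z" "\<And>z. g z - g (z(i := z j)) = (z i - z j) * h2 z"
      by blast
    have "f z * g z - (f (z(i := z j)) * g (z(i := z j)))
        = (z i - z j) * (f z * h2 z + h1 z * g (z(i := z j)))" for z
    proof -
      have "f z * g z - (f (z(i := z j)) * g (z(i := z j)))
         = f z * (g z - g (z(i := z j))) + (f z - f (z(i := z j))) * g (z(i := z j))"
        by (simp add: algebra_simps)
      then show ?thesis unfolding h(3,4) by (simp add: algebra_simps)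
    qed
    then show ?case using h(1,2) mult.hyps
      by (intro bexI[of _ "\<lambda>z. f z * h2 z + h1 z * g (z(i := z j))"] allI
          mpoly_fun.add mpoly_fun.mult mpoly_fun_subst)
  qed
  then show thesis using that by blast
qed

text \<open>
  Zariski density in one coordinate: it transports identities from points with pairwise distinct
  coordinates to all points.
\<close>

lemma mpoly_fun_eq_dense:
  assumes "f \<in> mpoly_fun" "g \<in> mpoly_fun" "finite F"
    and "\<And>u. u \<notin> F \<Longrightarrow> f (z(i := u)) = g (z(i := u))"
  shows "f z = g z"
proof -
  obtain P where P: "\<And>u. f (z(i := u)) = poly P u" using mpoly_fun_one_variable assms(1) by metis
  obtain Q where Q: "\<And>u. g (z(i := u)) = poly Q u" using mpoly_fun_one_variable assms(2) by metis
  have "P = Q"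
  proof (rule ccontr)
    assume "P \<noteq> Q"
    then have "finite {u. poly (P - Q) u = 0}" by (intro poly_roots_finite) auto
    moreover have "- F \<subseteq> {u. poly (P - Q) u = 0}" using P Q assms(4) by auto
    ultimately have "finite (- F)" by (rule finite_subset[rotated])
    then show False using assms(3) by (metis Compl_eq_Diff_UNIV finite_Diff2 infinite_UNIV_char_0)
  qed
  then show ?thesis using P[of "z i"] Q[of "z i"] by simp
qed

text \<open>
  If \<open>\<phi>\<^sub>p\<close> and \<open>\<phi>\<^sub>q\<close> agree where \<open>z\<^sub>p = z\<^sub>q\<close>, the poles of \<open>\<Sum>p. \<phi>\<^sub>p / (\<Prod>q\<noteq>p. z\<^sub>p - z\<^sub>q)\<close> along the
  diagonals cancel. This is Newton's scheme of divided differences: a point \<open>a\<close> is eliminated by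
  expanding \<open>1 / (\<Prod>q. z\<^sub>a - z\<^sub>q)\<close> into partial fractions, which turns \<open>\<phi>\<^sub>p\<close> into the polynomial
  \<open>\<psi>\<^sub>p = (\<phi>\<^sub>p - \<phi>\<^sub>a) / (z\<^sub>p - z\<^sub>a)\<close>. The hypothesis asks for agreement only at points that are otherwise
  distinct, since the Hall--Littlewood sum is controlled only there.
\<close>

lemma divided_difference_mpoly_fun:
  fixes \<phi> :: "'i \<Rightarrow> ('i \<Rightarrow> complex) \<Rightarrow> complex"
  assumes "finite J" "J \<noteq> {}"
    and "\<And>p. p \<in> J \<Longrightarrow> \<phi> p \<in> mpoly_fun"
    and "\<And>p q z. p \<in> J \<Longrightarrow> q \<in> J \<Longrightarrow> p \<noteq> q \<Longrightarrow> inj_on z (J - {p}) \<Longrightarrow> z p = z q \<Longrightarrow> \<phi> p z = \<phi> q z"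
  obtains F where "F \<in> mpoly_fun"
    "\<And>z. inj_on z J \<Longrightarrow> (\<Sum>p\<in>J. \<phi> p z / (\<Prod>q\<in>J-{p}. z p - z q)) = F z"
proof -
  have "\<exists>F\<in>mpoly_fun. \<forall>z. inj_on z J \<longrightarrow> (\<Sum>p\<in>J. \<phi> p z / (\<Prod>q\<in>J-{p}. z p - z q)) = F z"
    using assms
  proof (induction J arbitrary: \<phi> rule: finite_ne_induct)
    case (singleton a)
    then show ?case by (intro bexI[of _ "\<phi> a"]) auto
  next
    case (insert a J)
    note compat = insert.prems(2)
    have "\<exists>h\<in>mpoly_fun. \<forall>z. (\<phi> p z - \<phi> a z) - (\<phi> p (z(p := z a)) - \<phi> a (z(p := z a))) = (z p - z a) * h z"
      if "p \<in> J" for p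
    proof -
      have "(\<lambda>z. \<phi> p z - \<phi> a z) \<in> mpoly_fun"
        using that insert.prems(1) by (intro mpoly_fun_diff) auto
      moreover have "p \<noteq> a" using that insert.hyps by auto
      ultimately obtain h where "h \<in> mpoly_fun"
        "\<And>z. (\<phi> p z - \<phi> a z) - (\<phi> p (z(p := z a)) - \<phi> a (z(p := z a))) = (z p - z a) * h z"
        by (rule mpoly_fun_divided_difference) (rule that, assumption+)
      then show ?thesis by blast
    qed
    then have "\<exists>\<psi>. \<forall>p\<in>J. \<psi> p \<in> mpoly_fun \<and>
        (\<forall>z. (\<phi> p z - \<phi> a z) - (\<phi> p (z(p := z a)) - \<phi> a (z(p := z a))) = (z p - z a) * \<psi> p z)"
      by (intro bchoice ballI) (simp only: Bex_def)
    then obtain \<psi> where \<psi>0: "\<forall>p\<in>J. \<psi> p \<in> mpoly_fun \<and>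
        (\<forall>z. (\<phi> p z - \<phi> a z) - (\<phi> p (z(p := z a)) - \<phi> a (z(p := z a))) = (z p - z a) * \<psi> p z)" ..
    note \<psi> = conjunct1[OF bspec[OF \<psi>0]] spec[OF conjunct2[OF bspec[OF \<psi>0]]]
    have \<psi>_eq: "\<phi> p z - \<phi> a z = (z p - z a) * \<psi> p z" if p: "p \<in> J" and inj: "inj_on z (insert a J - {p})" for p z
    proof -
      have "\<phi> p (z(p := z a)) = \<phi> a (z(p := z a))"
      proof (rule compat)
        show "inj_on (z(p := z a)) (insert a J - {p})"
          by (rule inj_on_cong[THEN iffD1, OF _ inj]) simp
        show "p \<in> insert a J" "a \<in> insert a J" "p \<noteq> a" "(z(p := z a)) p = (z(p := z a)) a"
          using p insert.hyps by auto
      qed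
      then show ?thesis using \<psi>(2)[OF p, of z] by (simp only: diff_self diff_0_right)
    qed
    have "\<exists>F\<in>mpoly_fun. \<forall>z. inj_on z J \<longrightarrow> (\<Sum>p\<in>J. \<psi> p z / (\<Prod>q\<in>J-{p}. z p - z q)) = F z"
    proof (rule insert.IH)
      show "\<psi> p \<in> mpoly_fun" if "p \<in> J" for p using \<psi>(1) that .
      fix p q and z :: "'i \<Rightarrow> complex"
      assume pq: "p \<in> J" "q \<in> J" "p \<noteq> q" and inj: "inj_on z (J - {p})" and eq: "z p = z q"
      show "\<psi> p z = \<psi> q z"
      proof (rule mpoly_fun_eq_dense[of "\<psi> p" "\<psi> q" "z ` J" z a])
        fix u assume u: "u \<notin> z ` J"
        define y where "y = z(a := u)"
        have ap: "a \<noteq> p" "a \<noteq> q" using pq insert.hyps by auto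
        have yJ: "y j = z j" if "j \<in> J" for j using that insert.hyps by (auto simp: y_def)
        have y1: "inj_on y (insert a J - {p})"
          using inj u yJ insert.hyps by (auto simp: inj_on_def y_def)
        have y2: "inj_on y (insert a J - {q})"
          unfolding inj_on_def
        proof (intro ballI impI)
          fix b c assume bc: "b \<in> insert a J - {q}" "c \<in> insert a J - {q}" "y b = y c"
          \<comment> \<open>As \<open>y p = y q\<close>, injectivity without \<open>p\<close> carries over to injectivity without \<open>q\<close>.\<close>
          define s where "s = (\<lambda>b. if b = p then q else b)"
          have "y (s b) = y (s c)" using bc eq pq yJ by (auto simp: s_def)
          moreover have "s b \<in> insert a J - {p}" "s c \<in> insert a J - {p}"
            using bc pq by (auto simp: s_def)
          ultimately have "s b = s c" using y1 by (meson inj_onD)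
          then show "b = c" using bc by (auto simp: s_def split: if_splits)
        qed
        have e: "y p = y q" using eq pq yJ by auto
        have "\<phi> p y = \<phi> q y" by (rule compat[OF _ _ pq(3) y1 e]) (use pq in auto)
        then have "(y p - y a) * \<psi> p y = (y p - y a) * \<psi> q y"
          using \<psi>_eq[OF pq(1) y1] \<psi>_eq[OF pq(2) y2] e by metis
        moreover have "y p \<noteq> y a" using u pq ap by (auto simp: y_def)
        ultimately have "\<psi> p y = \<psi> q y" by simp
        then show "\<psi> p (z(a := u)) = \<psi> q (z(a := u))" by (simp only: y_def)
      next
        show "\<psi> p \<in> mpoly_fun" "\<psi> q \<in> mpoly_fun" using \<psi>(1) pq by blast+
        show "finite (z ` J)" using insert.hyps by blast
      qed
    qed
    then obtain F where F: "F \<in> mpoly_fun" "\<And>z. inj_on z J \<Longrightarrow> (\<Sum>p\<in>J. \<psi> p z / (\<Prod>q\<in>J-{p}. z p - z q)) = F z"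
      by blast
    show ?case
    proof (intro bexI[of _ F] F(1) allI impI)
      fix z :: "'i \<Rightarrow> complex" assume inj: "inj_on z (insert a J)"
      then have injJ: "inj_on z J" and za: "z a \<notin> z ` J"
        using insert.hyps by (auto simp: inj_on_insert)
      have re: "(\<Prod>q\<in>S. c - z q) = (\<Prod>q\<in>z`S. c - q)" if "S \<subseteq> J" for S c
        using inj_on_subset[OF injJ that] by (simp add: prod.reindex)
      have im: "z ` (J - {p}) = z ` J - {z p}" if "p \<in> J" for p
        using injJ that by (auto simp: inj_on_def)
      have pf: "1 / (\<Prod>q\<in>J. z a - z q) = (\<Sum>p\<in>J. 1 / ((z a - z p) * (\<Prod>q\<in>J-{p}. z p - z q)))"
        using lagrange_partial_fractions[of "z ` J" "z a"] insert.hyps za injJ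
        by (simp add: re im sum.reindex)
      have "(\<Sum>p\<in>insert a J. \<phi> p z / (\<Prod>q\<in>insert a J-{p}. z p - z q))
          = \<phi> a z * (1 / (\<Prod>q\<in>J. z a - z q)) + (\<Sum>p\<in>J. \<phi> p z / (\<Prod>q\<in>insert a J-{p}. z p - z q))"
        using insert.hyps by simp
      also have "(\<Sum>p\<in>J. \<phi> p z / (\<Prod>q\<in>insert a J-{p}. z p - z q))
               = (\<Sum>p\<in>J. \<phi> p z / ((z p - z a) * (\<Prod>q\<in>J-{p}. z p - z q)))"
      proof (rule sum.cong[OF refl])
        fix p assume "p \<in> J"
        then have "insert a J - {p} = insert a (J - {p})" using insert.hyps by auto
        then show "\<phi> p z / (\<Prod>q\<in>insert a J-{p}. z p - z q) = \<phi> p z / ((z p - z a) * (\<Prod>q\<in>J-{p}. z p - z q))"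
          using insert.hyps by simp
      qed
      also have "\<phi> a z * (1 / (\<Prod>q\<in>J. z a - z q)) + \<dots> = (\<Sum>p\<in>J. \<psi> p z / (\<Prod>q\<in>J-{p}. z p - z q))"
        unfolding pf sum_distrib_left sum.distrib[symmetric]
      proof (rule sum.cong[OF refl])
        fix p assume p: "p \<in> J"
        then have nz: "z p - z a \<noteq> 0" using za by (metis eq_iff_diff_eq_0 imageI)
        have "\<phi> p z - \<phi> a z = (z p - z a) * \<psi> p z"
          by (rule \<psi>_eq[OF p]) (use inj in \<open>auto simp: inj_on_def\<close>)
        then have \<psi>p: "\<psi> p z = (\<phi> p z - \<phi> a z) / (z p - z a)" using nz by (simp add: field_simps)
        have gen: "x * (1 / ((- c) * d)) + y / (c * d) = ((y - x) / c) / d" for x y c d :: complex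
          by (simp add: diff_divide_distrib)
        have neg: "z a - z p = - (z p - z a)" by simp
        show "\<phi> a z * (1 / ((z a - z p) * (\<Prod>q\<in>J-{p}. z p - z q))) + \<phi> p z / ((z p - z a) * (\<Prod>q\<in>J-{p}. z p - z q))
           = \<psi> p z / (\<Prod>q\<in>J-{p}. z p - z q)"
          unfolding \<psi>p neg by (rule gen)
      qed
      finally show "(\<Sum>p\<in>insert a J. \<phi> p z / (\<Prod>q\<in>insert a J-{p}. z p - z q)) = F z"
        using F(2)[OF injJ] by simp
    qed
  qed
  then show thesis using that by blast
qed

section \<open>The Hall--Littlewood sum\<close>

text \<open>
  The sum in the symmetrisation formula, sorted by the argument that carries the first part. The
  index type is left open: indices are natural numbers for the formula itself, argument labels for
  measurability, and the arguments themselves (\<open>z\<close> the identity) for symmetry.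
\<close>

primrec hl_sum :: "complex \<Rightarrow> nat list \<Rightarrow> 'i set \<Rightarrow> ('i \<Rightarrow> complex) \<Rightarrow> complex" where
  "hl_sum t [] J z = 1"
| "hl_sum t (l # ls) J z =
     (\<Sum>p\<in>J. z p ^ l * (\<Prod>q\<in>J-{p}. (z p - t * z q) / (z p - z q)) * hl_sum t ls (J - {p}) z)"

lemma hl_sum_reindex:
  "inj_on f J \<Longrightarrow> hl_sum t lam (f ` J) z = hl_sum t lam J (\<lambda>i. z (f i))"
proof (induction lam arbitrary: J)
  case (Cons l ls)
  have im: "f ` J - {f p} = f ` (J - {p})" if "p \<in> J" for p
    using Cons.prems that by (auto simp: inj_on_def)
  have "inj_on f (J - {p})" for p using Cons.prems by (rule inj_on_subset) auto
  then show ?case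
    using Cons.prems by (simp add: sum.reindex im prod.reindex Cons.IH)
qed simp

lemma hl_sum_cong:
  "(\<And>p. p \<in> J \<Longrightarrow> z p = y p) \<Longrightarrow> hl_sum t lam J z = hl_sum t lam J y"
proof (induction lam arbitrary: J)
  case (Cons l ls)
  then have "hl_sum t ls (J - {p}) z = hl_sum t ls (J - {p}) y" for p by blast
  with Cons.prems show ?case by simp
qed simp

text \<open>
  The sum depends only on the set of arguments. This is its symmetry, and it is how sums over
  different index sets are compared.
\<close>

lemma hl_sum_image: "inj_on z J \<Longrightarrow> hl_sum t lam (z ` J) (\<lambda>u. u) = hl_sum t lam J z"
  by (rule hl_sum_reindex)

lemma hl_sum_measurable:
  assumes "\<And>i. (\<lambda>w. z w i) \<in> borel_measurable M"
  shows "(\<lambda>w. hl_sum t lam J (z w)) \<in> borel_measurable M"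
proof (induction lam arbitrary: J)
  case (Cons l ls)
  note [measurable] = assms Cons.IH
  show ?case by simp
qed simp

text \<open>
  By induction the sums for the remaining parts are polynomial. At \<open>z\<^sub>p = z\<^sub>q\<close> removing \<open>p\<close> or
  removing \<open>q\<close> leaves the same set of arguments, which is the compatibility that divided
  differences require. Where coordinates coincide the sum no longer determines the polynomial; the
  last clause keeps it independent of the labels outside \<open>J\<close> there too.
\<close>

lemma hl_sum_mpoly_fun:
  assumes "finite (J :: 'i set)"
  obtains F where "F \<in> mpoly_fun" "\<And>z. inj_on z J \<Longrightarrow> hl_sum t lam J z = F z"
    "\<And>z y. (\<And>i. i \<in> J \<Longrightarrow> z i = y i) \<Longrightarrow> F z = F y"
proof -
  have "\<exists>F\<in>mpoly_fun. \<forall>z. inj_on z J \<longrightarrow> hl_sum t lam J z = F z"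
    using assms
  proof (induction lam arbitrary: J)
    case Nil
    then show ?case by (intro bexI[of _ "\<lambda>z. 1"]) (auto intro: mpoly_fun.intros)
  next
    case (Cons l ls)
    show ?case
    proof (cases "J = {}")
      case True
      then show ?thesis by (intro bexI[of _ "\<lambda>z. 0"]) (auto intro: mpoly_fun.intros)
    next
      case False
      have "\<forall>p\<in>J. \<exists>f. f \<in> mpoly_fun \<and> (\<forall>z. inj_on z (J - {p}) \<longrightarrow> hl_sum t ls (J - {p}) z = f z)"
        using Cons.IH Cons.prems by blast
      then obtain f where f: "\<forall>p\<in>J. f p \<in> mpoly_fun \<and> (\<forall>z. inj_on z (J - {p}) \<longrightarrow> hl_sum t ls (J - {p}) z = f p z)"
        using bchoice[of J "\<lambda>p f. f \<in> mpoly_fun \<and> (\<forall>z. inj_on z (J - {p}) \<longrightarrow> hl_sum t ls (J - {p}) z = f z)"]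
        by blast
      define \<phi> where "\<phi> = (\<lambda>p z. z p ^ l * (\<Prod>q\<in>J-{p}. z p - t * z q) * f p z)"
      have 1: "\<phi> p \<in> mpoly_fun" if "p \<in> J" for p
        unfolding \<phi>_def using f that
        by (intro mpoly_fun.mult mpoly_fun_power mpoly_fun_prod mpoly_fun_diff mpoly_fun.coord mpoly_fun.const) auto
      have 2: "\<phi> p z = \<phi> q z"
        if pq: "p \<in> J" "q \<in> J" "p \<noteq> q" and inj: "inj_on z (J - {p})" and eq: "z p = z q" for p q z
      proof -
        have "z ` (J - {a}) \<subseteq> z ` (J - {b})" if "a \<in> J" "a \<noteq> b" "z a = z b" for a b
        proof
          fix y assume "y \<in> z ` (J - {a})"
          then obtain r where r: "r \<in> J" "r \<noteq> a" "y = z r" by auto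
          show "y \<in> z ` (J - {b})"
          proof (cases "r = b")
            case True
            then show ?thesis using that r by (intro image_eqI[of _ _ a]) auto
          qed (use r in auto)
        qed
        then have im: "z ` (J - {p}) = z ` (J - {q})" using pq eq by (metis subset_antisym)
        have inj': "inj_on z (J - {q})"
        proof (rule eq_card_imp_inj_on)
          show "finite (J - {q})" using Cons.prems by simp
          have "card (z ` (J - {q})) = card (J - {p})" using card_image[OF inj] im by simp
          then show "card (z ` (J - {q})) = card (J - {q})" using pq Cons.prems by simp
        qed
        have "(\<Prod>r\<in>J-{p}. z p - t * z r) = (\<Prod>u\<in>z ` (J-{p}). z p - t * u)"
          using inj by (simp add: prod.reindex)
        also have "\<dots> = (\<Prod>r\<in>J-{q}. z q - t * z r)"
          unfolding im eq using inj' by (simp add: prod.reindex)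
        finally have "(\<Prod>r\<in>J-{p}. z p - t * z r) = (\<Prod>r\<in>J-{q}. z q - t * z r)" .
        moreover have "f p z = f q z"
        proof -
          have "f p z = hl_sum t ls (J - {p}) z" using f pq inj by metis
          also have "\<dots> = hl_sum t ls (J - {q}) z"
            using hl_sum_image[OF inj, of t ls] hl_sum_image[OF inj', of t ls] im by metis
          also have "\<dots> = f q z" using f pq inj' by metis
          finally show ?thesis .
        qed
        ultimately show ?thesis by (simp add: \<phi>_def eq)
      qed
      obtain F where F: "F \<in> mpoly_fun"
        "\<And>z. inj_on z J \<Longrightarrow> (\<Sum>p\<in>J. \<phi> p z / (\<Prod>q\<in>J-{p}. z p - z q)) = F z"
        using divided_difference_mpoly_fun[OF Cons.prems False, of \<phi>] 1 2 by blast
      have "hl_sum t (l # ls) J z = F z" if "inj_on z J" for z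
      proof -
        have "hl_sum t (l # ls) J z = (\<Sum>p\<in>J. \<phi> p z / (\<Prod>q\<in>J-{p}. z p - z q))"
          unfolding hl_sum.simps
        proof (rule sum.cong[OF refl])
          fix p assume p: "p \<in> J"
          have "inj_on z (J - {p})" using that by (rule inj_on_subset) auto
          then have "hl_sum t ls (J - {p}) z = f p z" using f p by blast
          then show "z p ^ l * (\<Prod>q\<in>J-{p}. (z p - t * z q) / (z p - z q)) * hl_sum t ls (J - {p}) z
                   = \<phi> p z / (\<Prod>q\<in>J-{p}. z p - z q)"
            by (simp add: \<phi>_def prod_dividef)
        qed
        then show ?thesis using F(2)[OF that] by simp
      qed
      then show ?thesis using F(1) by blast
    qed
  qed
  then obtain F where F: "F \<in> mpoly_fun" "\<And>z. inj_on z J \<Longrightarrow> hl_sum t lam J z = F z" by blast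
  show thesis
  proof (rule that[of "\<lambda>z. F (\<lambda>i. if i \<in> J then z i else 0)"])
    show "(\<lambda>z. F (\<lambda>i. if i \<in> J then z i else 0)) \<in> mpoly_fun" by (rule mpoly_fun_restrict[OF F(1)])
    fix z :: "'i \<Rightarrow> complex" assume inj: "inj_on z J"
    define y where "y = (\<lambda>i. if i \<in> J then z i else 0)"
    have "hl_sum t lam J z = hl_sum t lam J y" by (rule hl_sum_cong) (simp add: y_def)
    also have "\<dots> = F y" by (rule F(2)) (use inj in \<open>simp add: y_def inj_on_def\<close>)
    finally show "hl_sum t lam J z = F (\<lambda>i. if i \<in> J then z i else 0)" by (simp only: y_def)
  next
    fix z y :: "'i \<Rightarrow> complex" assume eq: "\<And>i. i \<in> J \<Longrightarrow> z i = y i"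
    have "(\<lambda>i. if i \<in> J then z i else 0) = (\<lambda>i. if i \<in> J then y i else 0)" using eq by auto
    then show "F (\<lambda>i. if i \<in> J then z i else 0) = F (\<lambda>i. if i \<in> J then y i else 0)" by simp
  qed
qed

text \<open>
  A bound for the degree in a single argument \<open>v\<close>: each factor \<open>(p - t v) / (p - v)\<close> is bounded as
  \<open>v\<close> grows, so only the power of \<open>v\<close> contributes. With its denominators cleared this is a statement
  about degrees of polynomials.
\<close>

lemma hl_sum_numerator_poly:
  assumes "finite Y" "\<And>l. l \<in> set lam \<Longrightarrow> l \<le> M"
  shows "\<exists>P. degree P \<le> M + card Y \<and>
    (\<forall>v. v \<notin> Y \<longrightarrow> (\<Prod>q\<in>Y. v - q) * hl_sum t lam (insert v Y) (\<lambda>u. u) = poly P v)"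
  using assms
proof (induction lam arbitrary: Y)
  case Nil
  have "degree (\<Prod>q\<in>Y. [:-q,1:]) \<le> sum (degree \<circ> (\<lambda>q. [:-q,1:])) Y"
    by (rule degree_prod_sum_le) (use Nil in auto)
  then have "degree (\<Prod>q\<in>Y. [:-q,1:]) \<le> M + card Y" by simp
  then show ?case by (intro exI[of _ "\<Prod>q\<in>Y. [:-q,1:]"]) (auto simp: poly_prod)
next
  case (Cons l ls)
  have "\<forall>p\<in>Y. \<exists>P. degree P \<le> M + card (Y - {p}) \<and>
      (\<forall>v. v \<notin> Y - {p} \<longrightarrow> (\<Prod>q\<in>Y-{p}. v - q) * hl_sum t ls (insert v (Y - {p})) (\<lambda>u. u) = poly P v)"
    by (intro ballI Cons.IH) (use Cons.prems in auto)
  then obtain P where P: "\<forall>p\<in>Y. degree (P p) \<le> M + card (Y - {p}) \<and>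
      (\<forall>v. v \<notin> Y - {p} \<longrightarrow> (\<Prod>q\<in>Y-{p}. v - q) * hl_sum t ls (insert v (Y - {p})) (\<lambda>u. u) = poly (P p) v)"
    using bchoice[of Y "\<lambda>p P. degree P \<le> M + card (Y - {p}) \<and>
      (\<forall>v. v \<notin> Y - {p} \<longrightarrow> (\<Prod>q\<in>Y-{p}. v - q) * hl_sum t ls (insert v (Y - {p})) (\<lambda>u. u) = poly P v)"]
    by blast
  define Q where "Q = smult (hl_sum t ls Y (\<lambda>u. u)) (monom 1 l * (\<Prod>q\<in>Y. [:- t * q, 1:]))
     + (\<Sum>p\<in>Y. smult (p ^ l * (\<Prod>q\<in>Y-{p}. (p - t * q) / (p - q))) ([:- p, t:] * P p))"
  have "degree Q \<le> M + card Y"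
    unfolding Q_def
  proof (intro degree_add_le degree_sum_le Cons.prems(1))
    have "degree (monom (1::complex) l * (\<Prod>q\<in>Y. [:- t * q, 1:])) \<le> l + card Y"
    proof (rule order_trans[OF degree_mult_le] add_mono degree_monom_le)+
      have "degree (\<Prod>q\<in>Y. [:- t * q,1:]) \<le> sum (degree \<circ> (\<lambda>q. [:- t * q,1:])) Y"
        by (rule degree_prod_sum_le) (use Cons in auto)
      then show "degree (\<Prod>q\<in>Y. [:- t * q,1:]) \<le> card Y" by simp
    qed
    then show "degree (smult (hl_sum t ls Y (\<lambda>u. u)) (monom 1 l * (\<Prod>q\<in>Y. [:- t * q, 1:]))) \<le> M + card Y"
      using Cons.prems(2)[of l] by (intro order_trans[OF degree_smult_le]) auto
    fix p assume p: "p \<in> Y"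
    have "degree ([:- p, t:] * P p) \<le> degree [:- p, t:] + degree (P p)" by (rule degree_mult_le)
    also have "\<dots> \<le> 1 + (M + card (Y - {p}))" using P p by (intro add_mono) auto
    also have "\<dots> = M + card Y" using p Cons.prems(1)
      by (metis Suc_eq_plus1 add.assoc add.commute card_Suc_Diff1)
    finally show "degree (smult (p ^ l * (\<Prod>q\<in>Y-{p}. (p - t * q) / (p - q))) ([:- p, t:] * P p)) \<le> M + card Y"
      using degree_smult_le order_trans by blast
  qed
  moreover have "(\<Prod>q\<in>Y. v - q) * hl_sum t (l # ls) (insert v Y) (\<lambda>u. u) = poly Q v" if v: "v \<notin> Y" for v
  proof -
    have nz: "(\<Prod>q\<in>Y. v - q) \<noteq> 0" using v Cons.prems(1) by auto
    have 1: "(\<Prod>q\<in>Y. v - q) * (v ^ l * (\<Prod>q\<in>Y. (v - t * q) / (v - q)) * hl_sum t ls Y (\<lambda>u. u))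
       = poly (smult (hl_sum t ls Y (\<lambda>u. u)) (monom 1 l * (\<Prod>q\<in>Y. [:- t * q, 1:]))) v"
      using nz by (simp add: poly_prod poly_monom prod_dividef)
    have 2: "(\<Prod>q\<in>Y. v - q) * (p ^ l * (\<Prod>q\<in>insert v Y-{p}. (p - t * q) / (p - q)) * hl_sum t ls (insert v Y - {p}) (\<lambda>u. u))
       = poly (smult (p ^ l * (\<Prod>q\<in>Y-{p}. (p - t * q) / (p - q))) ([:- p, t:] * P p)) v" if p: "p \<in> Y" for p
    proof -
      have pv: "p - v \<noteq> 0" "v \<noteq> p" using v p by auto
      have ins: "insert v Y - {p} = insert v (Y - {p})" using pv by auto
      have A: "(\<Prod>q\<in>Y. v - q) = (v - p) * (\<Prod>q\<in>Y-{p}. v - q)"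
        using p Cons.prems(1) by (simp add: prod.remove)
      have B: "(\<Prod>q\<in>insert v (Y-{p}). (p - t * q) / (p - q)) = (p - t * v) / (p - v) * (\<Prod>q\<in>Y-{p}. (p - t * q) / (p - q))"
        using v Cons.prems(1) by simp
      have C: "(\<Prod>q\<in>Y-{p}. v - q) * hl_sum t ls (insert v (Y - {p})) (\<lambda>u. u) = poly (P p) v"
        using P p v by blast
      have "(\<Prod>q\<in>Y. v - q) * (p ^ l * (\<Prod>q\<in>insert v Y-{p}. (p - t * q) / (p - q)) * hl_sum t ls (insert v Y - {p}) (\<lambda>u. u))
         = ((v - p) * ((p - t * v) / (p - v))) * (p ^ l * (\<Prod>q\<in>Y-{p}. (p - t * q) / (p - q)))
           * ((\<Prod>q\<in>Y-{p}. v - q) * hl_sum t ls (insert v (Y - {p})) (\<lambda>u. u))"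
        unfolding ins A B by (simp add: algebra_simps)
      also have "(v - p) * ((p - t * v) / (p - v)) = t * v - p"
        using pv(1) by (simp add: field_simps)
      finally show ?thesis unfolding C by (simp add: algebra_simps)
    qed
    have "insert v Y - {v} = Y" using v by auto
    then have "(\<Prod>q\<in>Y. v - q) * hl_sum t (l # ls) (insert v Y) (\<lambda>u. u)
      = (\<Prod>q\<in>Y. v - q) * (v ^ l * (\<Prod>q\<in>Y. (v - t * q) / (v - q)) * hl_sum t ls Y (\<lambda>u. u))
      + (\<Sum>p\<in>Y. (\<Prod>q\<in>Y. v - q) * (p ^ l * (\<Prod>q\<in>insert v Y-{p}. (p - t * q) / (p - q)) * hl_sum t ls (insert v Y - {p}) (\<lambda>u. u)))"
      using v Cons.prems(1) by (simp add: distrib_left sum_distrib_left)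
    also have "\<dots> = poly Q v"
      unfolding Q_def poly_add poly_sum by (intro arg_cong2[of _ _ _ _ "(+)"] 1 sum.cong refl 2)
    finally show ?thesis .
  qed
  ultimately show ?case by blast
qed

text \<open>
  Each step contributes \<open>\<Sum>p. \<Prod>q\<noteq>p. (p - t q) / (p - q) = [N]\<close>. The numerators, multiplied by
  \<open>(1 - t) p\<close>, are the values at \<open>p\<close> of \<open>\<Prod>q. X - t q\<close>, or of its difference with \<open>\<Prod>q. X - q\<close>, whose
  degree is less than \<open>N\<close>; interpolating this difference at \<open>0\<close> gives the identity.
\<close>

lemma hl_sum_zero_partition:
  assumes "finite Z" "0 \<notin> Z" "t \<noteq> 1"
  shows "hl_sum t (replicate (card Z) 0) Z (\<lambda>u. u) = t_fact t (card Z)"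
  using assms
proof (induction "card Z" arbitrary: Z)
  case 0
  then show ?case by (simp add: t_fact_def)
next
  case (Suc N)
  have "hl_sum t (replicate (card Z) 0) Z (\<lambda>u. u)
      = (\<Sum>p\<in>Z. (\<Prod>q\<in>Z-{p}. (p - t * q) / (p - q)) * t_fact t N)"
    unfolding Suc(2)[symmetric] replicate_Suc hl_sum.simps
  proof (rule sum.cong[OF refl])
    fix p assume p: "p \<in> Z"
    then have "N = card (Z - {p})" using Suc by simp
    then have "hl_sum t (replicate N 0) (Z - {p}) (\<lambda>u. u) = t_fact t N"
      using Suc.hyps(1)[of "Z - {p}"] Suc.prems by simp
    then show "p ^ 0 * (\<Prod>q\<in>Z-{p}. (p - t * q) / (p - q)) * hl_sum t (replicate N 0) (Z - {p}) (\<lambda>u. u)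
       = (\<Prod>q\<in>Z-{p}. (p - t * q) / (p - q)) * t_fact t N" by simp
  qed
  also have "\<dots> = (\<Sum>p\<in>Z. \<Prod>q\<in>Z-{p}. (p - t * q) / (p - q)) * t_fact t N"
    by (simp add: sum_distrib_right)
  also have "(\<Sum>p\<in>Z. \<Prod>q\<in>Z-{p}. (p - t * q) / (p - q)) = t_number t (Suc N)"
  proof -
    define P where "P = (\<Prod>q\<in>Z. [:- t * q, 1:]) - (\<Prod>q\<in>Z. [:- q, 1:])"
    have deg: "degree (\<Prod>q\<in>Z. [:- c q, 1:]) = Suc N" "lead_coeff (\<Prod>q\<in>Z. [:- c q, 1:]) = 1" for c :: "complex \<Rightarrow> complex"
    proof -
      show "degree (\<Prod>q\<in>Z. [:- c q, 1:]) = Suc N"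
        by (subst degree_prod_eq_sum_degree) (use Suc in auto)
      show "lead_coeff (\<Prod>q\<in>Z. [:- c q, 1:]) = 1"
        by (subst lead_coeff_prod) simp
    qed
    have degP: "degree P < card Z"
    proof -
      have "degree P \<le> Suc N"
        unfolding P_def using deg(1)[of "\<lambda>q. t * q"] deg(1)[of "\<lambda>q. q"]
        by (intro degree_diff_le) auto
      moreover have "coeff P (Suc N) = 0"
        unfolding P_def using deg[of "\<lambda>q. t * q"] deg[of "\<lambda>q. q"] by simp
      ultimately have "degree P < Suc N \<or> P = 0"
        by (metis le_neq_implies_less leading_coeff_0_iff)
      then show ?thesis using Suc(2) by auto
    qed
    have nz: "(\<Prod>q\<in>Z. q) \<noteq> 0" using Suc.prems by auto
    have summand: "poly P p * (\<Prod>q\<in>Z-{p}. (0 - q) / (p - q))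
        = ((1 - t) * (-1) ^ N * (\<Prod>q\<in>Z. q)) * (\<Prod>q\<in>Z-{p}. (p - t * q) / (p - q))" if p: "p \<in> Z" for p
    proof -
      have "(\<Prod>q\<in>Z. p - q) = 0" using p Suc.prems by auto
      then have "poly P p = (\<Prod>q\<in>Z. p - t * q)" by (simp add: P_def poly_prod)
      also have "\<dots> = (p - t * p) * (\<Prod>q\<in>Z-{p}. p - t * q)"
        using p Suc.prems by (simp add: prod.remove)
      finally have 1: "poly P p = (p - t * p) * (\<Prod>q\<in>Z-{p}. p - t * q)" .
      have "card (Z - {p}) = N" using p Suc by simp
      then have 2: "(\<Prod>q\<in>Z-{p}. 0 - q) = (-1) ^ N * (\<Prod>q\<in>Z-{p}. q)"
        using prod.distrib[of "\<lambda>_. -1" "\<lambda>q. q" "Z - {p}"] by simp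
      have 3: "(\<Prod>q\<in>Z. q) = p * (\<Prod>q\<in>Z-{p}. q)"
        using p Suc.prems by (simp add: prod.remove)
      show ?thesis
        unfolding prod_dividef 1 2 3 by (simp add: algebra_simps)
    qed
    have "((1 - t) * (-1) ^ N * (\<Prod>q\<in>Z. q)) * (\<Sum>p\<in>Z. \<Prod>q\<in>Z-{p}. (p - t * q) / (p - q)) = poly P 0"
      using lagrange_interpolation[OF Suc.prems(1) degP, of 0] summand
      by (simp add: sum_distrib_left)
    also have "poly P 0 = (-1) ^ N * (\<Prod>q\<in>Z. q) * (1 - t ^ Suc N)"
    proof -
      have "(\<Prod>q\<in>Z. - (t * q)) = (- t) ^ Suc N * (\<Prod>q\<in>Z. q)" "(\<Prod>q\<in>Z. - q) = (-1) ^ Suc N * (\<Prod>q\<in>Z. q)"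
        using prod.distrib[of "\<lambda>_. -t" "\<lambda>q. q" "Z"] prod.distrib[of "\<lambda>_. -1" "\<lambda>q. q" "Z"] Suc(2) by simp_all
      moreover have "(- t) ^ Suc N = (-1) ^ Suc N * t ^ Suc N" by (rule power_minus)
      ultimately show ?thesis by (auto simp: P_def poly_prod algebra_simps)
    qed
    finally have "(-1) ^ N * (\<Prod>q\<in>Z. q) * ((1 - t) * (\<Sum>p\<in>Z. \<Prod>q\<in>Z-{p}. (p - t * q) / (p - q)))
        = (-1) ^ N * (\<Prod>q\<in>Z. q) * (1 - t ^ Suc N)"
      by (simp only: mult_ac)
    then have "(1 - t) * (\<Sum>p\<in>Z. \<Prod>q\<in>Z-{p}. (p - t * q) / (p - q)) = 1 - t ^ Suc N"
      using nz by simp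
    then show ?thesis using \<open>t \<noteq> 1\<close> by (simp add: t_number_def field_simps)
  qed
  also have "t_number t (Suc N) * t_fact t N = t_fact t (card Z)"
    unfolding Suc(2)[symmetric] by (simp add: t_fact_def)
  finally show ?case .
qed

section \<open>The symmetrisation formula and its polynomial extension\<close>

text \<open>
  The term of the symmetrisation formula that belongs to the order \<open>xs\<close> of the arguments; lists
  without repetition replace permutations because they admit the recursion of \<open>hl_sum\<close>.
\<close>

primrec hl_term :: "complex \<Rightarrow> nat list \<Rightarrow> ('i \<Rightarrow> complex) \<Rightarrow> 'i list \<Rightarrow> complex" where
  "hl_term t [] z xs = 1"
| "hl_term t (l # ls) z xs =
     z (hd xs) ^ l * (\<Prod>q\<in>set (tl xs). (z (hd xs) - t * z q) / (z (hd xs) - z q)) * hl_term t ls z (tl xs)"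

lemma hl_sum_permutations_of_set:
  assumes "finite J" "length lam = card J"
  shows "hl_sum t lam J z = (\<Sum>xs\<in>permutations_of_set J. hl_term t lam z xs)"
  using assms
proof (induction lam arbitrary: J)
  case (Cons l ls)
  have ne: "J \<noteq> {}" using Cons.prems by auto
  have "(\<Sum>xs\<in>permutations_of_set J. hl_term t (l # ls) z xs)
      = (\<Sum>p\<in>J. \<Sum>xs\<in>(#) p ` permutations_of_set (J - {p}). hl_term t (l # ls) z xs)"
    unfolding permutations_of_set_nonempty[OF ne]
    by (rule sum.UNION_disjoint) (use Cons.prems in auto)
  also have "\<dots> = (\<Sum>p\<in>J. \<Sum>xs\<in>permutations_of_set (J - {p}).
      z p ^ l * (\<Prod>q\<in>J-{p}. (z p - t * z q) / (z p - z q)) * hl_term t ls z xs)"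
  proof (rule sum.cong[OF refl])
    fix p assume "p \<in> J"
    show "(\<Sum>xs\<in>(#) p ` permutations_of_set (J - {p}). hl_term t (l # ls) z xs)
        = (\<Sum>xs\<in>permutations_of_set (J - {p}).
            z p ^ l * (\<Prod>q\<in>J-{p}. (z p - t * z q) / (z p - z q)) * hl_term t ls z xs)"
      by (subst sum.reindex) (auto simp: permutations_of_setD intro!: sum.cong)
  qed
  also have "\<dots> = hl_sum t (l # ls) J z"
    using Cons by (simp add: sum_distrib_left)
  finally show ?case ..
qed simp

lemma hl_term_nth:
  assumes "length xs = length lam" "distinct xs"
  shows "hl_term t lam z xs = (\<Prod>i<length lam. z (xs ! i) ^ (lam ! i)) *
     (\<Prod>j<length lam. \<Prod>i<j. (z (xs ! i) - t * z (xs ! j)) / (z (xs ! i) - z (xs ! j)))"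
  using assms
proof (induction lam arbitrary: xs)
  case (Cons l ls)
  then obtain x ys where xs: "xs = x # ys" "length ys = length ls" "distinct ys"
    by (cases xs) auto
  define r where "r = (\<lambda>u v. (z u - t * z v) / (z u - z v))"
  then have r: "r u v = (z u - t * z v) / (z u - z v)" for u v by simp
  have "(\<Prod>j<Suc (length ls). \<Prod>i<j. r (xs ! i) (xs ! j))
      = (\<Prod>j<length ls. r x (ys ! j)) * (\<Prod>j<length ls. \<Prod>i<j. r (ys ! i) (ys ! j))"
    unfolding prod.lessThan_Suc_shift xs(1) by (simp add: prod.distrib)
  moreover have "(\<Prod>j<length ls. r x (ys ! j)) = (\<Prod>q\<in>set ys. r x q)"
    using prod.reindex_bij_betw[OF bij_betw_nth[OF xs(3) refl refl], of "r x"] xs(2) by simp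
  moreover have "(\<Prod>i<Suc (length ls). z (xs ! i) ^ ((l # ls) ! i)) = z x ^ l * (\<Prod>i<length ls. z (ys ! i) ^ (ls ! i))"
    unfolding prod.lessThan_Suc_shift xs(1) by simp
  moreover have "hl_term t (l # ls) z xs = z x ^ l * (\<Prod>q\<in>set ys. r x q) * hl_term t ls z ys"
    by (simp add: xs(1) r_def)
  moreover have "hl_term t ls z ys = (\<Prod>i<length ls. z (ys ! i) ^ (ls ! i)) * (\<Prod>j<length ls. \<Prod>i<j. r (ys ! i) (ys ! j))"
    unfolding r_def by (rule Cons.IH[OF xs(2,3)])
  ultimately show ?case
    unfolding list.size add_0_right add_Suc_right r[symmetric] by (simp only: mult_ac)
qed simp

lemma HL_formula_eq_hl_sum:
  "HL_formula t lam z = hl_sum t lam {..<length lam} z / v_part t lam"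
proof -
  define N where "N = length lam"
  define G where "G = (\<lambda>w :: nat \<Rightarrow> nat. map w [0..<N])"
  have bij: "bij_betw G {w. w permutes {..<N}} (permutations_of_set {..<N})"
  proof -
    have inj: "inj_on G {w. w permutes {..<N}}"
    proof (rule inj_onI)
      fix w w' assume w: "w \<in> {w. w permutes {..<N}}" "w' \<in> {w. w permutes {..<N}}" "G w = G w'"
      show "w = w'"
      proof
        fix i show "w i = w' i"
        proof (cases "i < N")
          case True
          have "map w [0..<N] ! i = map w' [0..<N] ! i" using w(3) unfolding G_def by (simp only:)
          then show ?thesis using True by simp
        next
          case False
          then show ?thesis using w by (simp add: permutes_def)
        qed
      qed
    qed
    have sub: "G ` {w. w permutes {..<N}} \<subseteq> permutations_of_set {..<N}"
    proof
      fix xs assume "xs \<in> G ` {w. w permutes {..<N}}"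
      then obtain w where w: "w permutes {..<N}" "xs = G w" by auto
      have "set xs = w ` {..<N}" using w(2) by (auto simp: G_def)
      also have "\<dots> = {..<N}" by (rule permutes_image[OF w(1)])
      finally have "set xs = {..<N}" .
      moreover have "distinct xs" unfolding w(2) G_def
        using permutes_inj_on[OF w(1)] by (simp add: distinct_map)
      ultimately show "xs \<in> permutations_of_set {..<N}" by (rule permutations_of_setI)
    qed
    have "card (G ` {w. w permutes {..<N}}) = card (permutations_of_set {..<N})"
      by (simp add: card_image[OF inj] card_permutations[OF refl])
    then have "G ` {w. w permutes {..<N}} = permutations_of_set {..<N}"
      using sub by (intro card_subset_eq) auto
    then show ?thesis using inj by (simp add: bij_betw_def)
  qed
  have "hl_sum t lam {..<N} z = (\<Sum>xs\<in>permutations_of_set {..<N}. hl_term t lam z xs)"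
    by (rule hl_sum_permutations_of_set) (auto simp: N_def)
  also have "\<dots> = (\<Sum>w | w permutes {..<N}. hl_term t lam z (G w))"
    by (rule sum.reindex_bij_betw[OF bij, symmetric])
  also have "\<dots> = (\<Sum>w | w permutes {..<N}.
         (\<Prod>i<N. z (w i) ^ (lam ! i)) *
         (\<Prod>j<N. \<Prod>i<j. (z (w i) - t * z (w j)) / (z (w i) - z (w j))))"
  proof (rule sum.cong[OF refl])
    fix w assume "w \<in> {w. w permutes {..<N}}"
    then have "distinct (G w)" "length (G w) = length lam"
      using permutes_inj_on[of w "{..<N}"] by (auto simp: G_def distinct_map N_def)
    moreover have "G w ! i = w i" if "i < N" for i using that by (simp add: G_def)
    ultimately show "hl_term t lam z (G w) = (\<Prod>i<N. z (w i) ^ (lam ! i)) *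
         (\<Prod>j<N. \<Prod>i<j. (z (w i) - t * z (w j)) / (z (w i) - z (w j)))"
      by (simp add: hl_term_nth N_def)
  qed
  finally show ?thesis by (simp add: HL_formula_def N_def Let_def)
qed

text \<open>
  Points with distinct coordinates are approached along the line with direction \<open>(1, 2, 3, \<dots>)\<close>,
  on which any two coordinates coincide at most once.
\<close>

lemma at_within_inj_nontrivial:
  fixes z :: "nat \<Rightarrow> complex"
  shows "at z within {y. inj_on y {..<N}} \<noteq> bot"
proof -
  define y where "y = (\<lambda>e::complex. \<lambda>i. z i + e * of_nat (Suc i))"
  have inj: "\<forall>\<^sub>F e in at 0. inj_on (y e) {..<N}"
  proof -
    have "\<forall>\<^sub>F e in at 0. \<forall>i\<in>{..<N}. \<forall>j\<in>{..<N}. y e i = y e j \<longrightarrow> i = j"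
    proof (intro eventually_ball_finite ballI finite_lessThan)
      fix i j :: nat
      show "\<forall>\<^sub>F e in at 0. y e i = y e j \<longrightarrow> i = j"
      proof (cases "i = j")
        case False
        then have ne: "of_nat (Suc i) - of_nat (Suc j) \<noteq> (0::complex)" by simp
        have "\<forall>\<^sub>F e in at 0. e \<noteq> (z j - z i) / (of_nat (Suc i) - of_nat (Suc j) :: complex)"
          by (rule eventually_neq_at_within)
        then show ?thesis
        proof eventually_elim
          case (elim e)
          show ?case
          proof
            assume "y e i = y e j"
            then have "e * (of_nat (Suc i) - of_nat (Suc j)) = z j - z i"
              unfolding y_def by (simp add: algebra_simps)
            then show "i = j" using elim ne by (simp add: field_simps)
          qed
        qed
      qed simp
    qed
    then show ?thesis by (simp add: inj_on_def)
  qed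
  have lim: "(y \<longlongrightarrow> z) (at 0)"
  proof -
    have "continuous_on UNIV y" unfolding y_def by (intro continuous_intros)
    then have "(y \<longlongrightarrow> y 0) (at 0)" by (simp add: continuous_on_def)
    moreover have "y 0 = z" by (simp add: y_def fun_eq_iff)
    ultimately show ?thesis by simp
  qed
  have ne: "\<forall>\<^sub>F e in at 0. y e \<noteq> z"
  proof -
    have "\<forall>\<^sub>F e in at (0::complex). e \<noteq> 0" by (rule eventually_neq_at_within)
    then show ?thesis
    proof eventually_elim
      case (elim e)
      then have "y e 0 \<noteq> z 0" by (simp add: y_def)
      then show ?case by metis
    qed
  qed
  have lim': "filterlim y (at z within {y. inj_on y {..<N}}) (at 0)"
    unfolding filterlim_at
  proof (intro conjI lim)
    show "\<forall>\<^sub>F e in at 0. y e \<in> {y. inj_on y {..<N}} \<and> y e \<noteq> z"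
      using inj ne by eventually_elim simp
  qed
  show ?thesis
  proof
    assume "at z within {y. inj_on y {..<N}} = bot"
    with lim' have "filterlim y bot (at 0)" by simp
    then have "\<forall>P. eventually P bot \<longrightarrow> (\<forall>\<^sub>F e in at 0. P (y e))" unfolding filterlim_iff .
    from spec[OF this, of "\<lambda>_. False"] show False by simp
  qed
qed

text \<open>
  The limit in the definition exists everywhere, because the formula agrees with a continuous
  function on the set through which the limit is taken.
\<close>

lemma hall_littlewood_eq:
  assumes "F \<in> mpoly_fun" "\<And>z. inj_on z {..<length lam} \<Longrightarrow> hl_sum t lam {..<length lam} z = F z"
  shows "hall_littlewood t lam z = F z / v_part t lam"
proof -
  define S where "S = {y::nat \<Rightarrow> complex. inj_on y {..<length lam}}"
  have "(F \<longlongrightarrow> F z) (at z within S)"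
    using mpoly_fun_continuous[OF assms(1)] unfolding continuous_on_def
    by (meson UNIV_I subset_UNIV tendsto_within_subset)
  then have "((\<lambda>y. F y / v_part t lam) \<longlongrightarrow> F z / v_part t lam) (at z within S)"
    by (simp add: divide_inverse tendsto_mult_right)
  moreover have "\<forall>\<^sub>F y in at z within S. F y / v_part t lam = HL_formula t lam y"
    unfolding eventually_at_filter
    by (intro always_eventually) (auto simp: S_def HL_formula_eq_hl_sum assms(2))
  ultimately have "(HL_formula t lam \<longlongrightarrow> F z / v_part t lam) (at z within S)"
    by (rule Lim_transform_eventually)
  then show ?thesis
    unfolding hall_littlewood_def S_def[symmetric]
    using at_within_inj_nontrivial[of z "length lam"] by (intro tendsto_Lim) (auto simp: S_def)
qed

section \<open>Integrals over the circle\<close>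

abbreviation unit_interval :: "real measure" where
  "unit_interval \<equiv> restrict_space lborel {0..1}"

definition circ :: "real \<Rightarrow> complex" where
  "circ s = cis (2 * pi * s)"

lemma norm_circ [simp]: "norm (circ s) = 1"
  by (simp add: circ_def)

lemma circ_nonzero [simp]: "circ s \<noteq> 0"
  by (simp add: circ_def)

lemma continuous_on_circ [continuous_intros]: "continuous_on S circ"
  unfolding circ_def by (intro continuous_intros)

lemma emeasure_unit_interval: "emeasure unit_interval (space unit_interval) = 1"
  by (simp add: emeasure_restrict_space space_restrict_space)

lemma emeasure_unit_interval' [simp]: "emeasure unit_interval {0..1} = 1"
  using emeasure_unit_interval by (simp add: space_restrict_space)

lemma sets_unit_interval [simp]: "{0..1} \<in> sets unit_interval"
  using sets.top[of unit_interval] by (simp add: space_restrict_space)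

lemma circ_measurable [measurable]: "circ \<in> borel_measurable unit_interval"
proof -
  have "circ \<in> borel_measurable borel"
    by (intro borel_measurable_continuous_onI continuous_on_circ)
  then show ?thesis by (intro measurable_restrict_space1) simp
qed

lemma circ_integrable:
  assumes "continuous_on (sphere 0 1) f"
  shows "integrable unit_interval (\<lambda>s. f (circ s) :: complex)"
proof -
  have "continuous_on {0..1} (\<lambda>s. f (circ s))"
    by (intro continuous_on_compose2[OF assms] continuous_intros) auto
  then have "set_integrable lborel {0..1} (\<lambda>s. f (circ s))"
    by (rule borel_integrable_atLeastAtMost')
  then show ?thesis by (simp add: integrable_restrict_space set_integrable_def)
qed

lemma circ_mean_value:
  assumes "f holomorphic_on ball 0 r" "r > 1"
  shows "(LINT s|unit_interval. f (circ s)) = f 0"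
proof -
  have sub: "cball 0 1 \<subseteq> ball (0::complex) r" using assms by auto
  have "((\<lambda>u. f u / (u - 0)) has_contour_integral (2 * of_real pi * \<i> * f 0)) (circlepath 0 1)"
    by (rule Cauchy_integral_circlepath_simple) (use assms holomorphic_on_subset[OF _ sub] in auto)
  then have "((\<lambda>s. f (circlepath 0 1 s) / (circlepath 0 1 s) * vector_derivative (circlepath 0 1) (at s within {0..1}))
     has_integral (2 * of_real pi * \<i> * f 0)) {0..1}"
    by (simp add: has_contour_integral_def)
  then have "((\<lambda>s. (2 * of_real pi * \<i>) * f (circ s)) has_integral (2 * of_real pi * \<i> * f 0)) {0..1}"
  proof (rule has_integral_eq[rotated])
    fix s :: real assume s: "s \<in> {0..1}"
    have "circlepath 0 1 s = circ s"
      by (simp add: circlepath circ_def cis_conv_exp mult_ac)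
    moreover have "vector_derivative (circlepath 0 1) (at s within {0..1}) = 2 * of_real pi * \<i> * circ s"
      using vector_derivative_circlepath01[of s 0 1] s
      by (simp add: circ_def cis_conv_exp mult_ac)
    ultimately show "f (circlepath 0 1 s) / (circlepath 0 1 s) * vector_derivative (circlepath 0 1) (at s within {0..1})
       = (2 * of_real pi * \<i>) * f (circ s)"
      by simp
  qed
  from has_integral_mult_right[OF this, of "1 / (2 * of_real pi * \<i>)"]
  have hi: "((\<lambda>s. f (circ s)) has_integral f 0) {0..1}" by simp
  have cont: "continuous_on {0..1} (\<lambda>s. f (circ s))"
  proof (rule continuous_on_compose2[OF _ continuous_on_circ])
    show "continuous_on (cball 0 1) f"
      using assms(1) sub holomorphic_on_imp_continuous_on holomorphic_on_subset by blast
  qed auto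
  have "(LINT s|unit_interval. f (circ s)) = (LINT s:{0..1}|lborel. f (circ s))"
    by (simp add: integral_restrict_space set_lebesgue_integral_def)
  also have "\<dots> = integral {0..1} (\<lambda>s. f (circ s))"
    by (rule set_borel_integral_eq_integral(2)[OF borel_integrable_atLeastAtMost'[OF cont]])
  also have "\<dots> = f 0" using hi by (rule integral_unique)
  finally show ?thesis .
qed

text \<open>
  Inversion on the circle is the reflection \<open>s \<mapsto> 1 - s\<close> of the parameter.
\<close>

lemma circ_integral_inverse:
  "(LINT s|unit_interval. f (inverse (circ s))) = (LINT s|unit_interval. f (circ s) :: complex)"
proof -
  have inv: "inverse (circ s) = circ (1 - s)" for s
  proof -
    have "circ (1 - s) = cis (2 * pi) * cis (- (2 * pi * s))"
      unfolding circ_def cis_mult by (simp add: algebra_simps)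
    then show ?thesis by (simp add: circ_def)
  qed
  have "(LINT s|unit_interval. f (circ s)) = (LINT s|lborel. indicator {0..1} s *\<^sub>R f (circ s))"
    by (simp add: integral_restrict_space)
  also have "\<dots> = \<bar>-1\<bar> *\<^sub>R (LINT s|lborel. indicator {0..1} (1 + (-1) * s) *\<^sub>R f (circ (1 + (-1) * s)))"
    by (rule lborel_integral_real_affine) simp
  also have "\<dots> = (LINT s|lborel. indicator {0..1} s *\<^sub>R f (inverse (circ s)))"
    by (auto simp: inv indicator_def intro!: Bochner_Integration.integral_cong)
  also have "\<dots> = (LINT s|unit_interval. f (inverse (circ s)))"
    by (simp add: integral_restrict_space)
  finally show ?thesis ..
qed

lemma AE_circ_neq: "AE s in unit_interval. circ s \<noteq> c"
proof -
  have fin: "finite {s \<in> {0..1}. circ s = c}"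
  proof (cases "{s \<in> {0..1}. circ s = c} = {}")
    case False
    then obtain s0 where s0: "s0 \<in> {0..1}" "circ s0 = c" by auto
    have "{s \<in> {0..1}. circ s = c} \<subseteq> {s0 - 1, s0, s0 + 1}"
    proof
      fix s assume s: "s \<in> {s \<in> {0..1}. circ s = c}"
      then have "cis (2 * pi * s) = cis (2 * pi * s0)" using s0 by (simp add: circ_def)
      then have "cis (2 * pi * s - 2 * pi * s0) = 1" by (simp add: cis_divide[symmetric])
      then obtain n :: int where n: "2 * pi * s - 2 * pi * s0 = of_int n * (2 * pi)"
        by (metis cis.simps(1) cos_one_2pi_int one_complex.simps(1) mult.commute mult.left_commute)
      then have "2 * pi * (s - s0 - of_int n) = 0" by (simp add: algebra_simps)
      then have "s - s0 = of_int n" by simp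
      moreover have "\<bar>s - s0\<bar> \<le> 1" using s s0 by auto
      ultimately have "\<bar>n\<bar> \<le> 1" by linarith
      then have "n = -1 \<or> n = 0 \<or> n = 1" by auto
      then show "s \<in> {s0 - 1, s0, s0 + 1}" using \<open>s - s0 = of_int n\<close> by auto
    qed
    then show ?thesis by (rule finite_subset) auto
  qed (simp only: finite.emptyI)
  have "AE s in lborel. s \<in> {0..1} \<longrightarrow> circ s \<noteq> c"
    by (rule AE_I'[OF finite_imp_null_set_lborel[OF fin]]) auto
  then show ?thesis by (simp add: AE_restrict_space_iff)
qed

text \<open>
  This is \<open>1 / (1 - u\<^sup>-\<^sup>2)\<close>, the factor \<open>p / (p - q)\<close> for the pair \<open>p = u\<close>, \<open>q = u\<^sup>-\<^sup>1\<close>. Its poles at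
  \<open>\<plusminus>1\<close> lie on the circle, and elsewhere on it \<open>kern u + kern (1/u) = 1\<close>.
\<close>

definition kern :: "complex \<Rightarrow> complex" where
  "kern u = u / (u - inverse u)"

lemma unit_circle_inverse_neq:
  assumes "norm u = 1" "u \<noteq> 1" "u \<noteq> -1"
  shows "u - inverse u \<noteq> (0::complex)"
proof
  assume "u - inverse u = 0"
  moreover have "u \<noteq> 0" using assms by auto
  ultimately have "u * u = 1" by (simp add: field_simps)
  then have "(u - 1) * (u + 1) = 0" by (simp add: algebra_simps)
  then show False using assms by (auto simp: eq_neg_iff_add_eq_0)
qed

text \<open>
  Subtracting from \<open>g\<close> the function \<open>A + B u\<close> that agrees with it at \<open>\<plusminus>1\<close> leaves a multiple of
  \<open>u - 1/u\<close>, so the poles of \<open>kern\<close> disappear: the integrand is \<open>F u + F (1/u)\<close> with \<open>F\<close> holomorphic,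
  and its mean value is \<open>2 F 0 = A\<close>.
\<close>

lemma circ_integral_kern:
  assumes G: "G holomorphic_on ball 0 r" and r: "r > 1"
    and g: "\<And>u. norm u = 1 \<Longrightarrow> g u = G u / u"
  shows "(LINT s|unit_interval. kern (circ s) * g (circ s) + kern (inverse (circ s)) * g (inverse (circ s)))
       = (g 1 + g (-1)) / 2"
proof -
  define A where "A = (g 1 + g (-1)) / 2"
  define B where "B = (g 1 - g (-1)) / 2"
  define P where "P = (\<lambda>z. G z - A * z - B * z\<^sup>2)"
  have P0: "P 1 = 0" "P (-1) = 0"
    using g[of 1] g[of "-1"] by (simp_all add: P_def A_def B_def field_simps)
  have P: "P holomorphic_on ball 0 r" unfolding P_def by (intro holomorphic_intros G)
  define q1 where "q1 = (\<lambda>z. if z = 1 then deriv P 1 else (P z - P 1) / (z - 1))"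
  have q1: "q1 holomorphic_on ball 0 r" unfolding q1_def by (rule pole_lemma_open[OF P]) simp
  define q2 where "q2 = (\<lambda>z. if z = -1 then deriv q1 (-1) else (q1 z - q1 (-1)) / (z - (-1)))"
  have q2: "q2 holomorphic_on ball 0 r" unfolding q2_def by (rule pole_lemma_open[OF q1]) simp
  have Pq: "P z = (z\<^sup>2 - 1) * q2 z" for z
  proof (cases "z = 1 \<or> z = -1")
    case True
    then show ?thesis using P0 by auto
  next
    case False
    have "q1 (-1) = 0" using P0 by (simp add: q1_def)
    then have "q2 z = P z / ((z - 1) * (z + 1))" using False P0 by (simp add: q2_def q1_def)
    moreover have "(z - 1) * (z + 1) \<noteq> 0" using False by (auto simp: eq_neg_iff_add_eq_0)
    moreover have "z\<^sup>2 - 1 = (z - 1) * (z + 1)" by (simp add: algebra_simps power2_eq_square)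
    ultimately show ?thesis by simp
  qed
  define F where "F = (\<lambda>z. A / 2 + B * z + z * q2 z)"
  have F: "F holomorphic_on ball 0 r" unfolding F_def by (intro holomorphic_intros q2) auto
  have sph: "sphere 0 1 \<subseteq> ball (0::complex) r" using r by auto
  have contF: "continuous_on (sphere 0 1) F"
    by (rule holomorphic_on_imp_continuous_on[OF holomorphic_on_subset[OF F sph]])
  have contFi: "continuous_on (sphere 0 1) (\<lambda>u. F (inverse u))"
    by (rule continuous_on_compose2[OF contF]) (auto intro!: continuous_intros simp: norm_inverse)
  have contG: "continuous_on (sphere 0 1) G"
    by (rule holomorphic_on_imp_continuous_on[OF holomorphic_on_subset[OF G sph]])
  have key: "kern u * g u + kern (inverse u) * g (inverse u) = F u + F (inverse u)"
    if u: "norm u = 1" "u \<noteq> 1" "u \<noteq> -1" for u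
  proof -
    have u0: "u \<noteq> 0" using u by auto
    have nz: "u - inverse u \<noteq> 0" by (rule unit_circle_inverse_neq[OF u])
    have gu: "g v = A + B * v + (v - inverse v) * q2 v" if "norm v = 1" for v
    proof -
      have v0: "v \<noteq> 0" using that by auto
      have "G v = A * v + B * v\<^sup>2 + (v\<^sup>2 - 1) * q2 v" using Pq[of v] by (simp add: P_def algebra_simps)
      then have "g v = (A * v + B * v\<^sup>2 + (v\<^sup>2 - 1) * q2 v) / v" using g[OF that] by simp
      also have "\<dots> = A + B * v + (v - inverse v) * q2 v"
        using v0 by (simp add: field_simps power2_eq_square)
      finally show ?thesis .
    qed
    have u2: "u * u - 1 \<noteq> 0" using nz u0 by (simp add: field_simps)
    have 1: "kern u * (u - inverse u) = u" "kern (inverse u) * (inverse u - u) = inverse u"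
      using nz by (simp_all add: kern_def)
    have k: "kern u = u * u / (u * u - 1)" "kern (inverse u) = - 1 / (u * u - 1)"
      using u0 u2 nz by (simp_all add: kern_def divide_simps)
    define D where "D = u * u - 1"
    have D: "D \<noteq> 0" "u * u = D + 1" "u - inverse u = D * inverse u"
      using u2 u0 by (simp_all add: D_def field_simps)
    have kD: "kern u = 1 + 1 / D" "kern (inverse u) = - (1 / D)"
      unfolding k using D(1) by (simp_all add: D_def[symmetric] D(2) add_divide_distrib)
    have 2: "kern u + kern (inverse u) = 1"
      unfolding kD by simp
    have "kern u * u + kern (inverse u) * inverse u = u + (1 / D) * (u - inverse u)"
      unfolding kD by (simp add: algebra_simps)
    then have 3: "kern u * u + kern (inverse u) * inverse u = u + inverse u"
      unfolding D(3) using D(1) by simp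
    have "kern u * g u + kern (inverse u) * g (inverse u)
      = A * (kern u + kern (inverse u)) + B * (kern u * u + kern (inverse u) * inverse u)
        + (kern u * (u - inverse u)) * q2 u + (kern (inverse u) * (inverse u - u)) * q2 (inverse u)"
      using u by (simp add: gu norm_inverse algebra_simps)
    also have "\<dots> = F u + F (inverse u)"
      unfolding 1 2 3 by (simp add: F_def algebra_simps)
    finally show ?thesis .
  qed
  have meas: "(\<lambda>s. g (circ s)) \<in> borel_measurable unit_interval"
    "(\<lambda>s. g (inverse (circ s))) \<in> borel_measurable unit_interval"
  proof -
    have "continuous_on (sphere 0 1) (\<lambda>u. G u / u)"
      by (intro continuous_intros contG) auto
    then have c1: "continuous_on (sphere 0 1) g"
      by (rule continuous_on_cong[THEN iffD1, OF refl, rotated]) (simp add: g)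
    have c2: "continuous_on (sphere 0 1) (\<lambda>u. g (inverse u))"
      by (rule continuous_on_compose2[OF c1]) (auto intro!: continuous_intros simp: norm_inverse)
    show "(\<lambda>s. g (circ s)) \<in> borel_measurable unit_interval"
      using circ_integrable[OF c1] by auto
    show "(\<lambda>s. g (inverse (circ s))) \<in> borel_measurable unit_interval"
      using circ_integrable[OF c2] by auto
  qed
  have "(LINT s|unit_interval. kern (circ s) * g (circ s) + kern (inverse (circ s)) * g (inverse (circ s)))
      = (LINT s|unit_interval. F (circ s) + F (inverse (circ s)))"
  proof (rule integral_cong_AE)
    show "(\<lambda>s. kern (circ s) * g (circ s) + kern (inverse (circ s)) * g (inverse (circ s))) \<in> borel_measurable unit_interval"
      unfolding kern_def using meas by measurable
    show "(\<lambda>s. F (circ s) + F (inverse (circ s))) \<in> borel_measurable unit_interval"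
      using circ_integrable[OF contF] circ_integrable[OF contFi] by auto
    show "AE s in unit_interval. kern (circ s) * g (circ s) + kern (inverse (circ s)) * g (inverse (circ s))
        = F (circ s) + F (inverse (circ s))"
      using AE_circ_neq[of 1] AE_circ_neq[of "-1"] by eventually_elim (simp add: key)
  qed
  also have "\<dots> = (LINT s|unit_interval. F (circ s)) + (LINT s|unit_interval. F (inverse (circ s)))"
    using circ_integrable[OF contF] circ_integrable[OF contFi] by (rule Bochner_Integration.integral_add)
  also have "\<dots> = F 0 + F 0"
    by (simp add: circ_integral_inverse[of F] circ_mean_value[OF F r])
  also have "\<dots> = A" by (simp add: F_def)
  finally show ?thesis by (simp add: A_def)
qed

section \<open>The torus and its generic points\<close>

abbreviation torus :: "nat set \<Rightarrow> (nat \<Rightarrow> real) measure" where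
  "torus I \<equiv> PiM I (\<lambda>_. unit_interval)"

lemma sigma_finite_unit_interval: "sigma_finite_measure unit_interval"
proof -
  have "finite_measure unit_interval"
    by (rule finite_measureI) (simp add: emeasure_unit_interval)
  then show ?thesis by (rule finite_measure.axioms)
qed

interpretation unit_intervals: product_sigma_finite "\<lambda>_::nat. unit_interval"
  by (simp add: product_sigma_finite_def sigma_finite_unit_interval)

lemma finite_measure_torus: "finite I \<Longrightarrow> finite_measure (torus I)"
proof (rule finite_measureI)
  assume "finite I"
  have "emeasure (torus I) (Pi\<^sub>E I (\<lambda>_. space unit_interval)) = 1"
    using \<open>finite I\<close> by (subst unit_intervals.emeasure_PiM) (auto simp: emeasure_unit_interval)
  then show "emeasure (torus I) (space (torus I)) \<noteq> \<infinity>" by (simp add: space_PiM)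
qed

definition torus_point :: "(nat \<Rightarrow> real) \<Rightarrow> nat \<Rightarrow> complex" where
  "torus_point \<theta> j = circ (\<theta> j)"

lemma norm_torus_point [simp]: "norm (torus_point \<theta> j) = 1" by (simp add: torus_point_def)

lemma torus_point_nonzero [simp]: "torus_point \<theta> j \<noteq> 0" by (simp add: torus_point_def)

lemma torus_point_fun_upd: "torus_point (\<theta>(i := s)) = (torus_point \<theta>)(i := circ s)"
  by (auto simp: torus_point_def)

lemma torus_point_measurable [measurable]: "(\<lambda>\<theta>. torus_point \<theta> j) \<in> borel_measurable (torus I)"
proof (cases "j \<in> I")
  case True
  then have "(\<lambda>\<theta>. \<theta> j) \<in> measurable (torus I) unit_interval"
    by (rule measurable_component_singleton)
  then show ?thesis unfolding torus_point_def by measurable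
next
  case False
  show ?thesis
  proof (rule measurable_cong[THEN iffD2])
    fix \<theta> :: "nat \<Rightarrow> real" assume "\<theta> \<in> space (torus I)"
    then have "\<theta> \<in> Pi\<^sub>E I (\<lambda>_. space unit_interval)" by (simp add: space_PiM)
    then have "\<theta> j = undefined" by (rule PiE_arb) (rule False)
    then show "torus_point \<theta> j = circ undefined" by (simp only: torus_point_def)
  qed (rule measurable_const, simp)
qed

text \<open>
  Fubini for null sets: it is enough to vary one coordinate with the others fixed.
\<close>

lemma AE_torus_insert:
  assumes "finite I" "i \<notin> I"
    and meas: "{\<theta> \<in> space (torus (insert i I)). \<not> P \<theta>} \<in> sets (torus (insert i I))"
    and AE: "AE \<theta> in torus I. AE s in unit_interval. P (\<theta>(i := s))"
  shows "AE \<theta> in torus (insert i I). P \<theta>"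
proof -
  define B where "B = {\<theta> \<in> space (torus (insert i I)). \<not> P \<theta>}"
  have [measurable]: "B \<in> sets (torus (insert i I))" using meas by (simp add: B_def)
  have "emeasure (torus (insert i I)) B = (\<integral>\<^sup>+\<theta>. indicator B \<theta> \<partial>torus (insert i I))"
    by simp
  also have "\<dots> = (\<integral>\<^sup>+\<theta>. (\<integral>\<^sup>+s. indicator B (\<theta>(i := s)) \<partial>unit_interval) \<partial>torus I)"
    using assms(1,2) by (intro unit_intervals.product_nn_integral_insert) auto
  also have "\<dots> = (\<integral>\<^sup>+\<theta>. 0 \<partial>torus I)"
  proof (rule nn_integral_cong_AE)
    show "AE \<theta> in torus I. (\<integral>\<^sup>+s. indicator B (\<theta>(i := s)) \<partial>unit_interval) = 0"
      using AE
    proof eventually_elim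
      case (elim \<theta>)
      have "(\<integral>\<^sup>+s. indicator B (\<theta>(i := s)) \<partial>unit_interval) = (\<integral>\<^sup>+s. 0 \<partial>unit_interval)"
        by (rule nn_integral_cong_AE) (use elim in eventually_elim, auto simp: B_def)
      then show ?case by simp
    qed
  qed
  finally have "emeasure (torus (insert i I)) B = 0" by simp
  then show ?thesis
  proof (rule AE_I[of _ _ B, rotated])
    show "{\<theta> \<in> space (torus (insert i I)). \<not> P \<theta>} \<subseteq> B" by (simp add: B_def)
  qed fact+
qed

text \<open>The arguments of the Hall--Littlewood polynomial: the elements of \<open>A\<close>, indexed by themselves,
  and \<open>x\<^sub>i\<close>, \<open>x\<^sub>i\<^sup>-\<^sup>1\<close>, indexed by \<open>(i, True)\<close> and \<open>(i, False)\<close>.\<close>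

fun args :: "(nat \<Rightarrow> complex) \<Rightarrow> complex + nat \<times> bool \<Rightarrow> complex" where
  "args x (Inl e) = e"
| "args x (Inr (i, b)) = (if b then x i else inverse (x i))"

definition arg_index :: "complex set \<Rightarrow> nat set \<Rightarrow> (complex + nat \<times> bool) set" where
  "arg_index A I = Inl ` A \<union> Inr ` (I \<times> UNIV)"

text \<open>
  The arguments \<open>1\<close>, \<open>-1\<close>, \<open>x\<^sub>i\<close>, \<open>x\<^sub>i\<^sup>-\<^sup>1\<close> are to be pairwise distinct; on the torus \<open>x\<^sub>i \<noteq> x\<^sub>i\<^sup>-\<^sup>1\<close>
  amounts to \<open>x\<^sub>i \<noteq> \<plusminus>1\<close>.
\<close>

definition generic :: "nat set \<Rightarrow> (nat \<Rightarrow> complex) \<Rightarrow> bool" where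
  "generic I x \<longleftrightarrow> (\<forall>i\<in>I. x i \<noteq> 1 \<and> x i \<noteq> -1) \<and>
     (\<forall>i\<in>I. \<forall>j\<in>I. i \<noteq> j \<longrightarrow> x i \<noteq> x j \<and> x i \<noteq> inverse (x j))"

lemma arg_index_mono: "A \<subseteq> B \<Longrightarrow> I \<subseteq> K \<Longrightarrow> arg_index A I \<subseteq> arg_index B K"
  by (auto simp: arg_index_def)

lemma generic_inj:
  assumes gen: "generic I x" and norm: "\<And>i. norm (x i) = 1" and A: "A \<subseteq> {1,-1}"
  shows "inj_on (args x) (arg_index A I)"
proof -
  have unit: "norm (x i) = 1 \<and> x i \<noteq> 1 \<and> x i \<noteq> -1" if "i \<in> I" for i
    using gen norm that by (simp add: generic_def)
  have distinct: "x i \<noteq> x j \<and> x i \<noteq> inverse (x j)" if "i \<in> I" "j \<in> I" "i \<noteq> j" for i j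
    using gen that by (simp add: generic_def)
  have self: "x i \<noteq> inverse (x i)" if "i \<in> I" for i
    using unit_circle_inverse_neq[of "x i"] unit[OF that] by auto
  have inv: "inverse (x i) \<noteq> 1 \<and> inverse (x i) \<noteq> -1" if "i \<in> I" for i
    using unit[OF that] by (metis inverse_1 inverse_inverse_eq inverse_minus_eq)
  have "inj_on (args x) (arg_index {1,-1} I)"
  proof (rule inj_onI)
    fix p q assume p: "p \<in> arg_index {1,-1} I" and q: "q \<in> arg_index {1,-1} I" and eq: "args x p = args x q"
    show "p = q"
    proof (cases p)
      case (Inl e)
      then have e: "e = 1 \<or> e = -1" using p by (auto simp: arg_index_def)
      show ?thesis
      proof (cases q)
        case (Inr jb)
        then obtain j b where q': "q = Inr (j, b)" "j \<in> I" using q by (cases jb) (auto simp: arg_index_def)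
        then show ?thesis using eq e unit[of j] inv[of j] Inl by (auto split: if_splits)
      qed (use eq Inl in auto)
    next
      case (Inr ia)
      then obtain i a where p': "p = Inr (i, a)" "i \<in> I" using p by (cases ia) (auto simp: arg_index_def)
      show ?thesis
      proof (cases q)
        case (Inl e)
        then have e: "e = 1 \<or> e = -1" using q by (auto simp: arg_index_def)
        then show ?thesis using eq Inl p' unit[of i] inv[of i] by (auto split: if_splits)
      next
        case (Inr jb)
        then obtain j b where q': "q = Inr (j, b)" "j \<in> I" using q by (cases jb) (auto simp: arg_index_def)
        show ?thesis
        proof (cases "i = j")
          case True
          have "a = b"
          proof (rule ccontr)
            assume "a \<noteq> b"
            then have "args x (Inr (i, True)) = args x (Inr (i, False))"
              using eq[unfolded p' q' True[symmetric]] by (metis (full_types))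
            then show False using self[OF p'(2)] by (simp only: args.simps if_True if_False)
          qed
          then show ?thesis using True p' q' by simp
        next
          case False
          then show ?thesis using eq distinct[of i j] distinct[of j i] p' q'
            by (cases a; cases b) auto
        qed
      qed
    qed
  qed
  then show ?thesis using A by (rule inj_on_subset[OF _ arg_index_mono]) simp
qed

lemma AE_generic:
  assumes "finite I"
  shows "AE \<theta> in torus I. generic I (torus_point \<theta>)"
proof -
  \<comment> \<open>Overwriting coordinate \<open>i\<close> by \<open>0\<close> makes the right-hand side independent of it.\<close>
  have one: "AE \<theta> in torus I. torus_point \<theta> i \<noteq> f (\<lambda>j. if j = i then 0 else torus_point \<theta> j)"
    if i: "i \<in> I" and f: "(\<lambda>\<theta>. f (\<lambda>j. if j = i then 0 else torus_point \<theta> j)) \<in> borel_measurable (torus I)" for i f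
  proof -
    have I: "I = insert i (I - {i})" using i by auto
    show ?thesis
    proof (subst I, rule AE_torus_insert)
      have "{\<theta> \<in> space (torus I). torus_point \<theta> i = f (\<lambda>j. if j = i then 0 else torus_point \<theta> j)} \<in> sets (torus I)"
        using f by measurable
      then show "{\<theta> \<in> space (torus (insert i (I - {i}))). \<not> torus_point \<theta> i \<noteq> f (\<lambda>j. if j = i then 0 else torus_point \<theta> j)}
          \<in> sets (torus (insert i (I - {i})))"
        using I by simp
      have "AE s in unit_interval. torus_point (\<theta>(i := s)) i \<noteq> f (\<lambda>j. if j = i then 0 else torus_point (\<theta>(i := s)) j)" for \<theta>
      proof -
        have "(\<lambda>j. if j = i then 0 else torus_point (\<theta>(i := s)) j) = (\<lambda>j. if j = i then 0 else torus_point \<theta> j)" for s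
          by (auto simp: torus_point_fun_upd)
        then show ?thesis using AE_circ_neq by (simp add: torus_point_fun_upd)
      qed
      then show "AE \<theta> in torus (I - {i}). AE s in unit_interval.
          torus_point (\<theta>(i := s)) i \<noteq> f (\<lambda>j. if j = i then 0 else torus_point (\<theta>(i := s)) j)"
        by simp
    qed (use assms in auto)
  qed
  have 1: "AE \<theta> in torus I. \<forall>i\<in>I. torus_point \<theta> i \<noteq> 1 \<and> torus_point \<theta> i \<noteq> -1"
  proof (rule AE_finite_allI[OF assms], intro AE_conjI)
    fix i assume "i \<in> I"
    then show "AE \<theta> in torus I. torus_point \<theta> i \<noteq> 1" "AE \<theta> in torus I. torus_point \<theta> i \<noteq> -1"
      using one[of i "\<lambda>_. 1"] one[of i "\<lambda>_. -1"] by simp_all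
  qed
  have 2: "AE \<theta> in torus I. \<forall>i\<in>I. \<forall>j\<in>I. i \<noteq> j \<longrightarrow> torus_point \<theta> i \<noteq> torus_point \<theta> j \<and> torus_point \<theta> i \<noteq> inverse (torus_point \<theta> j)"
  proof (intro AE_finite_allI[OF assms])
    fix i j assume ij: "i \<in> I" "j \<in> I"
    show "AE \<theta> in torus I. i \<noteq> j \<longrightarrow> torus_point \<theta> i \<noteq> torus_point \<theta> j \<and> torus_point \<theta> i \<noteq> inverse (torus_point \<theta> j)"
    proof (cases "i = j")
      case False
      then show ?thesis
        using one[OF ij(1), of "\<lambda>x. x j"] one[OF ij(1), of "\<lambda>x. inverse (x j)"] by simp
    qed simp
  qed
  show ?thesis
using 1 2 by eventually_elim (simp add: generic_def)
qed

section \<open>The weights and their residues\<close>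

text \<open>
  The density is built over arbitrary finite index sets \<open>I\<close>, so that any variable can be removed
  without renumbering, and for all \<open>A \<subseteq> {1,-1}\<close>. The normalisation \<open>2 ^ k k!\<close> is left out.
\<close>

definition pair_weight :: "complex \<Rightarrow> complex \<Rightarrow> complex \<Rightarrow> complex" where
  "pair_weight t u v = pm2 1 u v / pm2 t u v"

definition single_weight :: "complex set \<Rightarrow> complex \<Rightarrow> complex \<Rightarrow> complex" where
  "single_weight A t u = (\<Prod>e\<in>A. pm1 e u / pm1 (t * e) u) / pm1 t (u\<^sup>2)"

definition weight :: "complex set \<Rightarrow> complex \<Rightarrow> nat set \<Rightarrow> (nat \<Rightarrow> complex) \<Rightarrow> complex" where
  "weight A t I x = (\<Prod>i\<in>I. single_weight A t (x i)) *
     (\<Prod>j\<in>I. \<Prod>i\<in>{i\<in>I. i < j}. pair_weight t (x i) (x j))"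

definition hl_integrand ::
  "complex \<Rightarrow> complex \<Rightarrow> complex set \<Rightarrow> nat list \<Rightarrow> nat set \<Rightarrow> (nat \<Rightarrow> complex) \<Rightarrow> complex" where
  "hl_integrand t \<alpha> A lam I x =
     hl_sum t lam (arg_index A I) (args x) * weight A t I x * (\<Prod>i\<in>I. pm1 \<alpha> (x i))"

lemma pm1_inverse [simp]: "pm1 a (inverse u) = pm1 a u"
  by (simp add: pm1_def mult.commute)

lemma pair_weight_commute: "pair_weight t u v = pair_weight t v u"
  by (simp add: pair_weight_def pm2_def mult_ac)

lemma pair_weight_inverse [simp]: "pair_weight t (inverse u) v = pair_weight t u v"
  by (simp add: pair_weight_def pm2_def mult_ac)

lemma single_weight_inverse [simp]: "single_weight A t (inverse u) = single_weight A t u"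
  by (simp add: single_weight_def power_inverse)

lemma finite_arg_index [simp]: "finite A \<Longrightarrow> finite I \<Longrightarrow> finite (arg_index A I)"
  by (simp add: arg_index_def)

lemma mult_assoc_eq: "a * b = c \<Longrightarrow> a * (b * d) = c * (d :: complex)"
  by (simp add: mult.assoc[symmetric])

lemma prod_arg_index:
  assumes "finite A" "finite I"
  shows "(\<Prod>q\<in>arg_index A I. f q) = (\<Prod>e\<in>A. f (Inl e)) * (\<Prod>i\<in>I. f (Inr (i, True)) * f (Inr (i, False)))"
proof -
  have "(\<Prod>q\<in>arg_index A I. f q) = (\<Prod>q\<in>Inl ` A. f q) * (\<Prod>q\<in>Inr ` (I \<times> UNIV). f q)"
    unfolding arg_index_def by (rule prod.union_disjoint) (use assms in auto)
  also have "(\<Prod>q\<in>Inr ` (I \<times> UNIV). f q) = (\<Prod>i\<in>I. \<Prod>b\<in>UNIV. f (Inr (i, b)))"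
    by (simp add: prod.reindex inj_on_def prod.cartesian_product)
  finally show ?thesis by (simp add: prod.reindex inj_on_def UNIV_bool mult_ac)
qed

lemma sum_arg_index:
  assumes "finite A" "finite I"
  shows "(\<Sum>q\<in>arg_index A I. f q) = (\<Sum>e\<in>A. f (Inl e)) + (\<Sum>i\<in>I. f (Inr (i, True)) + f (Inr (i, False)))"
proof -
  have "(\<Sum>q\<in>arg_index A I. f q) = (\<Sum>q\<in>Inl ` A. f q) + (\<Sum>q\<in>Inr ` (I \<times> UNIV). f q)"
    unfolding arg_index_def by (rule sum.union_disjoint) (use assms in auto)
  also have "(\<Sum>q\<in>Inr ` (I \<times> UNIV). f q) = (\<Sum>i\<in>I. \<Sum>b\<in>UNIV. f (Inr (i, b)))"
    by (simp add: sum.reindex inj_on_def sum.cartesian_product)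
  finally show ?thesis by (simp add: sum.reindex inj_on_def UNIV_bool add_ac)
qed

text \<open>
  Since \<open>pair_weight\<close> is symmetric, the order of the indices that \<open>weight\<close> uses to list each pair once
  does not matter.
\<close>

lemma weight_insert:
  assumes "finite I" "a \<notin> I"
  shows "weight A t (insert a I) x =
    single_weight A t (x a) * (\<Prod>j\<in>I. pair_weight t (x a) (x j)) * weight A t I x"
proof -
  define c where "c = (\<lambda>i j. pair_weight t (x i) (x j))"
  have c: "c i j = c j i" for i j by (simp add: c_def pair_weight_commute)
  have 1: "{i \<in> insert a I. i < a} = {i\<in>I. i < a}" by auto
  have 2: "(\<Prod>i\<in>{i \<in> insert a I. i < j}. c i j) = (if a < j then c a j else 1) * (\<Prod>i\<in>{i\<in>I. i < j}. c i j)" for j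
  proof (cases "a < j")
    case True
    then have "{i \<in> insert a I. i < j} = insert a {i\<in>I. i < j}" by auto
    then show ?thesis using True assms by simp
  next
    case False
    then have "{i \<in> insert a I. i < j} = {i\<in>I. i < j}" by auto
    then show ?thesis using False by simp
  qed
  have 3: "(\<Prod>i\<in>{i\<in>I. i < a}. c i a) = (\<Prod>j\<in>I. if j < a then c j a else 1)"
    using assms(1) by (simp add: prod.If_cases Int_def)
  have "(\<Prod>i\<in>{i\<in>I. i < a}. c i a) * (\<Prod>j\<in>I. if a < j then c a j else 1)
      = (\<Prod>j\<in>I. c a j)"
    unfolding 3 prod.distrib[symmetric]
  proof (rule prod.cong[OF refl])
    fix j assume "j \<in> I"
    then have "j \<noteq> a" using assms by auto
    then show "(if j < a then c j a else 1) * (if a < j then c a j else 1) = c a j"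
      using c[of j a] by auto
  qed
  note 4 = this
  have "(\<Prod>j\<in>insert a I. \<Prod>i\<in>{i \<in> insert a I. i < j}. c i j)
      = (\<Prod>j\<in>insert a I. if a < j then c a j else 1) * (\<Prod>j\<in>insert a I. \<Prod>i\<in>{i\<in>I. i < j}. c i j)"
    by (simp only: 2 prod.distrib)
  also have "\<dots> = ((\<Prod>i\<in>{i\<in>I. i < a}. c i a) * (\<Prod>j\<in>I. if a < j then c a j else 1)) *
      (\<Prod>j\<in>I. \<Prod>i\<in>{i\<in>I. i < j}. c i j)"
    using assms by simp
  finally have "(\<Prod>j\<in>insert a I. \<Prod>i\<in>{i \<in> insert a I. i < j}. c i j)
      = (\<Prod>j\<in>I. c a j) * (\<Prod>j\<in>I. \<Prod>i\<in>{i\<in>I. i < j}. c i j)"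
    unfolding 4 .
  then show ?thesis
    using assms unfolding weight_def c_def by (simp add: mult_ac)
qed

lemma weight_cong: "(\<And>i. i \<in> I \<Longrightarrow> x i = y i) \<Longrightarrow> weight A t I x = weight A t I y"
  unfolding weight_def by (auto intro!: arg_cong2[of _ _ _ _ "(*)"] prod.cong)

text \<open>
  The denominators of the density do not vanish on the torus.
\<close>

lemma one_minus_neq:
  assumes "norm t < 1" "norm c = 1"
  shows "1 - t * c \<noteq> (0::complex)"
proof
  assume "1 - t * c = 0"
  then have "t * c = 1" by simp
  then have "norm t * norm c = 1" by (metis norm_mult norm_one)
  then show False using assms by simp
qed

lemma one_minus_neqs:
  assumes "norm t < 1" "norm u = 1" "norm v = 1"
  shows "1 - t * u * v \<noteq> (0::complex)" "1 - t * u / v \<noteq> 0"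
  using one_minus_neq[OF assms(1), of "u * v"] one_minus_neq[OF assms(1), of "u / v"] assms
  by (simp_all add: norm_mult norm_divide mult.assoc)

text \<open>
  In this and the next two lemmas the factors \<open>(u - t q) / (u - q)\<close> of the Hall--Littlewood sum cancel
  the factors of the density in \<open>u\<^sup>-\<^sup>1\<close>. What remains has its poles outside the closed disc, except
  for \<open>kern u\<close>, which comes from \<open>q = u\<^sup>-\<^sup>1\<close>.
\<close>

lemma single_residue_factor:
  assumes "norm t < 1" "norm u = 1" "norm e = 1" "u \<noteq> e"
  shows "(u - t * e) / (u - e) * (pm1 e u / pm1 (t * e) u) = (1 - e * u) / (1 - t * e * u)"
proof -
  have u0: "u \<noteq> 0" using assms by auto
  define a where "a = 1 - e / u"
  define b where "b = 1 - t * e / u"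
  have a: "a \<noteq> 0" "u - e = u * a" using assms(4) u0 by (auto simp: a_def field_simps)
  have b: "b \<noteq> 0" "u - t * e = u * b"
    using one_minus_neqs(2)[OF assms(1,3,2)] u0 by (auto simp: b_def field_simps)
  have "pm1 e u = (1 - e * u) * a" "pm1 (t * e) u = (1 - t * e * u) * b"
    by (simp_all add: pm1_def a_def b_def divide_inverse)
  then show ?thesis using a b u0 by simp
qed

lemma pair_residue_factor:
  assumes "norm t < 1" "norm u = 1" "norm v = 1" "u \<noteq> v" "u \<noteq> inverse v"
  shows "(u - t * v) / (u - v) * ((u - t * inverse v) / (u - inverse v)) * pair_weight t u v
    = (1 - u * v) * (1 - u / v) / ((1 - t * u * v) * (1 - t * u / v))"
proof -
  have u0: "u \<noteq> 0" "v \<noteq> 0" using assms by auto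
  have i: "norm (inverse u) = 1" "norm (inverse v) = 1" using assms by (auto simp: norm_inverse)
  define a where "a = 1 - inverse u * v"
  define b where "b = 1 - inverse u * inverse v"
  define a' where "a' = 1 - t * inverse u * v"
  define b' where "b' = 1 - t * inverse u * inverse v"
  have a: "a \<noteq> 0" "u - v = u * a" "b \<noteq> 0" "u - inverse v = u * b"
    using assms(4,5) u0 by (auto simp: a_def b_def field_simps)
  have b: "a' \<noteq> 0" "u - t * v = u * a'" "b' \<noteq> 0" "u - t * inverse v = u * b'"
    using one_minus_neqs(1)[OF assms(1) i(1) assms(3)] one_minus_neqs(1)[OF assms(1) i] u0
    by (auto simp: a'_def b'_def field_simps)
  have w: "pm2 1 u v = (1 - u * v) * (1 - u / v) * a * b"
    "pm2 t u v = (1 - t * u * v) * (1 - t * u / v) * a' * b'"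
    by (simp_all add: pm2_def a_def b_def a'_def b'_def divide_inverse)
  show ?thesis unfolding pair_weight_def w a(2,4) b(2,4) using a(1,3) b(1,3) u0 by simp
qed

lemma self_residue_factor:
  assumes "norm t < 1" "norm u = 1"
  shows "(u - t * inverse u) / (u - inverse u) * (1 / pm1 t (u\<^sup>2)) = kern u / (1 - t * u\<^sup>2)"
proof -
  have u0: "u \<noteq> 0" using assms by auto
  define b where "b = 1 - t * inverse (u\<^sup>2)"
  have b: "b \<noteq> 0" using one_minus_neq[OF assms(1), of "inverse (u\<^sup>2)"] assms(2)
    by (auto simp: b_def norm_inverse norm_power)
  have "u - t * inverse u = u * b" using u0 by (simp add: b_def field_simps power2_eq_square)
  moreover have "pm1 t (u\<^sup>2) = (1 - t * u\<^sup>2) * b" by (simp add: pm1_def b_def)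
  ultimately show ?thesis using b by (simp add: kern_def)
qed

text \<open>
  When \<open>e = \<plusminus>1\<close> carries the part, its factors in the density cancel completely, because \<open>1/e = e\<close>.
\<close>

lemma removed_point_factor:
  assumes "norm t < 1" "norm u = 1" "e = 1 \<or> e = -1" "u \<noteq> e"
  shows "(e - t * u) / (e - u) * ((e - t * inverse u) / (e - inverse u)) * (pm1 e u / pm1 (t * e) u) = 1"
proof -
  have u0: "u \<noteq> 0" using assms by auto
  have ee: "e * e = 1" "norm e = 1" "e \<noteq> 0" using assms by auto
  have i: "norm (inverse u) = 1" using assms by (simp add: norm_inverse)
  define a where "a = 1 - e * u"
  define a' where "a' = 1 - e * inverse u"
  define b where "b = 1 - t * e * u"
  define b' where "b' = 1 - t * e * inverse u"
  have eqs: "e - u = e * a" "e - inverse u = e * a'" "e - t * u = e * b" "e - t * inverse u = e * b'"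
    using ee(1) by (simp_all add: a_def a'_def b_def b'_def right_diff_distrib mult.assoc[symmetric])
  have "b \<noteq> 0" "b' \<noteq> 0"
    using one_minus_neqs(1)[OF assms(1) ee(2) assms(2)] one_minus_neqs(1)[OF assms(1) ee(2) i]
    by (simp_all add: b_def b'_def)
  moreover have "a \<noteq> 0" "a' \<noteq> 0"
  proof -
    have "inverse u \<noteq> e" using assms(3,4) by (metis inverse_1 inverse_inverse_eq inverse_minus_eq)
    then show "a \<noteq> 0" "a' \<noteq> 0" using assms(4) eqs(1,2) by auto
  qed
  moreover have "pm1 e u = a * a'" "pm1 (t * e) u = b * b'"
    by (simp_all add: pm1_def a_def a'_def b_def b'_def)
  ultimately show ?thesis using ee(3) unfolding eqs by simp
qed

text \<open>
  The function \<open>g\<close> of the variable \<open>x\<^sub>i\<close>, with the other variables as parameters; \<open>F\<close> stands for the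
  polynomial extending the sum over the remaining parts, at the remaining arguments \<open>x\<^sub>i\<^sup>-\<^sup>1\<close>, \<open>A\<close>
  and \<open>x\<^sub>j\<^sup>\<plusminus>\<^sup>1\<close> for \<open>j \<in> I\<close>.
\<close>

definition residue_fun ::
  "complex \<Rightarrow> complex \<Rightarrow> complex set \<Rightarrow> nat \<Rightarrow> nat \<Rightarrow> nat set \<Rightarrow>
   ((complex + nat \<times> bool \<Rightarrow> complex) \<Rightarrow> complex) \<Rightarrow> (nat \<Rightarrow> complex) \<Rightarrow> complex" where
  "residue_fun t \<alpha> A l i I F x =
     x i ^ l * F (args x) * (\<Prod>e\<in>A. (1 - e * x i) / (1 - t * e * x i)) *
     (\<Prod>j\<in>I. (1 - x i * x j) * (1 - x i / x j) / ((1 - t * x i * x j) * (1 - t * x i / x j))) *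
     (pm1 \<alpha> (x i) / (1 - t * (x i)\<^sup>2)) * (weight A t I x * (\<Prod>j\<in>I. pm1 \<alpha> (x j)))"

text \<open>
  The term of the integrand in which \<open>x\<^sub>i\<close> carries the part \<open>l\<close>. It is written with the set of the
  remaining arguments, so that replacing \<open>x\<^sub>i\<close> by its inverse yields the term of \<open>x\<^sub>i\<^sup>-\<^sup>1\<close>.
\<close>

definition pair_term ::
  "complex \<Rightarrow> complex \<Rightarrow> complex set \<Rightarrow> nat \<Rightarrow> nat list \<Rightarrow> nat \<Rightarrow> nat set \<Rightarrow> (nat \<Rightarrow> complex) \<Rightarrow> complex" where
  "pair_term t \<alpha> A l ls i I x = (let Y = insert (inverse (x i)) (args x ` arg_index A I) in
     x i ^ l * (\<Prod>q\<in>Y. (x i - t * q) / (x i - q)) * hl_sum t ls Y (\<lambda>u. u) *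
     weight A t (insert i I) x * (\<Prod>j\<in>insert i I. pm1 \<alpha> (x j)))"

lemma pair_term_eq:
  assumes t: "norm t < 1" and x: "\<And>j. norm (x j) = 1" and A: "A \<subseteq> {1,-1}" and I: "finite I" "i \<notin> I"
    and gen: "generic (insert i I) x"
    and F: "\<And>z. inj_on z (insert (Inr (i, False)) (arg_index A I)) \<Longrightarrow>
      hl_sum t ls (insert (Inr (i, False)) (arg_index A I)) z = F z"
  shows "pair_term t \<alpha> A l ls i I x = kern (x i) * residue_fun t \<alpha> A l i I F x"
proof -
  have finA: "finite A" using A by (rule finite_subset) simp
  have nA: "norm e = 1" if "e \<in> A" for e using that A by auto
  have inj: "inj_on (args x) (arg_index A (insert i I))" by (rule generic_inj[OF gen x A])
  define p where "p = (Inr (i, True) :: complex + nat \<times> bool)"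
  have sub: "insert (Inr (i, False)) (arg_index A I) \<subseteq> arg_index A (insert i I)" by (auto simp: arg_index_def)
  have injF: "inj_on (args x) (insert (Inr (i, False)) (arg_index A I))" by (rule inj_on_subset[OF inj sub])
  have nin: "(Inr (i, False)) \<notin> arg_index A I" using I by (auto simp: arg_index_def)
  have pin: "p \<in> arg_index A (insert i I)" by (auto simp: p_def arg_index_def)
  have neq: "x i \<noteq> args x q" if "q \<in> arg_index A I" for q
  proof
    assume "x i = args x q"
    then have "args x p = args x q" by (simp add: p_def)
    then have "p = q" using inj_onD[OF inj] pin sub that by blast
    then show False using that I by (auto simp: p_def arg_index_def)
  qed
  have neqA: "x i \<noteq> e" if "e \<in> A" for e using neq[of "Inl e"] that by (auto simp: arg_index_def)
  have neqI: "x i \<noteq> x j" "x i \<noteq> inverse (x j)" if "j \<in> I" for j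
    using neq[of "Inr (j, True)"] neq[of "Inr (j, False)"] that by (auto simp: arg_index_def)
  define Y where "Y = insert (inverse (x i)) (args x ` arg_index A I)"
  have Y: "Y = args x ` insert (Inr (i, False)) (arg_index A I)" by (simp add: Y_def)
  have HF: "hl_sum t ls Y (\<lambda>u. u) = F (args x)"
    unfolding Y using hl_sum_image[OF injF] F[OF injF] by simp
  define h where "h = (\<lambda>q. (x i - t * q) / (x i - q))"
  have "(\<Prod>q\<in>Y. h q) = (\<Prod>q\<in>insert (Inr (i, False)) (arg_index A I). h (args x q))"
    unfolding Y using injF by (simp only: prod.reindex o_def)
  also have "\<dots> = h (inverse (x i)) * ((\<Prod>e\<in>A. h e) * (\<Prod>j\<in>I. h (x j) * h (inverse (x j))))"
    using nin finA I by (simp add: prod_arg_index)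
  finally have P: "(\<Prod>q\<in>Y. h q) = h (inverse (x i)) * ((\<Prod>e\<in>A. h e) * (\<Prod>j\<in>I. h (x j) * h (inverse (x j))))" .
  have 1: "(\<Prod>e\<in>A. h e) * (\<Prod>e\<in>A. pm1 e (x i) / pm1 (t * e) (x i)) = (\<Prod>e\<in>A. (1 - e * x i) / (1 - t * e * x i))"
    unfolding prod.distrib[symmetric] h_def
    using single_residue_factor[OF t x nA neqA] by (intro prod.cong refl) auto
  have 2: "(\<Prod>j\<in>I. h (x j) * h (inverse (x j))) * (\<Prod>j\<in>I. pair_weight t (x i) (x j))
     = (\<Prod>j\<in>I. (1 - x i * x j) * (1 - x i / x j) / ((1 - t * x i * x j) * (1 - t * x i / x j)))"
    unfolding prod.distrib[symmetric] h_def
    using pair_residue_factor[OF t x x neqI] by (intro prod.cong refl) auto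
  have 3: "h (inverse (x i)) * (1 / pm1 t ((x i)\<^sup>2)) = kern (x i) / (1 - t * (x i)\<^sup>2)"
    unfolding h_def by (rule self_residue_factor[OF t x])
  have "pair_term t \<alpha> A l ls i I x = x i ^ l * (\<Prod>q\<in>Y. h q) * F (args x) *
      (single_weight A t (x i) * (\<Prod>j\<in>I. pair_weight t (x i) (x j)) * weight A t I x) *
      (pm1 \<alpha> (x i) * (\<Prod>j\<in>I. pm1 \<alpha> (x j)))"
    unfolding pair_term_def Y_def[symmetric] Let_def HF weight_insert[OF I] h_def
    using I by simp
  also have "\<dots> = x i ^ l * F (args x) *
     ((\<Prod>e\<in>A. h e) * (\<Prod>e\<in>A. pm1 e (x i) / pm1 (t * e) (x i))) *
     ((\<Prod>j\<in>I. h (x j) * h (inverse (x j))) * (\<Prod>j\<in>I. pair_weight t (x i) (x j))) *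
     (h (inverse (x i)) * (1 / pm1 t ((x i)\<^sup>2))) * pm1 \<alpha> (x i) *
     (weight A t I x * (\<Prod>j\<in>I. pm1 \<alpha> (x j)))"
    unfolding P single_weight_def by simp
  also have "\<dots> = kern (x i) * residue_fun t \<alpha> A l i I F x"
    unfolding 1 2 3 residue_fun_def by simp
  finally show ?thesis .
qed

lemma generic_upd_inverse:
  assumes "generic I x"
  shows "generic I (x(i := inverse (x i)))"
proof -
  have "inverse (x i) \<noteq> 1 \<and> inverse (x i) \<noteq> -1" if "i \<in> I"
    using assms that unfolding generic_def by (metis inverse_1 inverse_inverse_eq inverse_minus_eq)
  moreover have "inverse (x i) \<noteq> x j \<and> x j \<noteq> inverse (x i) \<and> inverse (x i) \<noteq> inverse (x j) \<and> x j \<noteq> inverse (inverse (x i))"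
    if "i \<in> I" "j \<in> I" "i \<noteq> j" for j
    using assms that unfolding generic_def by (metis inverse_inverse_eq)
  ultimately show ?thesis using assms by (auto simp: generic_def)
qed

lemma hl_integrand_expand:
  assumes t: "norm t < 1" and x: "\<And>j. norm (x j) = 1" and A: "A \<subseteq> {1,-1}" and I: "finite I"
    and gen: "generic I x"
  shows "hl_integrand t \<alpha> A (l # ls) I x =
    (\<Sum>e\<in>A. e ^ l * (\<Prod>e'\<in>A-{e}. (e - t * e') / (e - e')) * hl_integrand t \<alpha> (A - {e}) ls I x) +
    (\<Sum>i\<in>I. pair_term t \<alpha> A l ls i (I - {i}) x + pair_term t \<alpha> A l ls i (I - {i}) (x(i := inverse (x i))))"
proof -
  have finA: "finite A" using A by (rule finite_subset) simp
  define W where "W = weight A t I x * (\<Prod>i\<in>I. pm1 \<alpha> (x i))"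
  define T where "T = (\<lambda>p. args x p ^ l * (\<Prod>q\<in>arg_index A I-{p}. (args x p - t * args x q) / (args x p - args x q))
      * hl_sum t ls (arg_index A I - {p}) (args x) * W)"
  have inj: "inj_on (args x) (arg_index A I)" by (rule generic_inj[OF gen x A])
  have exp: "hl_integrand t \<alpha> A (l # ls) I x = (\<Sum>e\<in>A. T (Inl e)) + (\<Sum>i\<in>I. T (Inr (i, True)) + T (Inr (i, False)))"
    unfolding hl_integrand_def hl_sum.simps sum_arg_index[OF finA I, symmetric]
    by (simp add: T_def W_def sum_distrib_right mult.assoc)
  have pair: "T (Inr (i, b)) = args x (Inr (i, b)) ^ l *
      (\<Prod>q\<in>insert (args x (Inr (i, \<not> b))) (args x ` arg_index A (I - {i})). (args x (Inr (i, b)) - t * q) / (args x (Inr (i, b)) - q)) *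
      hl_sum t ls (insert (args x (Inr (i, \<not> b))) (args x ` arg_index A (I - {i}))) (\<lambda>u. u) * W" if i: "i \<in> I" for i b
  proof -
    have set: "arg_index A I - {Inr (i, b)} = insert (Inr (i, \<not> b)) (arg_index A (I - {i}))"
      using i by (auto simp: arg_index_def)
    have im: "insert (args x (Inr (i, \<not> b))) (args x ` arg_index A (I - {i})) = args x ` (arg_index A I - {Inr (i, b)})"
      unfolding set by simp
    have inj': "inj_on (args x) (arg_index A I - {Inr (i, b)})" by (rule inj_on_subset[OF inj]) auto
    show ?thesis
      unfolding im T_def using inj' by (simp only: prod.reindex o_def hl_sum_image)
  qed
  have T1: "T (Inr (i, True)) = pair_term t \<alpha> A l ls i (I - {i}) x" if i: "i \<in> I" for i
    using pair[OF i, of True] i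
    by (simp add: pair_term_def Let_def W_def insert_absorb mult.assoc)
  have T2: "T (Inr (i, False)) = pair_term t \<alpha> A l ls i (I - {i}) (x(i := inverse (x i)))" if i: "i \<in> I" for i
  proof -
    define y where "y = x(i := inverse (x i))"
    have yi: "y i = inverse (x i)" and yj: "\<And>j. j \<in> I - {i} \<Longrightarrow> y j = x j" by (auto simp: y_def)
    have "args y q = args x q" if "q \<in> arg_index A (I - {i})" for q
    proof (cases q)
      case (Inr jb)
      then show ?thesis using that by (cases jb) (auto simp: arg_index_def y_def)
    qed simp
    then have im: "args y ` arg_index A (I - {i}) = args x ` arg_index A (I - {i})" by (intro image_cong) auto
    have "weight A t (insert i (I - {i})) y = weight A t (insert i (I - {i})) x"
    proof -
      have fin: "finite (I - {i})" "i \<notin> I - {i}" using I by auto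
      have 1: "weight A t (I - {i}) y = weight A t (I - {i}) x" by (rule weight_cong[OF yj])
      have 2: "(\<Prod>j\<in>I - {i}. pair_weight t (inverse (x i)) (y j)) = (\<Prod>j\<in>I - {i}. pair_weight t (x i) (x j))"
        using yj by (intro prod.cong) auto
      show ?thesis unfolding weight_insert[OF fin] 1 yi 2 by simp
    qed
    moreover have "(\<Prod>j\<in>insert i (I - {i}). pm1 \<alpha> (y j)) = (\<Prod>j\<in>insert i (I - {i}). pm1 \<alpha> (x j))"
      by (intro prod.cong) (auto simp: y_def)
    ultimately have "pair_term t \<alpha> A l ls i (I - {i}) y = T (Inr (i, False))"
      using pair[OF i, of False] i
      by (simp add: pair_term_def Let_def W_def insert_absorb mult.assoc im yi)
    then show ?thesis by (simp add: y_def)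
  qed
  have T0: "T (Inl e) = e ^ l * (\<Prod>e'\<in>A-{e}. (e - t * e') / (e - e')) * hl_integrand t \<alpha> (A - {e}) ls I x"
    if e: "e \<in> A" for e
  proof -
    have set: "arg_index A I - {Inl e} = arg_index (A - {e}) I" by (auto simp: arg_index_def)
    have ee: "e = 1 \<or> e = -1" using e A by auto
    have xe: "x i \<noteq> e" if "i \<in> I" for i using gen that ee by (auto simp: generic_def)
    have "(\<Prod>i\<in>I. (e - t * x i) / (e - x i) * ((e - t * inverse (x i)) / (e - inverse (x i)))) * weight A t I x
       = weight (A - {e}) t I x"
    proof -
      have s: "single_weight A t u = pm1 e u / pm1 (t * e) u * single_weight (A - {e}) t u" for u
        unfolding single_weight_def using e finA by (simp add: prod.remove)
      have "(\<Prod>i\<in>I. (e - t * x i) / (e - x i) * ((e - t * inverse (x i)) / (e - inverse (x i)))) * (\<Prod>i\<in>I. single_weight A t (x i))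
        = (\<Prod>i\<in>I. single_weight (A - {e}) t (x i))"
        unfolding prod.distrib[symmetric]
      proof (rule prod.cong[OF refl])
        fix i assume "i \<in> I"
        show "(e - t * x i) / (e - x i) * ((e - t * inverse (x i)) / (e - inverse (x i))) * single_weight A t (x i)
          = single_weight (A - {e}) t (x i)"
          unfolding s mult_assoc_eq[OF removed_point_factor[OF t x ee xe[OF \<open>i \<in> I\<close>]]] by (rule mult_1)
      qed
      then show ?thesis unfolding weight_def by (rule mult_assoc_eq)
    qed
    then show ?thesis
      unfolding T_def set hl_integrand_def W_def
      using finA I by (simp add: prod_arg_index mult_ac)
  qed
  show ?thesis unfolding exp by (simp only: T0 T1 T2 cong: sum.cong)
qed

section \<open>Integrating out one variable\<close>

text \<open>
  A variable cannot be frozen at a point that is already among the arguments.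
\<close>

lemma residue_fun_zero:
  assumes "finite A" "e \<in> A" "e * e = 1"
  shows "residue_fun t \<alpha> A l i I F (x(i := e)) = 0"
proof -
  have "(\<Prod>e'\<in>A. (1 - e' * e) / (1 - t * e' * e)) = 0"
    using assms by (intro prod_zero bexI[of _ e]) auto
  then show ?thesis by (simp add: residue_fun_def)
qed

definition residue_coeff :: "complex \<Rightarrow> complex \<Rightarrow> complex set \<Rightarrow> nat \<Rightarrow> complex \<Rightarrow> complex" where
  "residue_coeff t \<alpha> A l e =
     e ^ l * (\<Prod>e'\<in>A. (1 - e' * e) / (1 - t * e' * e)) * ((1 - \<alpha> * e)\<^sup>2 / (1 - t))"

text \<open>
  Freezing \<open>x\<^sub>i\<close> at \<open>e = \<plusminus>1\<close>: the factors in \<open>e\<close> and \<open>x\<^sub>j\<close> are those by which the density for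
  \<open>insert e A\<close> differs from the one for \<open>A\<close>, and the remaining argument \<open>x\<^sub>i\<^sup>-\<^sup>1 = e\<close> becomes the new
  element of \<open>A\<close>.
\<close>

lemma residue_fun_value:
  assumes t: "norm t < 1" and x: "\<And>j. norm (x j) = 1" and A: "A \<subseteq> {1,-1}" and I: "finite I" "i \<notin> I"
    and gen: "generic I x" and e: "e = 1 \<or> e = -1" "e \<notin> A"
    and F: "\<And>z. inj_on z (insert (Inr (i, False)) (arg_index A I)) \<Longrightarrow>
      hl_sum t ls (insert (Inr (i, False)) (arg_index A I)) z = F z"
  shows "residue_fun t \<alpha> A l i I F (x(i := e)) =
    residue_coeff t \<alpha> A l e * hl_integrand t \<alpha> (insert e A) ls I x"
proof -
  have finA: "finite A" using A by (rule finite_subset) simp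
  define y where "y = x(i := e)"
  have yi: "y i = e" and yj: "\<And>j. j \<in> I \<Longrightarrow> y j = x j" using I by (auto simp: y_def)
  have ie: "inverse e = e" "e\<^sup>2 = 1" using e by auto
  have args: "args y q = args x q" if "q \<in> arg_index A I" for q
  proof (cases q)
    case (Inr jb)
    then show ?thesis using that yj by (cases jb) (auto simp: arg_index_def)
  qed simp
  have inj: "inj_on (args x) (arg_index (insert e A) I)"
    by (rule generic_inj[OF gen x]) (use A e in auto)
  have arg_index: "arg_index (insert e A) I = insert (Inl e) (arg_index A I)" by (auto simp: arg_index_def)
  have nin: "Inl e \<notin> arg_index A I" "Inr (i, False) \<notin> arg_index A I" using e I by (auto simp: arg_index_def)
  have im: "args y ` insert (Inr (i, False)) (arg_index A I) = args x ` arg_index (insert e A) I"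
    unfolding arg_index using args by (auto simp: yi ie)
  have inj': "inj_on (args y) (insert (Inr (i, False)) (arg_index A I))"
  proof (rule eq_card_imp_inj_on)
    show "finite (insert (Inr (i, False)) (arg_index A I))" using finA I by simp
    have "card (args y ` insert (Inr (i, False)) (arg_index A I)) = card (arg_index (insert e A) I)"
      unfolding im by (rule card_image[OF inj])
    also have "\<dots> = card (insert (Inr (i, False)) (arg_index A I))"
      unfolding arg_index using nin finA I by simp
    finally show "card (args y ` insert (Inr (i, False)) (arg_index A I)) = card (insert (Inr (i, False)) (arg_index A I))" .
  qed
  have Fy: "F (args y) = hl_sum t ls (arg_index (insert e A) I) (args x)"
    using F[OF inj'] hl_sum_image[OF inj', of t ls] hl_sum_image[OF inj, of t ls] im by metis
  have w: "weight A t I y = weight A t I x" by (rule weight_cong[OF yj])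
  have pr: "(\<Prod>j\<in>I. (1 - e * y j) * (1 - e / y j) / ((1 - t * e * y j) * (1 - t * e / y j))) * weight A t I y
      = weight (insert e A) t I x"
  proof -
    have s: "(1 - e * u) * (1 - e / u) / ((1 - t * e * u) * (1 - t * e / u)) * single_weight A t u
        = single_weight (insert e A) t u" for u
      unfolding single_weight_def using e finA by (simp add: pm1_def divide_inverse)
    have "(\<Prod>j\<in>I. (1 - e * y j) * (1 - e / y j) / ((1 - t * e * y j) * (1 - t * e / y j))) * (\<Prod>j\<in>I. single_weight A t (x j))
       = (\<Prod>j\<in>I. single_weight (insert e A) t (x j))"
      unfolding prod.distrib[symmetric] using s yj by (intro prod.cong) auto
    then show ?thesis unfolding w unfolding weight_def by (rule mult_assoc_eq)
  qed
  have pm: "pm1 \<alpha> e = (1 - \<alpha> * e)\<^sup>2" by (simp add: pm1_def ie power2_eq_square)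
  have pa: "(\<Prod>j\<in>I. pm1 \<alpha> (y j)) = (\<Prod>j\<in>I. pm1 \<alpha> (x j))" using yj by (intro prod.cong) auto
  have "residue_fun t \<alpha> A l i I F y =
     e ^ l * F (args y) * (\<Prod>e'\<in>A. (1 - e' * e) / (1 - t * e' * e)) * ((1 - \<alpha> * e)\<^sup>2 / (1 - t)) *
     ((\<Prod>j\<in>I. (1 - e * y j) * (1 - e / y j) / ((1 - t * e * y j) * (1 - t * e / y j))) * weight A t I y) *
     (\<Prod>j\<in>I. pm1 \<alpha> (x j))"
    unfolding residue_fun_def yi pa pm ie by simp
  then show ?thesis
    unfolding pr Fy residue_coeff_def hl_integrand_def y_def[symmetric] by (simp add: mult_ac)
qed

text \<open>
  Here the ordering of the parts enters. As a polynomial in \<open>u\<^sup>-\<^sup>1\<close> the sum over the remaining parts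
  has degree at most \<open>l\<close>, so the factor \<open>u ^ l\<close> clears its pole at \<open>0\<close>.
\<close>

lemma residue_fun_numerator:
  assumes x: "\<And>j. norm (x j) = 1" and A: "A \<subseteq> {1,-1}" and I: "finite I" "i \<notin> I"
    and gen: "generic I x" and ls: "\<And>k. k \<in> set ls \<Longrightarrow> k \<le> l"
    and Fpoly: "F \<in> mpoly_fun"
    and F: "\<And>z. inj_on z (insert (Inr (i, False)) (arg_index A I)) \<Longrightarrow>
      hl_sum t ls (insert (Inr (i, False)) (arg_index A I)) z = F z"
    and Fcong: "\<And>z y. (\<And>p. p \<in> insert (Inr (i, False)) (arg_index A I) \<Longrightarrow> z p = y p) \<Longrightarrow> F z = F y"
  obtains c where "\<And>u. u \<noteq> 0 \<Longrightarrow> u ^ l * F (args (x(i := u))) = (\<Sum>k\<le>l. c k * u ^ (l - k))"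
proof -
  have finA: "finite A" using A by (rule finite_subset) simp
  define J where "J = arg_index A I"
  have finJ: "finite J" using finA I by (simp add: J_def)
  have nin: "Inr (i, False) \<notin> J" using I by (auto simp: J_def arg_index_def)
  have inj: "inj_on (args x) J" unfolding J_def by (rule generic_inj[OF gen x A])
  obtain P where P: "\<And>v. F ((args x)(Inr (i, False) := v)) = poly P v"
    using mpoly_fun_one_variable[OF Fpoly] by metis
  define Y where "Y = args x ` J"
  have finY: "finite Y" using finJ by (simp add: Y_def)
  obtain Q where Q: "degree Q \<le> l + card Y"
    "\<And>v. v \<notin> Y \<Longrightarrow> (\<Prod>q\<in>Y. v - q) * hl_sum t ls (insert v Y) (\<lambda>u. u) = poly Q v"
    using hl_sum_numerator_poly[OF finY ls] by blast
  have PQ: "poly ((\<Prod>q\<in>Y. [:-q,1:]) * P) v = poly Q v" if v: "v \<notin> Y" for v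
  proof -
    define z where "z = (args x)(Inr (i, False) := v)"
    have zJ: "z p = args x p" if "p \<in> J" for p using that nin by (auto simp: z_def)
    have im: "z ` insert (Inr (i, False)) J = insert v Y"
      using zJ by (auto simp: z_def[symmetric] Y_def) (auto simp: z_def)
    have "inj_on z J" using inj zJ by (simp add: inj_on_def)
    moreover have "z (Inr (i, False)) \<notin> z ` J"
      using v zJ by (auto simp: Y_def z_def[symmetric]) (auto simp: z_def)
    ultimately have injz: "inj_on z (insert (Inr (i, False)) J)" using nin by simp
    have "hl_sum t ls (insert v Y) (\<lambda>u. u) = poly P v"
      using F[folded J_def, OF injz] hl_sum_image[OF injz, of t ls] im P[of v] by (simp add: z_def)
    then show ?thesis using Q(2)[OF v] by (simp add: poly_prod)
  qed
  have "(\<Prod>q\<in>Y. [:-q,1:]) * P = Q"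
  proof (rule ccontr)
    assume "(\<Prod>q\<in>Y. [:-q,1:]) * P \<noteq> Q"
    then have "finite {v. poly ((\<Prod>q\<in>Y. [:-q,1:]) * P - Q) v = 0}" by (intro poly_roots_finite) simp
    moreover have "- Y \<subseteq> {v. poly ((\<Prod>q\<in>Y. [:-q,1:]) * P - Q) v = 0}" using PQ by auto
    ultimately have "finite (- Y)" by (rule finite_subset[rotated])
    then show False using finY by (metis Compl_eq_Diff_UNIV finite_Diff2 infinite_UNIV_char_0)
  qed
  then have deg: "degree P \<le> l"
  proof (cases "P = 0")
    case False
    have ne: "(\<Prod>q\<in>Y. [:-q,1:]) \<noteq> (0 :: complex poly)" using finY by simp
    have "degree ((\<Prod>q\<in>Y. [:-q,1:]) :: complex poly) = card Y"
      by (subst degree_prod_eq_sum_degree) auto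
    then have "degree Q = card Y + degree P"
      using degree_mult_eq[OF ne False] \<open>_ = Q\<close> by simp
    then show ?thesis using Q(1) by simp
  qed simp
  show thesis
  proof (rule that[of "coeff P"])
    fix u :: complex assume u: "u \<noteq> 0"
    have "F (args (x(i := u))) = F ((args x)(Inr (i, False) := inverse u))"
    proof (rule Fcong)
      fix p assume p: "p \<in> insert (Inr (i, False)) (arg_index A I)"
      show "args (x(i := u)) p = ((args x)(Inr (i, False) := inverse u)) p"
      proof (cases p)
        case (Inr jb)
        then show ?thesis using p I by (cases jb) (auto simp: arg_index_def)
      qed simp
    qed
    also have "\<dots> = (\<Sum>k\<le>l. coeff P k * inverse u ^ k)"
      unfolding P poly_altdef
      by (rule sum.mono_neutral_left) (use deg in \<open>auto simp: coeff_eq_0\<close>)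
    finally have "u ^ l * F (args (x(i := u))) = (\<Sum>k\<le>l. coeff P k * (u ^ l * inverse u ^ k))"
      by (simp add: sum_distrib_left mult_ac)
    also have "\<dots> = (\<Sum>k\<le>l. coeff P k * u ^ (l - k))"
      using u by (intro sum.cong refl) (auto simp: power_diff divide_inverse power_inverse)
    finally show "u ^ l * F (args (x(i := u))) = (\<Sum>k\<le>l. coeff P k * u ^ (l - k))" .
  qed
qed

lemma pair_term_integral:
  assumes t: "norm t < 1" and x: "\<And>j. norm (x j) = 1" and A: "A \<subseteq> {1,-1}" and I: "finite I" "i \<notin> I"
    and gen: "generic I x" and ls: "\<And>k. k \<in> set ls \<Longrightarrow> k \<le> l"
    and Fpoly: "F \<in> mpoly_fun"
    and F: "\<And>z. inj_on z (insert (Inr (i, False)) (arg_index A I)) \<Longrightarrow>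
      hl_sum t ls (insert (Inr (i, False)) (arg_index A I)) z = F z"
    and Fcong: "\<And>z y. (\<And>p. p \<in> insert (Inr (i, False)) (arg_index A I) \<Longrightarrow> z p = y p) \<Longrightarrow> F z = F y"
  shows "(LINT s|unit_interval. kern (circ s) * residue_fun t \<alpha> A l i I F (x(i := circ s)) +
       kern (inverse (circ s)) * residue_fun t \<alpha> A l i I F (x(i := inverse (circ s))))
     = (\<Sum>e\<in>{1,-1}-A. residue_coeff t \<alpha> A l e * hl_integrand t \<alpha> (insert e A) ls I x) / 2"
proof -
  have finA: "finite A" using A by (rule finite_subset) simp
  \<comment> \<open>The denominators need \<open>norm t * r\<^sup>2 < 1\<close> on the disc of radius \<open>r > 1\<close>.\<close>
  define r where "r = sqrt (2 / (1 + norm t))"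
  have n0: "0 < 1 + norm t" by (smt (verit) norm_ge_zero)
  have r1: "r > 1" unfolding r_def using t n0 by (simp add: field_simps)
  have r2: "norm t * r\<^sup>2 < 1" unfolding r_def using t n0 by (simp add: field_simps)
  have tr: "norm t * r < 1"
  proof -
    have "norm t * r \<le> norm t * r\<^sup>2"
      using r1 by (intro mult_left_mono) (auto simp: power2_eq_square)
    then show ?thesis using r2 by linarith
  qed
  have nz1: "1 - t * c * u \<noteq> 0" if "norm c = 1" "u \<in> ball 0 r" for c u
  proof
    assume "1 - t * c * u = 0"
    then have "norm (t * c * u) = 1" by (metis eq_iff_diff_eq_0 norm_one)
    then have "norm t * norm u = 1" using that by (simp add: norm_mult)
    moreover have "norm t * norm u \<le> norm t * r" using that by (intro mult_left_mono) auto
    ultimately show False using tr by linarith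
  qed
  have nz2: "1 - t * u\<^sup>2 \<noteq> 0" if "u \<in> ball 0 r" for u
  proof
    assume "1 - t * u\<^sup>2 = 0"
    then have "norm (t * u\<^sup>2) = 1" by (metis eq_iff_diff_eq_0 norm_one)
    then have "norm t * (norm u)\<^sup>2 = 1" by (simp add: norm_mult norm_power)
    moreover have "norm t * (norm u)\<^sup>2 \<le> norm t * r\<^sup>2" using that by (intro mult_left_mono power_mono) auto
    ultimately show False using r2 by linarith
  qed
  obtain c where c: "\<And>u. u \<noteq> 0 \<Longrightarrow> u ^ l * F (args (x(i := u))) = (\<Sum>k\<le>l. c k * u ^ (l - k))"
    using residue_fun_numerator[OF x A I gen ls Fpoly F Fcong] by metis
  define C where "C = weight A t I x * (\<Prod>j\<in>I. pm1 \<alpha> (x j))"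
  define G where "G = (\<lambda>u. (\<Sum>k\<le>l. c k * u ^ (l - k)) * (\<Prod>e\<in>A. (1 - e * u) / (1 - t * e * u)) *
     (\<Prod>j\<in>I. (1 - x j * u) * (1 - inverse (x j) * u) / ((1 - t * x j * u) * (1 - t * inverse (x j) * u))) *
     ((1 - \<alpha> * u) * (u - \<alpha>) / (1 - t * u\<^sup>2)) * C)"
  have G: "G holomorphic_on ball 0 r"
    unfolding G_def
  proof (intro holomorphic_on_mult holomorphic_on_prod holomorphic_on_sum holomorphic_on_divide
      holomorphic_on_diff holomorphic_on_power holomorphic_on_const holomorphic_on_ident)
    show "1 - t * e * u \<noteq> 0" if "e \<in> A" "u \<in> ball 0 r" for e u
      using nz1[of e u] A that by auto
    show "(1 - t * x j * u) * (1 - t * inverse (x j) * u) \<noteq> 0" if "u \<in> ball 0 r" for j u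
      using nz1[of "x j" u] nz1[of "inverse (x j)" u] x that by (simp add: norm_inverse)
    show "1 - t * u\<^sup>2 \<noteq> 0" if "u \<in> ball 0 r" for u by (rule nz2[OF that])
  qed
  have GR: "residue_fun t \<alpha> A l i I F (x(i := u)) = G u / u" if u: "norm u = 1" for u
  proof -
    have u0: "u \<noteq> 0" using u by auto
    define y where "y = x(i := u)"
    have yi: "y i = u" and yj: "\<And>j. j \<in> I \<Longrightarrow> y j = x j" using I by (auto simp: y_def)
    have 1: "(\<Prod>j\<in>I. (1 - u * y j) * (1 - u / y j) / ((1 - t * u * y j) * (1 - t * u / y j)))
       = (\<Prod>j\<in>I. (1 - x j * u) * (1 - inverse (x j) * u) / ((1 - t * x j * u) * (1 - t * inverse (x j) * u)))"
      by (intro prod.cong refl) (simp add: yj divide_inverse mult_ac)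
    have 2: "(\<Prod>j\<in>I. pm1 \<alpha> (y j)) = (\<Prod>j\<in>I. pm1 \<alpha> (x j))" using yj by (intro prod.cong) auto
    have 3: "weight A t I y = weight A t I x" by (rule weight_cong[OF yj])
    have 4: "pm1 \<alpha> u = (1 - \<alpha> * u) * (u - \<alpha>) / u" using u0 by (simp add: pm1_def field_simps)
    show ?thesis
      unfolding y_def[symmetric] residue_fun_def yi 1 2 3 4
      unfolding y_def c[OF u0] G_def C_def by (simp add: mult_ac)
  qed
  have "(LINT s|unit_interval. kern (circ s) * residue_fun t \<alpha> A l i I F (x(i := circ s)) +
       kern (inverse (circ s)) * residue_fun t \<alpha> A l i I F (x(i := inverse (circ s))))
     = (residue_fun t \<alpha> A l i I F (x(i := 1)) + residue_fun t \<alpha> A l i I F (x(i := -1))) / 2"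
    by (rule circ_integral_kern[OF G r1 GR])
  also have "residue_fun t \<alpha> A l i I F (x(i := 1)) + residue_fun t \<alpha> A l i I F (x(i := -1))
     = (\<Sum>e\<in>{1,-1}. residue_fun t \<alpha> A l i I F (x(i := e)))" by simp
  also have "\<dots> = (\<Sum>e\<in>{1,-1}-A. residue_fun t \<alpha> A l i I F (x(i := e)))"
    by (rule sum.mono_neutral_right) (use residue_fun_zero[OF finA] in auto)
  also have "\<dots> = (\<Sum>e\<in>{1,-1}-A. residue_coeff t \<alpha> A l e * hl_integrand t \<alpha> (insert e A) ls I x)"
    by (intro sum.cong refl residue_fun_value[OF t x A I gen _ _ F]) auto
  finally show ?thesis .
qed

section \<open>Boundedness near the poles\<close>

text \<open>
  Bounded on the circle and Lipschitz under inversion, uniformly in the parameter \<open>\<theta>\<close>. Division by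
  \<open>u - 1/u\<close> keeps the difference of the values at \<open>u\<close> and \<open>1/u\<close> bounded, also near \<open>u = \<plusminus>1\<close>. The
  property is inherited by sums, products and reciprocals of functions bounded away from \<open>0\<close>, which
  are all that the density and the polynomials are built from.
\<close>

definition inv_lip :: "((nat \<Rightarrow> real) \<Rightarrow> complex \<Rightarrow> complex) \<Rightarrow> bool" where
  "inv_lip h \<longleftrightarrow> (\<exists>C. \<forall>\<theta> u. norm u = 1 \<longrightarrow>
     norm (h \<theta> u) \<le> C \<and> norm (h \<theta> u - h \<theta> (inverse u)) \<le> C * norm (u - inverse u))"

lemma inv_lipI:
  assumes "\<And>\<theta> u. norm u = 1 \<Longrightarrow> norm (h \<theta> u) \<le> C"
    and "\<And>\<theta> u. norm u = 1 \<Longrightarrow> norm (h \<theta> u - h \<theta> (inverse u)) \<le> D * norm (u - inverse u)"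
  shows "inv_lip h"
  unfolding inv_lip_def
proof (intro exI[of _ "max C D"] allI impI conjI)
  fix \<theta> and u :: complex assume u: "norm u = 1"
  show "norm (h \<theta> u) \<le> max C D" using assms(1)[OF u, of \<theta>] by simp
  have "D * norm (u - inverse u) \<le> max C D * norm (u - inverse u)"
    by (intro mult_right_mono) auto
  then show "norm (h \<theta> u - h \<theta> (inverse u)) \<le> max C D * norm (u - inverse u)"
    using assms(2)[OF u, of \<theta>] by linarith
qed

lemma inv_lipE:
  assumes "inv_lip h"
  obtains C where "0 \<le> C" "\<And>\<theta> u. norm u = 1 \<Longrightarrow> norm (h \<theta> u) \<le> C"
    "\<And>\<theta> u. norm u = 1 \<Longrightarrow> norm (h \<theta> u - h \<theta> (inverse u)) \<le> C * norm (u - inverse u)"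
proof -
  obtain C where C: "\<forall>\<theta> u. norm u = 1 \<longrightarrow>
     norm (h \<theta> u) \<le> C \<and> norm (h \<theta> u - h \<theta> (inverse u)) \<le> C * norm (u - inverse u)"
    using assms unfolding inv_lip_def by blast
  have "norm (h undefined 1) \<le> C" using C by simp
  then have "0 \<le> C" using norm_ge_zero order_trans by blast
  then show thesis using C that by blast
qed

lemma inv_lip_const: "inv_lip (\<lambda>\<theta> u. c)"
  by (rule inv_lipI[of _ "norm c" 0]) auto

lemma inv_lip_coord: "inv_lip (\<lambda>\<theta> u. ((torus_point \<theta>)(i := u)) j)"
  by (rule inv_lipI[of _ 1 1]) auto

lemma norm_coord: "norm u = 1 \<Longrightarrow> norm (((torus_point \<theta>)(i := u)) j) = 1"
  by simp

lemma inv_lip_add: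
  assumes "inv_lip f" "inv_lip g"
  shows "inv_lip (\<lambda>\<theta> u. f \<theta> u + g \<theta> u)"
proof -
  obtain C where C: "\<And>\<theta> u. norm u = 1 \<Longrightarrow> norm (f \<theta> u) \<le> C"
    "\<And>\<theta> u. norm u = 1 \<Longrightarrow> norm (f \<theta> u - f \<theta> (inverse u)) \<le> C * norm (u - inverse u)"
    using assms(1) by (rule inv_lipE) blast
  obtain D where D: "\<And>\<theta> u. norm u = 1 \<Longrightarrow> norm (g \<theta> u) \<le> D"
    "\<And>\<theta> u. norm u = 1 \<Longrightarrow> norm (g \<theta> u - g \<theta> (inverse u)) \<le> D * norm (u - inverse u)"
    using assms(2) by (rule inv_lipE) blast
  show ?thesis
  proof (rule inv_lipI[of _ "C + D" "C + D"])
    fix \<theta> and u :: complex assume u: "norm u = 1"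
    show "norm (f \<theta> u + g \<theta> u) \<le> C + D"
      using C(1)[OF u, of \<theta>] D(1)[OF u, of \<theta>] norm_triangle_ineq[of "f \<theta> u" "g \<theta> u"] by linarith
    have "norm (f \<theta> u + g \<theta> u - (f \<theta> (inverse u) + g \<theta> (inverse u)))
       \<le> norm (f \<theta> u - f \<theta> (inverse u)) + norm (g \<theta> u - g \<theta> (inverse u))"
      using norm_triangle_ineq[of "f \<theta> u - f \<theta> (inverse u)" "g \<theta> u - g \<theta> (inverse u)"]
      by (simp add: algebra_simps)
    then show "norm (f \<theta> u + g \<theta> u - (f \<theta> (inverse u) + g \<theta> (inverse u))) \<le> (C + D) * norm (u - inverse u)"
      using C(2)[OF u, of \<theta>] D(2)[OF u, of \<theta>] by (simp add: distrib_right)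
  qed
qed

lemma inv_lip_mult:
  assumes "inv_lip f" "inv_lip g"
  shows "inv_lip (\<lambda>\<theta> u. f \<theta> u * g \<theta> u)"
proof -
  obtain C where C: "0 \<le> C" "\<And>\<theta> u. norm u = 1 \<Longrightarrow> norm (f \<theta> u) \<le> C"
    "\<And>\<theta> u. norm u = 1 \<Longrightarrow> norm (f \<theta> u - f \<theta> (inverse u)) \<le> C * norm (u - inverse u)"
    using assms(1) by (rule inv_lipE) blast
  obtain D where D: "0 \<le> D" "\<And>\<theta> u. norm u = 1 \<Longrightarrow> norm (g \<theta> u) \<le> D"
    "\<And>\<theta> u. norm u = 1 \<Longrightarrow> norm (g \<theta> u - g \<theta> (inverse u)) \<le> D * norm (u - inverse u)"
    using assms(2) by (rule inv_lipE) blast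
  show ?thesis
  proof (rule inv_lipI[of _ "C * D" "2 * C * D"])
    fix \<theta> and u :: complex assume u: "norm u = 1"
    have u': "norm (inverse u) = 1" using u by (simp add: norm_inverse)
    show "norm (f \<theta> u * g \<theta> u) \<le> C * D"
      unfolding norm_mult using C(1,2) D(2) u by (intro mult_mono) auto
    have "f \<theta> u * g \<theta> u - f \<theta> (inverse u) * g \<theta> (inverse u)
       = f \<theta> u * (g \<theta> u - g \<theta> (inverse u)) + (f \<theta> u - f \<theta> (inverse u)) * g \<theta> (inverse u)"
      by (simp add: algebra_simps)
    then have "norm (f \<theta> u * g \<theta> u - f \<theta> (inverse u) * g \<theta> (inverse u))
       \<le> norm (f \<theta> u) * norm (g \<theta> u - g \<theta> (inverse u)) + norm (f \<theta> u - f \<theta> (inverse u)) * norm (g \<theta> (inverse u))"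
      by (metis norm_mult norm_triangle_ineq)
    also have "\<dots> \<le> C * (D * norm (u - inverse u)) + (C * norm (u - inverse u)) * D"
      using C D u u' by (intro add_mono mult_mono) auto
    finally show "norm (f \<theta> u * g \<theta> u - f \<theta> (inverse u) * g \<theta> (inverse u)) \<le> 2 * C * D * norm (u - inverse u)"
      by (simp add: algebra_simps)
  qed
qed

lemma inv_lip_inverse:
  assumes "inv_lip f" "0 < \<delta>" "\<And>\<theta> u. norm u = 1 \<Longrightarrow> \<delta> \<le> norm (f \<theta> u)"
  shows "inv_lip (\<lambda>\<theta> u. inverse (f \<theta> u))"
proof -
  obtain C where C: "0 \<le> C" "\<And>\<theta> u. norm u = 1 \<Longrightarrow> norm (f \<theta> u - f \<theta> (inverse u)) \<le> C * norm (u - inverse u)"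
    using assms(1) by (rule inv_lipE) blast
  show ?thesis
  proof (rule inv_lipI[of _ "inverse \<delta>" "inverse \<delta> * C * inverse \<delta>"])
    fix \<theta> and u :: complex assume u: "norm u = 1"
    have u': "norm (inverse u) = 1" using u by (simp add: norm_inverse)
    have b: "norm (inverse (f \<theta> v)) \<le> inverse \<delta>" if "norm v = 1" for v
      unfolding norm_inverse using assms(2) assms(3)[OF that] by (intro le_imp_inverse_le)
    show "norm (inverse (f \<theta> u)) \<le> inverse \<delta>" by (rule b[OF u])
    have "f \<theta> u \<noteq> 0" "f \<theta> (inverse u) \<noteq> 0"
      using assms(2) assms(3)[OF u, of \<theta>] assms(3)[OF u', of \<theta>] by auto
    then have "inverse (f \<theta> u) - inverse (f \<theta> (inverse u))
        = - (inverse (f \<theta> u) * (f \<theta> u - f \<theta> (inverse u)) * inverse (f \<theta> (inverse u)))"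
      by (rule inverse_diff_inverse)
    then have "norm (inverse (f \<theta> u) - inverse (f \<theta> (inverse u)))
        = norm (inverse (f \<theta> u)) * norm (f \<theta> u - f \<theta> (inverse u)) * norm (inverse (f \<theta> (inverse u)))"
      by (simp only: norm_minus_cancel norm_mult)
    also have "\<dots> \<le> inverse \<delta> * (C * norm (u - inverse u)) * inverse \<delta>"
      using b[OF u] b[OF u'] C(2)[OF u, of \<theta>] assms(2) C(1) by (intro mult_mono) auto
    finally show "norm (inverse (f \<theta> u) - inverse (f \<theta> (inverse u))) \<le> inverse \<delta> * C * inverse \<delta> * norm (u - inverse u)"
      by (simp add: algebra_simps)
  qed
qed

lemma inv_lip_diff:
  assumes "inv_lip f" "inv_lip g"
  shows "inv_lip (\<lambda>\<theta> u. f \<theta> u - g \<theta> u)"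
  using inv_lip_add[OF assms(1) inv_lip_mult[OF inv_lip_const[of "-1"] assms(2)]] by simp

lemma inv_lip_prod: "(\<And>j. j \<in> S \<Longrightarrow> inv_lip (f j)) \<Longrightarrow> inv_lip (\<lambda>\<theta> u. \<Prod>j\<in>S. f j \<theta> u)"
  by (induction S rule: infinite_finite_induct) (simp_all add: inv_lip_const inv_lip_mult)

lemma inv_lip_power: "inv_lip f \<Longrightarrow> inv_lip (\<lambda>\<theta> u. f \<theta> u ^ n)"
  by (induction n) (simp_all add: inv_lip_const inv_lip_mult)

lemma inv_lip_mpoly_fun:
  assumes "f \<in> mpoly_fun" "\<And>p. inv_lip (\<lambda>\<theta> u. z \<theta> u p)"
  shows "inv_lip (\<lambda>\<theta> u. f (z \<theta> u))"
  using assms by (induction rule: mpoly_fun.induct) (simp_all add: inv_lip_const inv_lip_mult inv_lip_add)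

text \<open>
  Unimodularity bounds \<open>1 - t c\<close> away from \<open>0\<close>, so that the reciprocals in the density stay in the
  class.
\<close>

definition inv_lip_unit :: "((nat \<Rightarrow> real) \<Rightarrow> complex \<Rightarrow> complex) \<Rightarrow> bool" where
  "inv_lip_unit c \<longleftrightarrow> inv_lip c \<and> (\<forall>\<theta> u. norm u = 1 \<longrightarrow> norm (c \<theta> u) = 1)"

lemma inv_lip_unit_const: "norm c = 1 \<Longrightarrow> inv_lip_unit (\<lambda>\<theta> u. c)"
  by (simp add: inv_lip_unit_def inv_lip_const)

lemma inv_lip_unit_coord: "inv_lip_unit (\<lambda>\<theta> u. ((torus_point \<theta>)(i := u)) j)"
  unfolding inv_lip_unit_def by (intro conjI inv_lip_coord allI impI norm_coord)

lemma inv_lip_unit_mult: "inv_lip_unit f \<Longrightarrow> inv_lip_unit g \<Longrightarrow> inv_lip_unit (\<lambda>\<theta> u. f \<theta> u * g \<theta> u)"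
  by (simp add: inv_lip_unit_def inv_lip_mult norm_mult)

lemma inv_lip_unit_inverse: "inv_lip_unit f \<Longrightarrow> inv_lip_unit (\<lambda>\<theta> u. inverse (f \<theta> u))"
  unfolding inv_lip_unit_def by (auto simp: norm_inverse intro: inv_lip_inverse[of f 1])

lemma inv_lip_unit_imp: "inv_lip_unit f \<Longrightarrow> inv_lip f"
  by (simp add: inv_lip_unit_def)

lemmas inv_lip_unit_intros =
  inv_lip_unit_mult inv_lip_unit_inverse inv_lip_unit_const inv_lip_unit_coord

lemma inv_lip_inverse_linear:
  assumes "norm t < 1" "inv_lip_unit c"
  shows "inv_lip (\<lambda>\<theta> u. inverse (1 - t * c \<theta> u))"
proof (rule inv_lip_inverse[of _ "1 - norm t"])
  show "inv_lip (\<lambda>\<theta> u. 1 - t * c \<theta> u)"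
    using assms(2) by (intro inv_lip_diff inv_lip_mult inv_lip_const inv_lip_unit_imp)
  show "1 - norm t \<le> norm (1 - t * c \<theta> u)" if "norm u = 1" for \<theta> u
    using norm_triangle_ineq2[of 1 "t * c \<theta> u"] assms(2) that by (simp add: inv_lip_unit_def norm_mult)
qed (use assms in simp)

lemma inv_lip_pm1: "inv_lip_unit c \<Longrightarrow> inv_lip (\<lambda>\<theta> u. pm1 a (c \<theta> u))"
  unfolding pm1_def
  by (intro inv_lip_mult inv_lip_diff inv_lip_const inv_lip_unit_imp inv_lip_unit_inverse)

lemma inv_lip_inverse_pm1:
  assumes "norm t < 1" "norm e = 1" "inv_lip_unit c"
  shows "inv_lip (\<lambda>\<theta> u. inverse (pm1 (t * e) (c \<theta> u)))"
proof -
  have "(\<lambda>\<theta> u. inverse (pm1 (t * e) (c \<theta> u)))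
     = (\<lambda>\<theta> u. inverse (1 - t * (e * c \<theta> u)) * inverse (1 - t * (e * inverse (c \<theta> u))))"
    by (simp add: pm1_def mult.assoc)
  then show ?thesis
    using assms by (simp only:) (intro inv_lip_mult inv_lip_inverse_linear inv_lip_unit_intros)
qed

lemma inv_lip_pair_weight:
  assumes "norm t < 1" "inv_lip_unit c" "inv_lip_unit d"
  shows "inv_lip (\<lambda>\<theta> u. pair_weight t (c \<theta> u) (d \<theta> u))"
proof -
  have "(\<lambda>\<theta> u. pair_weight t (c \<theta> u) (d \<theta> u)) = (\<lambda>\<theta> u. pm2 1 (c \<theta> u) (d \<theta> u) *
      (inverse (1 - t * (c \<theta> u * d \<theta> u)) * inverse (1 - t * (c \<theta> u * inverse (d \<theta> u))) *
       inverse (1 - t * (inverse (c \<theta> u) * d \<theta> u)) * inverse (1 - t * (inverse (c \<theta> u) * inverse (d \<theta> u)))))"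
    unfolding pair_weight_def divide_inverse
    by (simp add: pm2_def mult.assoc)
  then show ?thesis
    using assms unfolding pm2_def
    by (simp only:) (intro inv_lip_mult inv_lip_diff inv_lip_const inv_lip_inverse_linear
        inv_lip_unit_mult inv_lip_unit_inverse inv_lip_unit_imp)
qed

lemma inv_lip_single_weight:
  assumes "norm t < 1" "A \<subseteq> {1,-1}" "inv_lip_unit c"
  shows "inv_lip (\<lambda>\<theta> u. single_weight A t (c \<theta> u))"
proof -
  have "inv_lip (\<lambda>\<theta> u. (\<Prod>e\<in>A. pm1 e (c \<theta> u) * inverse (pm1 (t * e) (c \<theta> u))) *
      inverse (pm1 (t * 1) (c \<theta> u * c \<theta> u)))"
    using assms by (intro inv_lip_mult inv_lip_prod inv_lip_pm1 inv_lip_inverse_pm1 inv_lip_unit_mult) auto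
  then show ?thesis by (simp add: single_weight_def divide_inverse power2_eq_square)
qed

lemma inv_lip_weight:
  assumes "norm t < 1" "A \<subseteq> {1,-1}" "\<And>j. inv_lip_unit (\<lambda>\<theta> u. z \<theta> u j)"
  shows "inv_lip (\<lambda>\<theta> u. weight A t I (z \<theta> u))"
  unfolding weight_def
  using assms by (intro inv_lip_mult inv_lip_prod inv_lip_single_weight inv_lip_pair_weight)

lemma inv_lip_residue_fun:
  assumes t: "norm t < 1" and A: "A \<subseteq> {1,-1}" and F: "F \<in> mpoly_fun"
  shows "inv_lip (\<lambda>\<theta> u. residue_fun t \<alpha> A l i I F ((torus_point \<theta>)(i := u)))"
proof -
  define z where "z = (\<lambda>\<theta> u. (torus_point \<theta>)(i := u))"
  have z: "inv_lip_unit (\<lambda>\<theta> u. z \<theta> u j)" for j unfolding z_def by (rule inv_lip_unit_coord)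
  have args: "inv_lip (\<lambda>\<theta> u. args (z \<theta> u) q)" for q
  proof (cases q)
    case (Inr jb)
    obtain j b where jb: "jb = (j, b)" by (cases jb)
    show ?thesis
    proof (cases b)
      case True
      then show ?thesis using inv_lip_unit_imp[OF z, of j] by (simp add: Inr jb)
    next
      case False
      then show ?thesis using inv_lip_unit_imp[OF inv_lip_unit_inverse[OF z, of j]] by (simp add: Inr jb)
    qed
  qed (simp add: inv_lip_const)
  have nA: "norm e = 1" if "e \<in> A" for e using that A by auto
  have "inv_lip (\<lambda>\<theta> u. z \<theta> u i ^ l * F (args (z \<theta> u)) *
     (\<Prod>e\<in>A. (1 - e * z \<theta> u i) * inverse (1 - t * (e * z \<theta> u i))) *
     (\<Prod>j\<in>I. (1 - z \<theta> u i * z \<theta> u j) * (1 - z \<theta> u i * inverse (z \<theta> u j)) *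
        (inverse (1 - t * (z \<theta> u i * z \<theta> u j)) * inverse (1 - t * (z \<theta> u i * inverse (z \<theta> u j))))) *
     (pm1 \<alpha> (z \<theta> u i) * inverse (1 - t * (z \<theta> u i * z \<theta> u i))) *
     (weight A t I (z \<theta> u) * (\<Prod>j\<in>I. pm1 \<alpha> (z \<theta> u j))))"
    by (intro inv_lip_mult inv_lip_prod inv_lip_diff inv_lip_const inv_lip_power inv_lip_pm1
        inv_lip_weight[OF t A z] inv_lip_mpoly_fun[OF F args] inv_lip_inverse_linear[OF t] inv_lip_unit_mult
        inv_lip_unit_inverse inv_lip_unit_const nA inv_lip_unit_imp[OF z]
        inv_lip_unit_imp[OF inv_lip_unit_inverse[OF z]] z)
  then show ?thesis
    unfolding residue_fun_def z_def by (simp add: divide_inverse mult.assoc power2_eq_square)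
qed

definition bracket ::
  "complex \<Rightarrow> complex \<Rightarrow> complex set \<Rightarrow> nat \<Rightarrow> nat \<Rightarrow> nat set \<Rightarrow>
   ((complex + nat \<times> bool \<Rightarrow> complex) \<Rightarrow> complex) \<Rightarrow> (nat \<Rightarrow> complex) \<Rightarrow> complex" where
  "bracket t \<alpha> A l i I F x = kern (x i) * residue_fun t \<alpha> A l i I F x +
     kern (inverse (x i)) * residue_fun t \<alpha> A l i I F (x(i := inverse (x i)))"

lemma bracket_bounded:
  assumes t: "norm t < 1" and A: "A \<subseteq> {1,-1}" and F: "F \<in> mpoly_fun"
  obtains C where "\<And>\<theta>. norm (bracket t \<alpha> A l i I F (torus_point \<theta>)) \<le> C"
proof -
  \<comment> \<open>The factor \<open>u\<close> is the numerator of \<open>kern u\<close>; where \<open>u = 1/u\<close>, both kernels are \<open>0\<close>.\<close>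
  define h where "h = (\<lambda>\<theta> u. u * residue_fun t \<alpha> A l i I F ((torus_point \<theta>)(i := u)))"
  have "inv_lip (\<lambda>\<theta> u. u)" using inv_lip_coord[of i i] by simp
  then have "inv_lip h"
    unfolding h_def by (intro inv_lip_mult inv_lip_residue_fun assms)
  then obtain C where C: "0 \<le> C"
    "\<And>\<theta> u. norm u = 1 \<Longrightarrow> norm (h \<theta> u - h \<theta> (inverse u)) \<le> C * norm (u - inverse u)"
    by (rule inv_lipE) blast
  have "norm (bracket t \<alpha> A l i I F (torus_point \<theta>)) \<le> C" for \<theta>
  proof -
    define u where "u = torus_point \<theta> i"
    have u: "norm u = 1" by (simp add: u_def)
    have "(torus_point \<theta>)(i := u) = torus_point \<theta>" by (simp add: u_def)
    then have b: "bracket t \<alpha> A l i I F (torus_point \<theta>) = (h \<theta> u - h \<theta> (inverse u)) / (u - inverse u)"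
      unfolding bracket_def u_def[symmetric] h_def kern_def
      by (simp add: diff_divide_distrib minus_divide_right[symmetric])
        (metis minus_diff_eq minus_divide_right)
    show ?thesis
    proof (cases "u - inverse u = 0")
      case True
      then show ?thesis unfolding b using C(1) by simp
    next
      case False
      then show ?thesis unfolding b norm_divide using C(2)[OF u, of \<theta>] by (simp add: field_simps)
    qed
  qed
  then show thesis by (rule that)
qed

lemma weight_measurable:
  assumes [measurable]: "\<And>j. (\<lambda>w. x w j) \<in> borel_measurable M"
  shows "(\<lambda>w. weight A t I (x w)) \<in> borel_measurable M"
  unfolding weight_def single_weight_def pair_weight_def pm1_def pm2_def by measurable

lemma args_measurable:
  assumes [measurable]: "\<And>j. (\<lambda>w. x w j) \<in> borel_measurable M"
  shows "(\<lambda>w. args (x w) q) \<in> borel_measurable M"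
proof (cases q)
  case (Inr jb)
  then show ?thesis by (cases jb) simp
qed simp

lemma hl_integrand_measurable:
  assumes x[measurable]: "\<And>j. (\<lambda>w. x w j) \<in> borel_measurable M"
  shows "(\<lambda>w. hl_integrand t \<alpha> A lam I (x w)) \<in> borel_measurable M"
proof -
  note [measurable] = weight_measurable[OF x] hl_sum_measurable[OF args_measurable[OF x]]
  show ?thesis unfolding hl_integrand_def pm1_def by measurable
qed

lemma residue_fun_measurable:
  assumes x[measurable]: "\<And>j. (\<lambda>w. x w j) \<in> borel_measurable M" and F: "F \<in> mpoly_fun"
  shows "(\<lambda>w. residue_fun t \<alpha> A l i I F (x w)) \<in> borel_measurable M"
proof -
  note [measurable] = weight_measurable[OF x] mpoly_fun_measurable[OF F args_measurable[OF x]]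
  show ?thesis unfolding residue_fun_def pm1_def by measurable
qed

lemma bracket_measurable:
  assumes F: "F \<in> mpoly_fun"
  shows "(\<lambda>\<theta>. bracket t \<alpha> A l i I F (torus_point \<theta>)) \<in> borel_measurable (torus K)"
proof -
  have upd: "(\<lambda>\<theta>. ((torus_point \<theta>)(i := inverse (torus_point \<theta> i))) j) \<in> borel_measurable (torus K)" for j
    by (cases "j = i") simp_all
  note [measurable] = residue_fun_measurable[OF torus_point_measurable F] residue_fun_measurable[OF upd F]
  show ?thesis unfolding bracket_def kern_def by measurable
qed

section \<open>The recursion for the integrals\<close>

definition hl_integral ::
  "complex \<Rightarrow> complex \<Rightarrow> complex set \<Rightarrow> nat list \<Rightarrow> nat set \<Rightarrow> complex" where
  "hl_integral t \<alpha> A lam I = (LINT \<theta>|torus I. hl_integrand t \<alpha> A lam I (torus_point \<theta>))"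

definition hl_integrable ::
  "complex \<Rightarrow> complex \<Rightarrow> complex set \<Rightarrow> nat list \<Rightarrow> nat set \<Rightarrow> bool" where
  "hl_integrable t \<alpha> A lam I \<longleftrightarrow> integrable (torus I) (\<lambda>\<theta>. hl_integrand t \<alpha> A lam I (torus_point \<theta>))"

text \<open>
  Boundedness allows the integral over \<open>x\<^sub>i\<close> to be carried out first; for almost all values of the
  other variables it is given by the values of \<open>residue_fun\<close> at \<open>\<plusminus>1\<close>.
\<close>

lemma bracket_integral:
  assumes t: "norm t < 1" and A: "A \<subseteq> {1,-1}" and I: "finite I" "i \<notin> I"
    and ls: "\<And>k. k \<in> set ls \<Longrightarrow> k \<le> l"
    and Fpoly: "F \<in> mpoly_fun"
    and F: "\<And>z. inj_on z (insert (Inr (i, False)) (arg_index A I)) \<Longrightarrow>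
      hl_sum t ls (insert (Inr (i, False)) (arg_index A I)) z = F z"
    and Fcong: "\<And>z y. (\<And>p. p \<in> insert (Inr (i, False)) (arg_index A I) \<Longrightarrow> z p = y p) \<Longrightarrow> F z = F y"
    and IH: "\<And>e. e \<in> {1,-1} - A \<Longrightarrow> hl_integrable t \<alpha> (insert e A) ls I"
  shows "integrable (torus (insert i I)) (\<lambda>\<theta>. bracket t \<alpha> A l i I F (torus_point \<theta>))"
    and "(LINT \<theta>|torus (insert i I). bracket t \<alpha> A l i I F (torus_point \<theta>)) =
      (\<Sum>e\<in>{1,-1}-A. residue_coeff t \<alpha> A l e * hl_integral t \<alpha> (insert e A) ls I) / 2"
proof -
  define B where "B = (\<lambda>\<theta>. bracket t \<alpha> A l i I F (torus_point \<theta>))"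
  have meas: "B \<in> borel_measurable (torus (insert i I))"
    unfolding B_def by (rule bracket_measurable[OF Fpoly])
  obtain C where C: "\<And>\<theta>. norm (B \<theta>) \<le> C"
    unfolding B_def using bracket_bounded[OF t A Fpoly] by metis
  have "finite_measure (torus (insert i I))" using I by (intro finite_measure_torus) simp
  then have int: "integrable (torus (insert i I)) B"
    by (rule finite_measure.integrable_const_bound[where B = C]) (use C meas in auto)
  then show "integrable (torus (insert i I)) (\<lambda>\<theta>. bracket t \<alpha> A l i I F (torus_point \<theta>))"
    by (simp add: B_def)
  have Bupd: "B (\<theta>(i := s)) = kern (circ s) * residue_fun t \<alpha> A l i I F ((torus_point \<theta>)(i := circ s)) +
       kern (inverse (circ s)) * residue_fun t \<alpha> A l i I F ((torus_point \<theta>)(i := inverse (circ s)))" for \<theta> s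
    by (simp add: B_def bracket_def torus_point_fun_upd)
  define R where "R = (\<lambda>\<theta>. (\<Sum>e\<in>{1,-1}-A. residue_coeff t \<alpha> A l e * hl_integrand t \<alpha> (insert e A) ls I (torus_point \<theta>)) / 2)"
  have "(LINT \<theta>|torus (insert i I). B \<theta>) = (LINT \<theta>|torus I. (LINT s|unit_interval. B (\<theta>(i := s))))"
    by (rule unit_intervals.product_integral_insert[OF I int])
  also have "\<dots> = (LINT \<theta>|torus I. R \<theta>)"
  proof (rule integral_cong_AE)
    have "(\<lambda>(\<theta>, s). \<theta>(i := s)) \<in> measurable (torus I \<Otimes>\<^sub>M unit_interval) (torus (insert i I))"
      by (rule measurable_add_dim)
    then have "(\<lambda>p. B (case p of (\<theta>, s) \<Rightarrow> \<theta>(i := s))) \<in> borel_measurable (torus I \<Otimes>\<^sub>M unit_interval)"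
      by (rule measurable_compose[OF _ meas])
    then have "(\<lambda>(\<theta>, s). B (\<theta>(i := s))) \<in> borel_measurable (torus I \<Otimes>\<^sub>M unit_interval)"
      by (simp add: case_prod_beta)
    then show "(\<lambda>\<theta>. LINT s|unit_interval. B (\<theta>(i := s))) \<in> borel_measurable (torus I)"
      by (rule sigma_finite_measure.borel_measurable_lebesgue_integral[OF sigma_finite_unit_interval])
    note [measurable] = hl_integrand_measurable[OF torus_point_measurable]
    show "R \<in> borel_measurable (torus I)" unfolding R_def by measurable
    show "AE \<theta> in torus I. (LINT s|unit_interval. B (\<theta>(i := s))) = R \<theta>"
      using AE_generic[OF I(1)]
    proof eventually_elim
      case (elim \<theta>)
      show ?case unfolding Bupd R_def
        by (rule pair_term_integral[OF t norm_torus_point A I elim ls Fpoly F Fcong])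
    qed
  qed
  also have "\<dots> = (\<Sum>e\<in>{1,-1}-A. residue_coeff t \<alpha> A l e * hl_integral t \<alpha> (insert e A) ls I) / 2"
    unfolding R_def hl_integral_def
    using IH by (simp add: hl_integrable_def)
  finally show "(LINT \<theta>|torus (insert i I). bracket t \<alpha> A l i I F (torus_point \<theta>)) =
      (\<Sum>e\<in>{1,-1}-A. residue_coeff t \<alpha> A l e * hl_integral t \<alpha> (insert e A) ls I) / 2"
    by (simp add: B_def)
qed

lemma hl_integral_Cons:
  assumes t: "norm t < 1" and A: "A \<subseteq> {1,-1}" and I: "finite I"
    and ls: "\<And>k. k \<in> set ls \<Longrightarrow> k \<le> l"
    and IH1: "\<And>e. e \<in> A \<Longrightarrow> hl_integrable t \<alpha> (A - {e}) ls I"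
    and IH2: "\<And>i e. i \<in> I \<Longrightarrow> e \<in> {1,-1} - A \<Longrightarrow> hl_integrable t \<alpha> (insert e A) ls (I - {i})"
  shows "hl_integrable t \<alpha> A (l # ls) I"
    and "hl_integral t \<alpha> A (l # ls) I =
      (\<Sum>e\<in>A. e ^ l * (\<Prod>e'\<in>A-{e}. (e - t * e') / (e - e')) * hl_integral t \<alpha> (A - {e}) ls I) +
      (\<Sum>i\<in>I. (\<Sum>e\<in>{1,-1}-A. residue_coeff t \<alpha> A l e * hl_integral t \<alpha> (insert e A) ls (I - {i})) / 2)"
proof -
  have finA: "finite A" using A by (rule finite_subset) simp
  have "\<exists>F. F \<in> mpoly_fun \<and>
      (\<forall>z. inj_on z (insert (Inr (i, False)) (arg_index A (I - {i}))) \<longrightarrow>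
        hl_sum t ls (insert (Inr (i, False)) (arg_index A (I - {i}))) z = F z) \<and>
      (\<forall>z y. (\<forall>p \<in> insert (Inr (i, False)) (arg_index A (I - {i})). z p = y p) \<longrightarrow> F z = F y)" for i
  proof -
    have fin: "finite (insert (Inr (i, False)) (arg_index A (I - {i})))" using finA I by simp
    obtain F where "F \<in> mpoly_fun"
      "\<And>z. inj_on z (insert (Inr (i, False)) (arg_index A (I - {i}))) \<Longrightarrow>
        hl_sum t ls (insert (Inr (i, False)) (arg_index A (I - {i}))) z = F z"
      "\<And>z y. (\<And>p. p \<in> insert (Inr (i, False)) (arg_index A (I - {i})) \<Longrightarrow> z p = y p) \<Longrightarrow> F z = F y"
      using hl_sum_mpoly_fun[OF fin, of t ls] by metis
    then show ?thesis by blast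
  qed
  then obtain F where F: "\<And>i. F i \<in> mpoly_fun"
    "\<And>i z. inj_on z (insert (Inr (i, False)) (arg_index A (I - {i}))) \<Longrightarrow>
      hl_sum t ls (insert (Inr (i, False)) (arg_index A (I - {i}))) z = F i z"
    "\<And>i z y. (\<And>p. p \<in> insert (Inr (i, False)) (arg_index A (I - {i})) \<Longrightarrow> z p = y p) \<Longrightarrow> F i z = F i y"
    by metis
  define B where "B = (\<lambda>i \<theta>. bracket t \<alpha> A l i (I - {i}) (F i) (torus_point \<theta>))"
  define c where "c = (\<lambda>e. e ^ l * (\<Prod>e'\<in>A-{e}. (e - t * e') / (e - e')))"
  have B: "integrable (torus I) (B i)"
    "(LINT \<theta>|torus I. B i \<theta>) =
      (\<Sum>e\<in>{1,-1}-A. residue_coeff t \<alpha> A l e * hl_integral t \<alpha> (insert e A) ls (I - {i})) / 2"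
    if i: "i \<in> I" for i
  proof -
    have ins: "insert i (I - {i}) = I" using i by auto
    have fin: "finite (I - {i})" "i \<notin> I - {i}" using I by auto
    note * = bracket_integral[OF t A fin ls F(1)[of i] F(2)[of _ i] F(3)[of i] IH2[OF i], unfolded ins]
    show "integrable (torus I) (B i)" unfolding B_def by (rule *(1))
    show "(LINT \<theta>|torus I. B i \<theta>) =
      (\<Sum>e\<in>{1,-1}-A. residue_coeff t \<alpha> A l e * hl_integral t \<alpha> (insert e A) ls (I - {i})) / 2"
      unfolding B_def by (rule *(2))
  qed
  define R where "R = (\<lambda>\<theta>. (\<Sum>e\<in>A. c e * hl_integrand t \<alpha> (A - {e}) ls I (torus_point \<theta>)) + (\<Sum>i\<in>I. B i \<theta>))"
  have R: "integrable (torus I) R"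
    unfolding R_def using B(1) IH1 by (auto simp: hl_integrable_def)
  have AE: "AE \<theta> in torus I. hl_integrand t \<alpha> A (l # ls) I (torus_point \<theta>) = R \<theta>"
    using AE_generic[OF I]
  proof eventually_elim
    case (elim \<theta>)
    have "pair_term t \<alpha> A l ls i (I - {i}) (torus_point \<theta>) + pair_term t \<alpha> A l ls i (I - {i}) ((torus_point \<theta>)(i := inverse (torus_point \<theta> i)))
        = B i \<theta>" if i: "i \<in> I" for i
    proof -
      have ins: "insert i (I - {i}) = I" using i by auto
      have fin: "finite (I - {i})" "i \<notin> I - {i}" using I by auto
      have norm: "norm (((torus_point \<theta>)(i := inverse (torus_point \<theta> i))) j) = 1" for j by (simp add: norm_inverse)
      have "pair_term t \<alpha> A l ls i (I - {i}) (torus_point \<theta>) = kern (torus_point \<theta> i) * residue_fun t \<alpha> A l i (I - {i}) (F i) (torus_point \<theta>)"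
        by (rule pair_term_eq[OF t norm_torus_point A fin _ F(2)]) (use elim ins in simp_all)
      moreover have "pair_term t \<alpha> A l ls i (I - {i}) ((torus_point \<theta>)(i := inverse (torus_point \<theta> i)))
         = kern (((torus_point \<theta>)(i := inverse (torus_point \<theta> i))) i) * residue_fun t \<alpha> A l i (I - {i}) (F i) ((torus_point \<theta>)(i := inverse (torus_point \<theta> i)))"
        by (rule pair_term_eq[OF t norm A fin _ F(2)], unfold ins, rule generic_upd_inverse[OF elim])
      ultimately show ?thesis by (simp add: B_def bracket_def)
    qed
    then show ?case
      unfolding hl_integrand_expand[OF t norm_torus_point A I elim] R_def c_def
      by (intro arg_cong2[of _ _ _ _ "(+)"] sum.cong refl)
  qed
  have meas: "(\<lambda>\<theta>. hl_integrand t \<alpha> A (l # ls) I (torus_point \<theta>)) \<in> borel_measurable (torus I)"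
    by (rule hl_integrand_measurable[OF torus_point_measurable])
  show "hl_integrable t \<alpha> A (l # ls) I"
    unfolding hl_integrable_def
    by (rule integrable_cong_AE_imp[OF R meas]) (use AE in eventually_elim, simp)
  have "hl_integral t \<alpha> A (l # ls) I = (LINT \<theta>|torus I. R \<theta>)"
    unfolding hl_integral_def by (rule integral_cong_AE[OF meas borel_measurable_integrable[OF R] AE])
  also have "\<dots> = (\<Sum>e\<in>A. c e * hl_integral t \<alpha> (A - {e}) ls I) + (\<Sum>i\<in>I. LINT \<theta>|torus I. B i \<theta>)"
    unfolding R_def hl_integral_def using B(1) IH1
    by (simp add: hl_integrable_def)
  also have "(\<Sum>i\<in>I. LINT \<theta>|torus I. B i \<theta>) =
    (\<Sum>i\<in>I. (\<Sum>e\<in>{1,-1}-A. residue_coeff t \<alpha> A l e * hl_integral t \<alpha> (insert e A) ls (I - {i})) / 2)"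
    by (intro sum.cong refl B(2))
  finally show "hl_integral t \<alpha> A (l # ls) I =
      (\<Sum>e\<in>A. e ^ l * (\<Prod>e'\<in>A-{e}. (e - t * e') / (e - e')) * hl_integral t \<alpha> (A - {e}) ls I) +
      (\<Sum>i\<in>I. (\<Sum>e\<in>{1,-1}-A. residue_coeff t \<alpha> A l e * hl_integral t \<alpha> (insert e A) ls (I - {i})) / 2)"
    unfolding c_def .
qed

section \<open>Solving the recursion\<close>

text \<open>
  In this normalisation neither the number of variables nor the power of \<open>1 - t\<close> appears in the
  closed forms.
\<close>

definition hl_normalised ::
  "complex \<Rightarrow> complex \<Rightarrow> complex set \<Rightarrow> nat list \<Rightarrow> nat set \<Rightarrow> complex" where
  "hl_normalised t \<alpha> A lam I = (1 - t) ^ card I / (2 ^ card I * fact (card I)) * hl_integral t \<alpha> A lam I"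

text \<open>
  The factor \<open>d\<close> stands for \<open>1\<close> or one of \<open>1 \<plusminus> \<alpha>\<close>, \<open>1 - \<alpha>\<^sup>2\<close>: the closed forms are known only after
  multiplication by it, and dividing would exclude \<open>\<alpha> = \<plusminus>1\<close>. All \<open>i \<in> I\<close> contribute equally, and
  their number cancels against the normalisation.
\<close>

lemma hl_normalised_Cons:
  assumes t: "norm t < 1" and A: "A \<subseteq> {1,-1}" and I: "finite I"
    and ls: "\<And>k. k \<in> set ls \<Longrightarrow> k \<le> l"
    and IH1: "\<And>e. e \<in> A \<Longrightarrow> hl_integrable t \<alpha> (A - {e}) ls I"
    and IH2: "\<And>i e. i \<in> I \<Longrightarrow> e \<in> {1,-1} - A \<Longrightarrow> hl_integrable t \<alpha> (insert e A) ls (I - {i})"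
    and val: "\<And>i e. i \<in> I \<Longrightarrow> e \<in> {1,-1} - A \<Longrightarrow>
      d * ((1 - \<alpha> * e) * ((\<Prod>e'\<in>A. (1 - e' * e) / (1 - t * e' * e)) * hl_normalised t \<alpha> (insert e A) ls (I - {i}))) = v e"
  shows "d * hl_normalised t \<alpha> A (l # ls) I =
      d * (\<Sum>e\<in>A. e ^ l * (\<Prod>e'\<in>A-{e}. (e - t * e') / (e - e')) * hl_normalised t \<alpha> (A - {e}) ls I) +
      (if I = {} then 0 else (\<Sum>e\<in>{1,-1}-A. e ^ l * (1 - \<alpha> * e) * v e) / 4)"
proof -
  define c where "c = (\<lambda>m. (1 - t) ^ m / (2 ^ m * fact m) :: complex)"
  have t1: "1 - t \<noteq> 0" using t by auto
  have summand: "d * (c (card I) * (residue_coeff t \<alpha> A l e * hl_integral t \<alpha> (insert e A) ls (I - {i})))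
      = e ^ l * (1 - \<alpha> * e) * v e / (2 * of_nat (card I))" if i: "i \<in> I" and e: "e \<in> {1,-1} - A" for i e
  proof -
    obtain m where m: "card I = Suc m" "card (I - {i}) = m"
      using i I by (metis card_Suc_Diff1)
    define P where "P = (\<Prod>e'\<in>A. (1 - e' * e) / (1 - t * e' * e))"
    define X where "X = hl_integral t \<alpha> (insert e A) ls (I - {i})"
    have "c (Suc m) = c m * ((1 - t) / (2 * of_nat (Suc m)))"
      by (simp add: c_def field_simps)
    then have "d * (c (card I) * (residue_coeff t \<alpha> A l e * X))
       = d * (c m * ((1 - t) / (2 * of_nat (Suc m))) * (e ^ l * P * ((1 - \<alpha> * e)\<^sup>2 / (1 - t)) * X))"
      unfolding m(1) residue_coeff_def P_def by simp
    also have "\<dots> = e ^ l * (1 - \<alpha> * e) * (d * ((1 - \<alpha> * e) * (P * (c m * X)))) / (2 * of_nat (Suc m))"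
      using t1 by (simp add: power2_eq_square del: of_nat_Suc)
    also have "d * ((1 - \<alpha> * e) * (P * (c m * X))) = v e"
      using val[OF i e] by (simp add: hl_normalised_def c_def m(2) P_def X_def)
    finally show ?thesis by (simp add: X_def m(1) del: of_nat_Suc)
  qed
  have N: "hl_normalised t \<alpha> B ls I = c (card I) * hl_integral t \<alpha> B ls I" for B ls
    by (simp add: hl_normalised_def c_def)
  have rec: "hl_integral t \<alpha> A (l # ls) I =
      (\<Sum>e\<in>A. e ^ l * (\<Prod>e'\<in>A-{e}. (e - t * e') / (e - e')) * hl_integral t \<alpha> (A - {e}) ls I) +
      (\<Sum>i\<in>I. (\<Sum>e\<in>{1,-1}-A. residue_coeff t \<alpha> A l e * hl_integral t \<alpha> (insert e A) ls (I - {i})) / 2)"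
    by (rule hl_integral_Cons(2)[OF t A I]) (fact ls IH1 IH2)+
  have "d * (c (card I) * hl_integral t \<alpha> A (l # ls) I)
    = d * (\<Sum>e\<in>A. e ^ l * (\<Prod>e'\<in>A-{e}. (e - t * e') / (e - e')) * (c (card I) * hl_integral t \<alpha> (A - {e}) ls I)) +
      (\<Sum>i\<in>I. (\<Sum>e\<in>{1,-1}-A. d * (c (card I) * (residue_coeff t \<alpha> A l e * hl_integral t \<alpha> (insert e A) ls (I - {i})))) / 2)"
    unfolding rec
    by (simp add: distrib_left sum_distrib_left mult_ac)
  also have "(\<Sum>i\<in>I. (\<Sum>e\<in>{1,-1}-A. d * (c (card I) * (residue_coeff t \<alpha> A l e * hl_integral t \<alpha> (insert e A) ls (I - {i})))) / 2)
     = (\<Sum>i\<in>I. (\<Sum>e\<in>{1,-1}-A. e ^ l * (1 - \<alpha> * e) * v e / (2 * of_nat (card I))) / 2)"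
    by (intro sum.cong refl arg_cong2[of _ _ _ _ "(/)"] summand)
  also have "\<dots> = (if I = {} then 0 else (\<Sum>e\<in>{1,-1}-A. e ^ l * (1 - \<alpha> * e) * v e) / 4)"
    using I by (simp add: sum_divide_distrib[symmetric])
  finally show ?thesis unfolding N .
qed

definition odd_parts :: "nat list \<Rightarrow> nat" where "odd_parts lam = length (filter odd lam)"
definition even_parts :: "nat list \<Rightarrow> nat" where "even_parts lam = length (filter even lam)"

text \<open>
  The solution of the recursion in its four components. Only numbers of odd and even parts enter,
  because each step multiplies by \<open>(\<plusminus>1) ^ l\<close>.
\<close>

definition closed_form :: "complex \<Rightarrow> complex \<Rightarrow> complex set \<Rightarrow> nat list \<Rightarrow> nat set \<Rightarrow> bool" where
  "closed_form t \<alpha> A lam I \<longleftrightarrow> hl_integrable t \<alpha> A lam I \<and>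
    (let p = (- \<alpha>) ^ odd_parts lam; q = (- \<alpha>) ^ even_parts lam; X = hl_normalised t \<alpha> A lam I in
      (A = {} \<longrightarrow> 2 * X = p + q) \<and>
      (A = {1} \<longrightarrow> (1 - \<alpha>) * X = p + q) \<and>
      (A = {-1} \<longrightarrow> (1 + \<alpha>) * X = p - q) \<and>
      (A = {1,-1} \<longrightarrow> (1 - \<alpha>\<^sup>2) * X = (1 + t) * (p - q)))"

lemma hl_integral_empty: "hl_integrable t \<alpha> {} [] {}" "hl_normalised t \<alpha> {} [] {} = 1"
proof -
  have f: "hl_integrand t \<alpha> {} [] {} = (\<lambda>x. 1)"
    by (simp add: fun_eq_iff hl_integrand_def weight_def)
  interpret finite_measure "torus {}" by (rule finite_measure_torus) simp
  show "hl_integrable t \<alpha> {} [] {}" unfolding hl_integrable_def f by simp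
  have "measure (torus {}) (space (torus {})) = 1"
    by (simp add: PiM_empty measure_def)
  then show "hl_normalised t \<alpha> {} [] {} = 1"
    unfolding hl_normalised_def hl_integral_def f by simp
qed

text \<open>
  With \<open>p\<close>, \<open>q\<close> the powers of \<open>-\<alpha>\<close> for the remaining parts, an even new part turns \<open>q\<close> into \<open>- \<alpha> q\<close>
  and an odd one turns \<open>p\<close> into \<open>- \<alpha> p\<close>; each case is then a linear identity in \<open>p\<close> and \<open>q\<close>.
\<close>

lemma hl_integral_closed_form:
  assumes t: "norm t < 1"
  shows "sorted_wrt (\<ge>) lam \<Longrightarrow> A \<subseteq> {1,-1} \<Longrightarrow> finite I \<Longrightarrow> card A + 2 * card I = length lam \<Longrightarrow>
    closed_form t \<alpha> A lam I"
proof (induction lam arbitrary: A I)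
  case Nil
  then have "A = {}" "I = {}" using finite_subset[of A "{1,-1}"] by auto
  then show ?case
    using hl_integral_empty by (simp add: closed_form_def odd_parts_def even_parts_def)
next
  case (Cons l ls)
  have t1: "1 + t \<noteq> 0" using one_minus_neq[OF t, of "-1"] by simp
  have finA: "finite A" using Cons.prems(2) by (rule finite_subset) simp
  have ls: "k \<le> l" if "k \<in> set ls" for k using Cons.prems(1) that by simp
  have sorted: "sorted_wrt (\<ge>) ls" using Cons.prems(1) by simp
  define p where "p = (- \<alpha>) ^ odd_parts ls"
  define q where "q = (- \<alpha>) ^ even_parts ls"
  have IHA: "closed_form t \<alpha> (A - {e}) ls I" if "e \<in> A" for e
  proof (rule Cons.IH[OF sorted])
    have "card A = Suc (card (A - {e}))" using that finA by (metis card_Suc_Diff1)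
    then show "card (A - {e}) + 2 * card I = length ls" using Cons.prems(4) by simp
  qed (use Cons.prems in auto)
  have IHI: "closed_form t \<alpha> (insert e A) ls (I - {i})" if "i \<in> I" "e \<in> {1,-1} - A" for i e
  proof (rule Cons.IH[OF sorted])
    have "card I = Suc (card (I - {i}))" using that Cons.prems(3) by (metis card_Suc_Diff1)
    then show "card (insert e A) + 2 * card (I - {i}) = length ls" using Cons.prems(4) that finA by simp
  qed (use Cons.prems that in auto)
  note cf = closed_form_def Let_def p_def[symmetric] q_def[symmetric]
  have int: "hl_integrable t \<alpha> (A - {e}) ls I" if "e \<in> A" for e using IHA[OF that] by (simp add: cf)
  have int': "hl_integrable t \<alpha> (insert e A) ls (I - {i})" if "i \<in> I" "e \<in> {1,-1} - A" for i e
    using IHI[OF that] by (simp add: cf)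
  have integrable: "hl_integrable t \<alpha> A (l # ls) I"
    by (rule hl_integral_Cons(1)[OF t Cons.prems(2,3) ls int int'])
  have rec: "d * hl_normalised t \<alpha> A (l # ls) I =
      d * (\<Sum>e\<in>A. e ^ l * (\<Prod>e'\<in>A-{e}. (e - t * e') / (e - e')) * hl_normalised t \<alpha> (A - {e}) ls I) +
      (if I = {} then 0 else (\<Sum>e\<in>{1,-1}-A. e ^ l * (1 - \<alpha> * e) * v e) / 4)"
    if "\<And>i e. i \<in> I \<Longrightarrow> e \<in> {1,-1} - A \<Longrightarrow>
      d * ((1 - \<alpha> * e) * ((\<Prod>e'\<in>A. (1 - e' * e) / (1 - t * e' * e)) * hl_normalised t \<alpha> (insert e A) ls (I - {i}))) = v e"
    for d v
    by (rule hl_normalised_Cons[OF t Cons.prems(2,3)]) (fact ls int int' that)+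
  define X where "X = hl_normalised t \<alpha> A (l # ls) I"
  define P where "P = (- \<alpha>) ^ odd_parts (l # ls)"
  define Q where "Q = (- \<alpha>) ^ even_parts (l # ls)"
  have PQ: "P = (if even l then p else - \<alpha> * p)" "Q = (if even l then - \<alpha> * q else q)"
    by (simp_all add: P_def Q_def p_def q_def odd_parts_def even_parts_def)
  have sgn: "(-1 :: complex) ^ l = (if even l then 1 else -1)" by simp
  \<comment> \<open>Without variables there is no residue to add, and the formula for it gives \<open>0\<close>.\<close>
  have empty_pq: "p = q" if "I = {}" "A = {1} \<or> A = {-1}"
  proof -
    have "ls = []" using Cons.prems(4) that by auto
    then show ?thesis by (simp add: p_def q_def odd_parts_def even_parts_def)
  qed
  have "A = {} \<or> A = {1} \<or> A = {-1} \<or> A = {1,-1}" using Cons.prems(2) by auto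
  moreover have "2 * X = P + Q" if A: "A = {}"
  proof -
    have "I \<noteq> {}" using Cons.prems(4) A by auto
    define v where "v = (\<lambda>e::complex. if e = 1 then p + q else p - q)"
    have "1 * X = 1 * (\<Sum>e\<in>A. e ^ l * (\<Prod>e'\<in>A-{e}. (e - t * e') / (e - e')) * hl_normalised t \<alpha> (A - {e}) ls I) +
      (if I = {} then 0 else (\<Sum>e\<in>{1,-1}-A. e ^ l * (1 - \<alpha> * e) * v e) / 4)"
      unfolding X_def
    proof (rule rec)
      fix i e assume "i \<in> I" "e \<in> {1,-1} - A"
      then show "1 * ((1 - \<alpha> * e) * ((\<Prod>e'\<in>A. (1 - e' * e) / (1 - t * e' * e)) * hl_normalised t \<alpha> (insert e A) ls (I - {i}))) = v e"
        using IHI[of i e] A by (auto simp: cf v_def)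
    qed
    then have "X = ((1 - \<alpha>) * (p + q) + (-1) ^ l * (1 + \<alpha>) * (p - q)) / 4"
      using \<open>I \<noteq> {}\<close> A by (simp add: v_def)
    then have "2 * X = 2 * (((1 - \<alpha>) * (p + q) + (-1) ^ l * (1 + \<alpha>) * (p - q)) / 4)" by (simp only:)
    also have "\<dots> = P + Q" unfolding PQ sgn by (auto simp: field_simps)
    finally show ?thesis .
  qed
  moreover have "(1 - \<alpha>) * X = P + Q" if A: "A = {1}"
  proof -
    have IH0: "hl_normalised t \<alpha> {} ls I = (p + q) / 2" using IHA[of 1] A by (simp add: cf field_simps)
    have "(1 - \<alpha>) * X = (1 - \<alpha>) * (\<Sum>e\<in>A. e ^ l * (\<Prod>e'\<in>A-{e}. (e - t * e') / (e - e')) * hl_normalised t \<alpha> (A - {e}) ls I) +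
      (if I = {} then 0 else (\<Sum>e\<in>{1,-1}-A. e ^ l * (1 - \<alpha> * e) * (2 * (p - q))) / 4)"
      unfolding X_def
    proof (rule rec)
      fix i e assume ie: "i \<in> I" "e \<in> {1,-1} - A"
      have e: "e = -1" using ie A by auto
      have w: "(1 - \<alpha>\<^sup>2) * hl_normalised t \<alpha> {-1,1} ls (I - {i}) = (1 + t) * (p - q)"
        using IHI[OF ie] A e by (simp add: cf insert_commute)
      have pr: "(\<Prod>e'\<in>A. (1 - e' * e) / (1 - t * e' * e)) = 2 / (1 + t)"
        unfolding e A by simp
      have dist: "(1 - \<alpha>) * ((1 - \<alpha> * e) * (r * N)) = r * ((1 - \<alpha>\<^sup>2) * N)" for r N
        unfolding e by (simp add: power2_eq_square algebra_simps)
      have "(1 - \<alpha>) * ((1 - \<alpha> * e) * ((\<Prod>e'\<in>A. (1 - e' * e) / (1 - t * e' * e)) * hl_normalised t \<alpha> (insert e A) ls (I - {i})))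
         = 2 / (1 + t) * ((1 - \<alpha>\<^sup>2) * hl_normalised t \<alpha> {-1,1} ls (I - {i}))"
        unfolding pr dist unfolding e A by (rule refl)
      then show "(1 - \<alpha>) * ((1 - \<alpha> * e) * ((\<Prod>e'\<in>A. (1 - e' * e) / (1 - t * e' * e)) * hl_normalised t \<alpha> (insert e A) ls (I - {i}))) = 2 * (p - q)"
        unfolding w using t1 by simp
    qed
    also have "\<dots> = (1 - \<alpha>) * (p + q) / 2 + (-1) ^ l * (1 + \<alpha>) * (p - q) / 2"
    proof -
      have new: "{1, -1} - A = {-1::complex}" using A by auto
      have S: "(\<Sum>e\<in>A. e ^ l * (\<Prod>e'\<in>A-{e}. (e - t * e') / (e - e')) * hl_normalised t \<alpha> (A - {e}) ls I) = (p + q) / 2"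
        unfolding A using IH0 by simp
      have D: "(if I = {} then 0 else (\<Sum>e\<in>{1,-1}-A. e ^ l * (1 - \<alpha> * e) * (2 * (p - q))) / 4)
          = (-1) ^ l * (1 + \<alpha>) * (p - q) / 2"
        unfolding new using empty_pq A by (auto simp: field_simps)
      show ?thesis unfolding S D by simp
    qed
    also have "\<dots> = P + Q" unfolding PQ sgn by (auto simp: field_simps)
    finally show ?thesis .
  qed
  moreover have "(1 + \<alpha>) * X = P - Q" if A: "A = {-1}"
  proof -
    have IH0: "hl_normalised t \<alpha> {} ls I = (p + q) / 2" using IHA[of "-1"] A by (simp add: cf field_simps)
    have "(1 + \<alpha>) * X = (1 + \<alpha>) * (\<Sum>e\<in>A. e ^ l * (\<Prod>e'\<in>A-{e}. (e - t * e') / (e - e')) * hl_normalised t \<alpha> (A - {e}) ls I) +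
      (if I = {} then 0 else (\<Sum>e\<in>{1,-1}-A. e ^ l * (1 - \<alpha> * e) * (2 * (p - q))) / 4)"
      unfolding X_def
    proof (rule rec)
      fix i e assume ie: "i \<in> I" "e \<in> {1,-1} - A"
      have e: "e = 1" using ie A by auto
      have w: "(1 - \<alpha>\<^sup>2) * hl_normalised t \<alpha> {1,-1} ls (I - {i}) = (1 + t) * (p - q)"
        using IHI[OF ie] A e by (simp add: cf)
      have pr: "(\<Prod>e'\<in>A. (1 - e' * e) / (1 - t * e' * e)) = 2 / (1 + t)"
        unfolding e A by simp
      have dist: "(1 + \<alpha>) * ((1 - \<alpha> * e) * (r * N)) = r * ((1 - \<alpha>\<^sup>2) * N)" for r N
        unfolding e by (simp add: power2_eq_square algebra_simps)
      have "(1 + \<alpha>) * ((1 - \<alpha> * e) * ((\<Prod>e'\<in>A. (1 - e' * e) / (1 - t * e' * e)) * hl_normalised t \<alpha> (insert e A) ls (I - {i})))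
         = 2 / (1 + t) * ((1 - \<alpha>\<^sup>2) * hl_normalised t \<alpha> {1,-1} ls (I - {i}))"
        unfolding pr dist unfolding e A by (rule refl)
      then show "(1 + \<alpha>) * ((1 - \<alpha> * e) * ((\<Prod>e'\<in>A. (1 - e' * e) / (1 - t * e' * e)) * hl_normalised t \<alpha> (insert e A) ls (I - {i}))) = 2 * (p - q)"
        unfolding w using t1 by simp
    qed
    also have "\<dots> = (-1) ^ l * (1 + \<alpha>) * (p + q) / 2 + (1 - \<alpha>) * (p - q) / 2"
    proof -
      have new: "{1, -1} - A = {1::complex}" using A by auto
      have S: "(\<Sum>e\<in>A. e ^ l * (\<Prod>e'\<in>A-{e}. (e - t * e') / (e - e')) * hl_normalised t \<alpha> (A - {e}) ls I) = (-1) ^ l * ((p + q) / 2)"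
        unfolding A using IH0 by simp
      have D: "(if I = {} then 0 else (\<Sum>e\<in>{1,-1}-A. e ^ l * (1 - \<alpha> * e) * (2 * (p - q))) / 4)
          = (1 - \<alpha>) * (p - q) / 2"
        unfolding new using empty_pq A by (auto simp: field_simps)
      show ?thesis unfolding S D by simp
    qed
    also have "\<dots> = P - Q" unfolding PQ sgn by (auto simp: field_simps)
    finally show ?thesis .
  qed
  moreover have "(1 - \<alpha>\<^sup>2) * X = (1 + t) * (P - Q)" if A: "A = {1,-1}"
  proof -
    have A1: "A - {1} = {-1}" "A - {-1} = {1}" "{1,-1} - A = {}" using A by auto
    have IH1: "(1 + \<alpha>) * hl_normalised t \<alpha> {-1} ls I = p - q" using IHA[of 1] A A1 by (simp add: cf)
    have IH2: "(1 - \<alpha>) * hl_normalised t \<alpha> {1} ls I = p + q" using IHA[of "-1"] A A1 by (simp add: cf)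
    have "1 * X = 1 * (\<Sum>e\<in>A. e ^ l * (\<Prod>e'\<in>A-{e}. (e - t * e') / (e - e')) * hl_normalised t \<alpha> (A - {e}) ls I) +
      (if I = {} then 0 else (\<Sum>e\<in>{1,-1}-A. e ^ l * (1 - \<alpha> * e) * 0) / 4)"
      unfolding X_def by (rule rec) (simp add: A1)
    also have "\<dots> = (\<Sum>e\<in>{1,-1}. e ^ l * (\<Prod>e'\<in>A-{e}. (e - t * e') / (e - e')) * hl_normalised t \<alpha> (A - {e}) ls I)"
      unfolding A1 by (simp add: A)
    also have "\<dots> = (1 + t) / 2 * hl_normalised t \<alpha> {-1} ls I + (-1) ^ l * ((- 1 - t) / (-2)) * hl_normalised t \<alpha> {1} ls I"
      by (simp add: A1)
    also have "(- 1 - t) / (-2) = (1 + t) / 2" by (simp add: field_simps)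
    finally have X: "X = (1 + t) / 2 * hl_normalised t \<alpha> {-1} ls I + (-1) ^ l * ((1 + t) / 2) * hl_normalised t \<alpha> {1} ls I" by simp
    have "(1 - \<alpha>\<^sup>2) * X = (1 + t) / 2 * ((1 - \<alpha>) * ((1 + \<alpha>) * hl_normalised t \<alpha> {-1} ls I) +
        (-1) ^ l * (1 + \<alpha>) * ((1 - \<alpha>) * hl_normalised t \<alpha> {1} ls I))"
    proof -
      have "(1 - \<alpha>\<^sup>2) * (r * Y + (-1) ^ l * r * Z) =
          r * ((1 - \<alpha>) * ((1 + \<alpha>) * Y) + (-1) ^ l * (1 + \<alpha>) * ((1 - \<alpha>) * Z))" for r Y Z
        by (simp add: power2_eq_square algebra_simps)
      then show ?thesis unfolding X .
    qed
    also have "\<dots> = (1 + t) * (((1 - \<alpha>) * (p - q) + (-1) ^ l * (1 + \<alpha>) * (p + q)) / 2)"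
      unfolding IH1 IH2 by simp
    also have "((1 - \<alpha>) * (p - q) + (-1) ^ l * (1 + \<alpha>) * (p + q)) / 2 = P - Q"
      unfolding PQ sgn by (auto simp: field_simps)
    finally show ?thesis .
  qed
  ultimately show ?case
    using integrable unfolding closed_form_def Let_def P_def[symmetric] Q_def[symmetric] X_def[symmetric]
    by auto
qed

section \<open>The original integral\<close>

lemma torus_integral_eq: "torus_integral n f = (LINT \<theta>|torus {..<n}. f (torus_point \<theta>))"
  by (simp add: torus_integral_def torus_point_def[abs_def] circ_def)

text \<open>
  The parameters \<open>\<plusminus>s\<close> combine to \<open>1 - t x\<^sup>\<plusminus>\<^sup>2\<close>, and the parameter \<open>-1\<close> cancels against
  \<open>1 - x\<^sup>\<plusminus>\<^sup>2\<close>. After this cancellation the factor is continuous on the circle, so it is the value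
  that \<open>remove_sings\<close> assigns there, at \<open>-1\<close> as well.
\<close>

lemma koornwinder_density_eq_weight:
  assumes t: "norm t < 1" and s: "s\<^sup>2 = t" and x: "\<And>j. norm (x j) = 1"
  shows "koornwinder_density n x t (-1) s (-s) t = weight {1} t {..<n} x / (2 ^ n * fact n)"
proof -
  have ns: "norm s < 1"
  proof (rule ccontr)
    assume "\<not> norm s < 1"
    then have "1 \<le> (norm s)\<^sup>2" by (simp add: one_le_power)
    then show False using t by (simp add: s[symmetric] norm_power)
  qed
  define f where "f = (\<lambda>u. pm1 1 (u\<^sup>2) / (pm1 t u * pm1 (-1) u * pm1 s u * pm1 (-s) u))"
  define g where "g = (\<lambda>u. pm1 1 u / (pm1 t u * pm1 t (u\<^sup>2)))"
  have pm1s: "pm1 s u * pm1 (-s) u = pm1 t (u\<^sup>2)" for u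
    by (simp add: pm1_def s[symmetric] power2_eq_square algebra_simps)
  have num: "pm1 1 (u\<^sup>2) = pm1 1 u * pm1 (-1) u" for u
    by (simp add: pm1_def power2_eq_square algebra_simps)
  have fg: "f u = g u" if "u \<noteq> 0" "u \<noteq> -1" for u
  proof -
    have "pm1 (-1) u = (1 + u) * (1 + u) / u" using that by (simp add: pm1_def field_simps)
    moreover have "1 + u \<noteq> 0" using that by (auto simp: eq_neg_iff_add_eq_0 add.commute)
    ultimately have "pm1 (-1) u \<noteq> 0" using that by simp
    then show ?thesis
      by (simp add: f_def g_def num mult.assoc pm1s)
  qed
  have sing: "remove_sings f u = g u" if u: "norm u = 1" for u
  proof (rule remove_sings_eqI)
    have u0: "u \<noteq> 0" using u by auto
    have nz: "pm1 t u \<noteq> 0" "pm1 t (u\<^sup>2) \<noteq> 0"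
      using one_minus_neq[OF t, of u] one_minus_neq[OF t, of "inverse u"]
        one_minus_neq[OF t, of "u\<^sup>2"] one_minus_neq[OF t, of "inverse (u\<^sup>2)"] u
      by (auto simp: pm1_def norm_inverse norm_power)
    have "isCont g u"
      unfolding g_def using nz u0 unfolding pm1_def by (intro continuous_intros) auto
    then have "(g \<longlongrightarrow> g u) (at u)" by (simp add: isCont_def)
    moreover have "\<forall>\<^sub>F v in at u. g v = f v"
    proof -
      have "\<forall>\<^sub>F v in at u. v \<noteq> 0" "\<forall>\<^sub>F v in at u. v \<noteq> -1"
        by (rule eventually_neq_at_within)+
      then show ?thesis by eventually_elim (simp add: fg)
    qed
    ultimately show "(f \<longlongrightarrow> g u) (at u)" by (rule Lim_transform_eventually)
  qed
  have "{i \<in> {..<n}. i < j} = {..<j}" if "j < n" for j using that by auto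
  then have "(\<Prod>j<n. \<Prod>i\<in>{i \<in> {..<n}. i < j}. pair_weight t (x i) (x j))
      = (\<Prod>j<n. \<Prod>i<j. pm2 1 (x i) (x j) / pm2 t (x i) (x j))"
    by (intro prod.cong) (auto simp: pair_weight_def)
  moreover have "single_weight {1} t (x i) = remove_sings f (x i)" for i
    unfolding sing[OF x] by (simp add: single_weight_def g_def)
  ultimately show ?thesis
    unfolding koornwinder_density_def f_def[symmetric] weight_def by simp
qed

definition pm_index :: "nat \<Rightarrow> nat \<Rightarrow> complex + nat \<times> bool" where
  "pm_index n k = (if k < 2 * n then Inr (k div 2, even k) else Inl 1)"

lemma pm_index:
  "inj_on (pm_index n) {..<2 * n + 1}" "pm_index n ` {..<2 * n + 1} = arg_index {1} {..<n}"
  "pm_args_one n x = (\<lambda>k. args x (pm_index n k))"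
proof -
  show inj: "inj_on (pm_index n) {..<2 * n + 1}"
  proof (rule inj_onI)
    fix j k assume "j \<in> {..<2 * n + 1}" "k \<in> {..<2 * n + 1}" "pm_index n j = pm_index n k"
    then show "j = k"
      by (auto simp: pm_index_def split: if_splits) (metis div_mult_mod_eq even_iff_mod_2_eq_zero odd_iff_mod_2_eq_one)
  qed
  show "pm_index n ` {..<2 * n + 1} = arg_index {1} {..<n}"
  proof (rule card_subset_eq)
    show "pm_index n ` {..<2 * n + 1} \<subseteq> arg_index {1} {..<n}"
      by (auto simp: pm_index_def arg_index_def)
    have "card (arg_index {1} {..<n}) = (\<Sum>q\<in>arg_index {1} {..<n}. 1)" by simp
    also have "\<dots> = 2 * n + 1" by (subst sum_arg_index) auto
    finally have "card (arg_index {1} {..<n}) = 2 * n + 1" .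
    then show "card (pm_index n ` {..<2 * n + 1}) = card (arg_index {1} {..<n})"
      unfolding card_image[OF inj] by simp
  qed simp
  show "pm_args_one n x = (\<lambda>k. args x (pm_index n k))"
    by (auto simp: pm_args_one_def pm_index_def fun_eq_iff)
qed

lemma hl_sum_pm_args_one:
  "hl_sum t lam {..<2 * n + 1} (pm_args_one n x) = hl_sum t lam (arg_index {1} {..<n}) (args x)"
  using hl_sum_reindex[OF pm_index(1), of t lam n "args x"] unfolding pm_index(2,3) by (rule sym)

lemma phi_eq_t_fact: "t \<noteq> 1 \<Longrightarrow> phi t r = t_fact t r * (1 - t) ^ r"
  by (simp add: phi_def t_fact_def t_number_def prod_dividef)

theorem theorem4p6:
  fixes n :: nat and lam :: "nat list" and t s \<alpha> :: complex
  assumes "norm t < 1"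
    and "s\<^sup>2 = t"
    and "is_partition (2 * n + 1) lam"
  shows "(1 - \<alpha>) / torus_integral n (\<lambda>x. koornwinder_density n x t (-1) s (-s) t) *
           torus_integral n (\<lambda>x.
             hall_littlewood t lam (pm_args_one n x) *
             koornwinder_density n x t (-1) s (-s) t *
             (\<Prod>i<n. pm1 \<alpha> (x i)))
         = phi t (2 * n + 1) / (v_part t lam * (1 - t) ^ (2 * n + 1)) *
           ((- \<alpha>) ^ length (filter odd lam) + (- \<alpha>) ^ length (filter even lam))"
proof -
  note t = assms(1)
  have t1: "t \<noteq> 1" "1 - t \<noteq> 0" using t by auto
  define N where "N = 2 * n + 1"
  have len: "length lam = N" and sorted: "sorted_wrt (\<ge>) lam"
    using assms(3) by (auto simp: is_partition_def N_def)
  define K where "K = (2 ^ n * fact n :: complex)"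
  have K: "K \<noteq> 0" by (simp add: K_def)
  have density: "koornwinder_density n (torus_point \<theta>) t (-1) s (-s) t = weight {1} t {..<n} (torus_point \<theta>) / K" for \<theta>
    unfolding K_def by (rule koornwinder_density_eq_weight[OF t assms(2) norm_torus_point])
  have closed: "(1 - \<beta>) * ((1 - t) ^ n * hl_integral t \<beta> {1} mu {..<n})
      = K * ((- \<beta>) ^ odd_parts mu + (- \<beta>) ^ even_parts mu)"
    if mu: "sorted_wrt (\<ge>) mu" "length mu = N" for \<beta> mu
  proof -
    have "closed_form t \<beta> {1} mu {..<n}"
      by (rule hl_integral_closed_form[OF t mu(1)]) (auto simp: mu(2) N_def)
    then have "(1 - \<beta>) * hl_normalised t \<beta> {1} mu {..<n} = (- \<beta>) ^ odd_parts mu + (- \<beta>) ^ even_parts mu"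
      by (simp add: closed_form_def Let_def)
    moreover have "hl_normalised t \<beta> {1} mu {..<n} = (1 - t) ^ n / K * hl_integral t \<beta> {1} mu {..<n}"
      by (simp add: hl_normalised_def K_def)
    ultimately show ?thesis using K by (simp add: field_simps)
  qed
  have inj: "AE \<theta> in torus {..<n}. inj_on (args (torus_point \<theta>)) (arg_index {1} {..<n})"
    using AE_generic[OF finite_lessThan[of n]] by eventually_elim (auto intro!: generic_inj)
  define D where "D = (LINT \<theta>|torus {..<n}. weight {1} t {..<n} (torus_point \<theta>))"
  \<comment> \<open>The closed form for \<open>\<alpha> = 0\<close> and all parts \<open>0\<close> evaluates the norm of the density.\<close>
  have D: "t_fact t N * D * (1 - t) ^ n = K"
  proof -
    have "hl_integral t 0 {1} (replicate N 0) {..<n} = (LINT \<theta>|torus {..<n}. t_fact t N * weight {1} t {..<n} (torus_point \<theta>))"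
      unfolding hl_integral_def
    proof (rule integral_cong_AE)
      show "(\<lambda>\<theta>. hl_integrand t 0 {1} (replicate N 0) {..<n} (torus_point \<theta>)) \<in> borel_measurable (torus {..<n})"
        by (rule hl_integrand_measurable[OF torus_point_measurable])
      note [measurable] = weight_measurable[OF torus_point_measurable]
      show "(\<lambda>\<theta>. t_fact t N * weight {1} t {..<n} (torus_point \<theta>)) \<in> borel_measurable (torus {..<n})" by measurable
      show "AE \<theta> in torus {..<n}. hl_integrand t 0 {1} (replicate N 0) {..<n} (torus_point \<theta>) = t_fact t N * weight {1} t {..<n} (torus_point \<theta>)"
        using inj
      proof eventually_elim
        case (elim \<theta>)
        define Z where "Z = args (torus_point \<theta>) ` arg_index {1} {..<n}"
        have "0 \<notin> Z" by (auto simp: Z_def arg_index_def split: if_splits)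
        moreover have "card Z = N"
          using card_image[OF pm_index(1)[of n]] unfolding Z_def card_image[OF elim] pm_index(2) N_def
          by simp
        moreover have "finite Z" by (simp add: Z_def)
        ultimately have "hl_sum t (replicate N 0) Z (\<lambda>u. u) = t_fact t N"
          using hl_sum_zero_partition[of Z t] t1 by simp
        then have "hl_sum t (replicate N 0) (arg_index {1} {..<n}) (args (torus_point \<theta>)) = t_fact t N"
          unfolding Z_def hl_sum_image[OF elim] .
        then show ?case by (simp add: hl_integrand_def pm1_def)
      qed
    qed
    then have "hl_integral t 0 {1} (replicate N 0) {..<n} = t_fact t N * D" by (simp add: D_def)
    moreover have "(1 - t) ^ n * hl_integral t 0 {1} (replicate N 0) {..<n} = K"
      using closed[of "replicate N 0" 0] by (simp add: odd_parts_def even_parts_def N_def sorted_wrt_iff_nth_less)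
    ultimately show ?thesis by (simp add: mult_ac)
  qed
  have 1: "torus_integral n (\<lambda>x. koornwinder_density n x t (-1) s (-s) t) = D / K"
    by (simp add: torus_integral_eq density D_def)
  obtain F where F: "F \<in> mpoly_fun" "\<And>z. inj_on z {..<N} \<Longrightarrow> hl_sum t lam {..<N} z = F z"
    using hl_sum_mpoly_fun[OF finite_lessThan[of N], of t lam] by metis
  have hl: "hall_littlewood t lam z = F z / v_part t lam" for z
    by (rule hall_littlewood_eq[OF F(1)]) (simp add: len F(2))
  have pm_meas: "(\<lambda>\<theta>. pm_args_one n (torus_point \<theta>) k) \<in> borel_measurable (torus {..<n})" for k
    unfolding pm_index(3) by (rule args_measurable[OF torus_point_measurable])
  have 2: "torus_integral n (\<lambda>x. hall_littlewood t lam (pm_args_one n x) *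
             koornwinder_density n x t (-1) s (-s) t * (\<Prod>i<n. pm1 \<alpha> (x i)))
         = hl_integral t \<alpha> {1} lam {..<n} / (v_part t lam * K)"
  proof -
    have "torus_integral n (\<lambda>x. hall_littlewood t lam (pm_args_one n x) *
             koornwinder_density n x t (-1) s (-s) t * (\<Prod>i<n. pm1 \<alpha> (x i)))
        = (LINT \<theta>|torus {..<n}. hl_integrand t \<alpha> {1} lam {..<n} (torus_point \<theta>) / (v_part t lam * K))"
      unfolding torus_integral_eq density hl
    proof (rule integral_cong_AE)
      note [measurable] = hl_integrand_measurable[OF torus_point_measurable] weight_measurable[OF torus_point_measurable]
        mpoly_fun_measurable[OF F(1) pm_meas]
      show "(\<lambda>\<theta>. F (pm_args_one n (torus_point \<theta>)) / v_part t lam * (weight {1} t {..<n} (torus_point \<theta>) / K) *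
          (\<Prod>i<n. pm1 \<alpha> (torus_point \<theta> i))) \<in> borel_measurable (torus {..<n})"
        unfolding pm1_def by measurable
      show "(\<lambda>\<theta>. hl_integrand t \<alpha> {1} lam {..<n} (torus_point \<theta>) / (v_part t lam * K)) \<in> borel_measurable (torus {..<n})"
        by measurable
      show "AE \<theta> in torus {..<n}. F (pm_args_one n (torus_point \<theta>)) / v_part t lam * (weight {1} t {..<n} (torus_point \<theta>) / K) *
          (\<Prod>i<n. pm1 \<alpha> (torus_point \<theta> i)) = hl_integrand t \<alpha> {1} lam {..<n} (torus_point \<theta>) / (v_part t lam * K)"
        using inj
      proof eventually_elim
        case (elim \<theta>)
        have "inj_on (args (torus_point \<theta>) \<circ> pm_index n) {..<N}"
          unfolding N_def by (rule comp_inj_on[OF pm_index(1)]) (unfold pm_index(2), rule elim)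
        then have "inj_on (pm_args_one n (torus_point \<theta>)) {..<N}" unfolding pm_index(3) o_def .
        then have "F (pm_args_one n (torus_point \<theta>)) = hl_sum t lam (arg_index {1} {..<n}) (args (torus_point \<theta>))"
          using F(2) hl_sum_pm_args_one[of t lam n "torus_point \<theta>", folded N_def] by (simp only:)
        then show ?case by (simp add: hl_integrand_def)
      qed
    qed
    then show ?thesis by (simp add: hl_integral_def)
  qed
  have D0: "D \<noteq> 0" "t_fact t N \<noteq> 0" "(1 - t) ^ n \<noteq> 0" using D K by auto
  have DK: "D = K / (t_fact t N * (1 - t) ^ n)" using D D0 by (simp add: field_simps)
  have "(1 - \<alpha>) / (D / K) * (hl_integral t \<alpha> {1} lam {..<n} / (v_part t lam * K))
      = t_fact t N / (v_part t lam * K) * ((1 - \<alpha>) * ((1 - t) ^ n * hl_integral t \<alpha> {1} lam {..<n}))"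
    unfolding DK using K D0 by (simp add: field_simps)
  also have "\<dots> = t_fact t N / v_part t lam * ((- \<alpha>) ^ odd_parts lam + (- \<alpha>) ^ even_parts lam)"
    unfolding closed[OF sorted len] using K by simp
  also have "t_fact t N / v_part t lam = phi t N / (v_part t lam * (1 - t) ^ N)"
    using t1 by (simp add: phi_eq_t_fact)
  finally show ?thesis
    unfolding 1 2 N_def odd_parts_def even_parts_def .
qed

end
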